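(* Let $\mathcal C$ be a strict monoidal category with coequalizers, $\mathcal D$ a right $\mathcal C$-category with coequalizers, and $(A,X)$ a wreath in $\mathcal C$ with structure morphisms $\psi,\zeta,\sigma$, such that the associated $A$-ring $\mathfrak C=A\otimes X$ is compatible with the $\mathcal C$-category structure of $\mathcal D$. Then the category of right representations (right modules) in $\mathcal D$ over the $A$-ring $\mathfrak C$ is isomorphic to the category of right modules in $\mathcal D$ over the algebra $A\#_{\psi,\zeta,\sigma}X$ in $\mathcal C$, the wreath product of $A$ and $X$.
   Context: Identity morphisms in composites are denoted by the object. $A$ is an algebra with multiplication $m_A$ and unit $\eta_A$. A wreath $(A,X)$ in $\mathcal C$: an algebra $A$, an object $X$, and morphisms $\psi:X\otimes A\to A\otimes X$, $\zeta:X\otimes X\to A\otimes X$, $\sigma:\underline 1\to A\otimes X$ satisfying $\psi(X\otimes m_A)=(m_A\otimes X)(A\otimes\psi)(\psi\otimes A)$, $\psi(X\otimes\eta_A)=\eta_A\otimes X$; $(m_A\otimes X)(A\otimes\psi)(\zeta\otimes A)=(m_A\otimes X)(A\otimes\zeta)(\psi\otimes X)(X\otimes\psi)$; $(m_A\otimes X)(A\otimes\zeta)(\psi\otimes X)(X\otimes\zeta)=(m_A\otimes X)(A\otimes\zeta)(\zeta\otimes X)$; $(m_A\otimes X)(A\otimes\sigma)=(m_A\otimes X)(A\otimes\psi)(\sigma\otimes A)$; $(m_A\otimes X)(A\otimes\zeta)(\psi\otimes X)(X\otimes\sigma)=\eta_A\otimes X=(m_A\otimes X)(A\otimes\zeta)(\sigma\otimes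 X)$. The wreath product $A\#_{\psi,\zeta,\sigma}X$ is the object $A\otimes X$ with multiplication $(m_A\otimes X)(m_A\otimes\zeta)(A\otimes\psi\otimes X)$ and unit $\sigma$. Right $\mathcal C$-category (taken strict): a category $\mathcal D$ with a functor $\diamond:\mathcal D\times\mathcal C\to\mathcal D$, $(M\diamond X)\diamond Y=M\diamond(X\otimes Y)$, $M\diamond\underline 1=M$. A right module in $\mathcal D$ over an algebra $B$ of $\mathcal C$ is $M\in\mathcal D$ with an associative unital action $M\diamond B\to M$; these form $\mathcal D_B$. For $M\in\mathcal D_A$ and a left $A$-module $Y$, $q_{M,Y}:M\diamond Y\to M\diamond_AY$ is the coequalizer of the two morphisms $M\diamond A\diamond Y\rightrightarrows M\diamond Y$ ($\otimes_A$ when $\mathcal D=\mathcal C$). $X$ is left coflat (resp. $\mathcal D$-coflat) if $-\otimes X$ on $\mathcal C$ (resp. $-\diamond X$ on $\mathcal D$) preserves coequalizers. A left $A$-module $Y$ is $\mathcal D$-robust if $(M\diamond Z)\diamond_AY\to M\diamond(Z\otimes_AY)$ is an isomorphism for all $M\in\mathcal D$, $Z\in\mathcal C_A$; left robust is the case $\mathcal D=\mathcal C$. If $A$ is left coflat and $\mathcal D$-coflat, the $A$-bimodules that are left coflat, $\mathcal D$-coflat, left robust and $\mathcal D$-robust form a monoidal category ${}^{\mathcal D!}_A\mathcal C_A$ under $\otimes_A$ (unit $A$), and $\mathcal D_A$ is a right ${}^{\mathcal D!}_A\mathcal C_A$-category via $\diamond_A$. An $A$-ring in $\mathcal C$ compatible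 with $\mathcal D$ is an algebra $\mathfrak C$ in ${}^{\mathcal D!}_A\mathcal C_A$; a right module in $\mathcal D$ over it is $M\in\mathcal D_A$ with an associative unital action $M\diamond_A\mathfrak C\to M$ in $\mathcal D_A$. The $A$-ring $\mathfrak C=A\otimes X$ of the wreath has left action $m_A\otimes X$, right action $(m_A\otimes X)(A\otimes\psi)$, multiplication $m_{\mathfrak C}$ determined by $m_{\mathfrak C}\,q_{\mathfrak C,\mathfrak C}=(m_A\otimes X)(A\otimes\zeta)(m_A\otimes X\otimes X)(A\otimes\psi\otimes X)$ and unit $(m_A\otimes X)(A\otimes\sigma):A\to\mathfrak C$. It is compatible with $\mathcal D$ when $A$ and $X$ are left coflat and $\mathcal D$-coflat. *)

theory Defs
  imports Main
begin

section \<open>Categories\<close>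

record ('o, 'a) cat =
  Ob :: "'o set"
  Ar :: "'a set"
  Dom :: "'a \<Rightarrow> 'o"
  Cod :: "'a \<Rightarrow> 'o"
  Ide :: "'o \<Rightarrow> 'a"  (\<open>\<one>\<index>\<close>)
  Comp :: "'a \<Rightarrow> 'a \<Rightarrow> 'a"  (infixr \<open>\<cdot>\<index>\<close> 55)

definition Hom :: "('o, 'a, 'e) cat_scheme \<Rightarrow> 'o \<Rightarrow> 'o \<Rightarrow> 'a set" where
  "Hom C x y = {f \<in> Ar C. Dom C f = x \<and> Cod C f = y}"

locale category =
  fixes C :: "('o, 'a, 'e) cat_scheme" (structure)
  assumes dom_in: "f \<in> Ar C \<Longrightarrow> Dom C f \<in> Ob C"
    and cod_in: "f \<in> Ar C \<Longrightarrow> Cod C f \<in> Ob C"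
    and ide_in: "x \<in> Ob C \<Longrightarrow> \<one> x \<in> Hom C x x"
    and comp_in: "\<lbrakk>f \<in> Hom C x y; g \<in> Hom C y z\<rbrakk> \<Longrightarrow> g \<cdot> f \<in> Hom C x z"
    and comp_assoc: "\<lbrakk>f \<in> Hom C w x; g \<in> Hom C x y; h \<in> Hom C y z\<rbrakk>
      \<Longrightarrow> (h \<cdot> g) \<cdot> f = h \<cdot> (g \<cdot> f)"
    and comp_ide_left: "f \<in> Hom C x y \<Longrightarrow> \<one> y \<cdot> f = f"
    and comp_ide_right: "f \<in> Hom C x y \<Longrightarrow> f \<cdot> \<one> x = f"

locale cat_functor = C: category C + D: category D
  for C :: "('o, 'a, 'e) cat_scheme" and D :: "('p, 'b, 'f) cat_scheme" +
  fixes F\<^sub>o :: "'o \<Rightarrow> 'p" and F\<^sub>a :: "'a \<Rightarrow> 'b"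
  assumes map_ob: "x \<in> Ob C \<Longrightarrow> F\<^sub>o x \<in> Ob D"
    and map_ar: "f \<in> Hom C x y \<Longrightarrow> F\<^sub>a f \<in> Hom D (F\<^sub>o x) (F\<^sub>o y)"
    and map_ide: "x \<in> Ob C \<Longrightarrow> F\<^sub>a (\<one>\<^bsub>C\<^esub> x) = \<one>\<^bsub>D\<^esub> (F\<^sub>o x)"
    and map_comp: "\<lbrakk>f \<in> Hom C x y; g \<in> Hom C y z\<rbrakk>
      \<Longrightarrow> F\<^sub>a (g \<cdot>\<^bsub>C\<^esub> f) = F\<^sub>a g \<cdot>\<^bsub>D\<^esub> F\<^sub>a f"

definition isomorphic_categories ::
    "('o, 'a, 'e) cat_scheme \<Rightarrow> ('p, 'b, 'f) cat_scheme \<Rightarrow> bool" where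
  "isomorphic_categories C D \<longleftrightarrow>
    (\<exists>F\<^sub>o F\<^sub>a G\<^sub>o G\<^sub>a. cat_functor C D F\<^sub>o F\<^sub>a \<and> cat_functor D C G\<^sub>o G\<^sub>a \<and>
      (\<forall>x\<in>Ob C. G\<^sub>o (F\<^sub>o x) = x) \<and> (\<forall>f\<in>Ar C. G\<^sub>a (F\<^sub>a f) = f) \<and>
      (\<forall>y\<in>Ob D. F\<^sub>o (G\<^sub>o y) = y) \<and> (\<forall>g\<in>Ar D. F\<^sub>a (G\<^sub>a g) = g))"

definition iso_in :: "('o, 'a, 'e) cat_scheme \<Rightarrow> 'a \<Rightarrow> bool" where
  "iso_in C f \<longleftrightarrow> f \<in> Ar C \<and>
    (\<exists>g \<in> Hom C (Cod C f) (Dom C f).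
      g \<cdot>\<^bsub>C\<^esub> f = \<one>\<^bsub>C\<^esub> (Dom C f) \<and> f \<cdot>\<^bsub>C\<^esub> g = \<one>\<^bsub>C\<^esub> (Cod C f))"

definition is_coequalizer :: "('o, 'a, 'e) cat_scheme \<Rightarrow> 'a \<Rightarrow> 'a \<Rightarrow> 'a \<Rightarrow> bool" where
  "is_coequalizer C f g q \<longleftrightarrow>
    f \<in> Ar C \<and> g \<in> Hom C (Dom C f) (Cod C f) \<and> q \<in> Ar C \<and> Dom C q = Cod C f \<and>
    q \<cdot>\<^bsub>C\<^esub> f = q \<cdot>\<^bsub>C\<^esub> g \<and>
    (\<forall>h \<in> Ar C. Dom C h = Cod C f \<and> h \<cdot>\<^bsub>C\<^esub> f = h \<cdot>\<^bsub>C\<^esub> g \<longrightarrow>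
      (\<exists>!u. u \<in> Hom C (Cod C q) (Cod C h) \<and> u \<cdot>\<^bsub>C\<^esub> q = h))"

definition has_coequalizers :: "('o, 'a, 'e) cat_scheme \<Rightarrow> bool" where
  "has_coequalizers C \<longleftrightarrow>
    (\<forall>f \<in> Ar C. \<forall>g \<in> Hom C (Dom C f) (Cod C f). \<exists>q. is_coequalizer C f g q)"

definition coeq :: "('o, 'a, 'e) cat_scheme \<Rightarrow> 'a \<Rightarrow> 'a \<Rightarrow> 'a" where
  "coeq C f g = (SOME q. is_coequalizer C f g q)"

text \<open>\<open>factor C q h\<close> is the morphism \<open>u\<close> determined by \<open>u \<cdot> q = h\<close>; it is only used
  with \<open>q\<close> an epimorphism through which \<open>h\<close> factors.\<close>

definition factor :: "('o, 'a, 'e) cat_scheme \<Rightarrow> 'a \<Rightarrow> 'a \<Rightarrow> 'a" where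
  "factor C q h = (THE u. u \<in> Hom C (Cod C q) (Cod C h) \<and> u \<cdot>\<^bsub>C\<^esub> q = h)"


section \<open>Monoidal categories and right categories over them\<close>

text \<open>The data include associators and unitors, because the monoidal category of
  \<open>A\<close>-bimodules and its action on the category of right \<open>A\<close>-modules are not strict even when
  the categories they are built from are. Objects and arrows are tensored by different
  operations, the one for arrows carrying the subscript \<open>a\<close>; the identity of \<open>X\<close>, denoted
  \<open>X\<close> on paper, is \<open>\<one> X\<close>.\<close>

record ('o, 'a) moncat = "('o, 'a) cat" +
  tenO :: "'o \<Rightarrow> 'o \<Rightarrow> 'o"  (infixl \<open>\<otimes>\<index>\<close> 70)
  tenA :: "'a \<Rightarrow> 'a \<Rightarrow> 'a"  (infixl \<open>\<otimes>\<^sub>a\<index>\<close> 70)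
  unitO :: "'o"
  assoc :: "'o \<Rightarrow> 'o \<Rightarrow> 'o \<Rightarrow> 'a"  \<comment> \<open>\<open>(X \<otimes> Y) \<otimes> Z \<rightarrow> X \<otimes> (Y \<otimes> Z)\<close>\<close>
  lunit :: "'o \<Rightarrow> 'a"  \<comment> \<open>\<open>unitO \<otimes> X \<rightarrow> X\<close>\<close>
  runit :: "'o \<Rightarrow> 'a"  \<comment> \<open>\<open>X \<otimes> unitO \<rightarrow> X\<close>\<close>

locale strict_monoidal_category = category C
  for C :: "('o, 'a) moncat" (structure) +
  assumes ten_ob: "\<lbrakk>x \<in> Ob C; y \<in> Ob C\<rbrakk> \<Longrightarrow> x \<otimes> y \<in> Ob C"
    and ten_ar: "\<lbrakk>f \<in> Hom C x y; g \<in> Hom C x' y'\<rbrakk> \<Longrightarrow> f \<otimes>\<^sub>a g \<in> Hom C (x \<otimes> x') (y \<otimes> y')"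
    and ten_ide: "\<lbrakk>x \<in> Ob C; y \<in> Ob C\<rbrakk> \<Longrightarrow> \<one> x \<otimes>\<^sub>a \<one> y = \<one> (x \<otimes> y)"
    and ten_comp: "\<lbrakk>f \<in> Hom C x y; g \<in> Hom C y z; f' \<in> Hom C x' y'; g' \<in> Hom C y' z'\<rbrakk>
      \<Longrightarrow> (g \<cdot> f) \<otimes>\<^sub>a (g' \<cdot> f') = (g \<otimes>\<^sub>a g') \<cdot> (f \<otimes>\<^sub>a f')"
    and unit_ob: "unitO C \<in> Ob C"
    and ten_assoc_ob: "\<lbrakk>x \<in> Ob C; y \<in> Ob C; z \<in> Ob C\<rbrakk> \<Longrightarrow> (x \<otimes> y) \<otimes> z = x \<otimes> (y \<otimes> z)"
    and ten_assoc_ar: "\<lbrakk>f \<in> Ar C; g \<in> Ar C; h \<in> Ar C\<rbrakk>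
      \<Longrightarrow> (f \<otimes>\<^sub>a g) \<otimes>\<^sub>a h = f \<otimes>\<^sub>a (g \<otimes>\<^sub>a h)"
    and ten_lunit_ob: "x \<in> Ob C \<Longrightarrow> unitO C \<otimes> x = x"
    and ten_runit_ob: "x \<in> Ob C \<Longrightarrow> x \<otimes> unitO C = x"
    and ten_lunit_ar: "f \<in> Ar C \<Longrightarrow> \<one> (unitO C) \<otimes>\<^sub>a f = f"
    and ten_runit_ar: "f \<in> Ar C \<Longrightarrow> f \<otimes>\<^sub>a \<one> (unitO C) = f"
    and assoc_strict: "\<lbrakk>x \<in> Ob C; y \<in> Ob C; z \<in> Ob C\<rbrakk> \<Longrightarrow> assoc C x y z = \<one> (x \<otimes> y \<otimes> z)"
    and lunit_strict: "x \<in> Ob C \<Longrightarrow> lunit C x = \<one> x"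
    and runit_strict: "x \<in> Ob C \<Longrightarrow> runit C x = \<one> x"

record ('m, 'n, 'o, 'a) rcat = "('m, 'n) cat" +
  actO :: "'m \<Rightarrow> 'o \<Rightarrow> 'm"  (infixl \<open>\<diamond>\<index>\<close> 70)
  actA :: "'n \<Rightarrow> 'a \<Rightarrow> 'n"  (infixl \<open>\<diamond>\<^sub>a\<index>\<close> 70)
  act_assoc :: "'m \<Rightarrow> 'o \<Rightarrow> 'o \<Rightarrow> 'n"  \<comment> \<open>\<open>(M \<diamond> X) \<diamond> Y \<rightarrow> M \<diamond> (X \<otimes> Y)\<close>\<close>
  act_unit :: "'m \<Rightarrow> 'n"  \<comment> \<open>\<open>M \<diamond> unitO \<rightarrow> M\<close>\<close>

locale strict_right_category = C: strict_monoidal_category C + D: category D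
  for C :: "('o, 'a) moncat" and D :: "('m, 'n, 'o, 'a) rcat" +
  assumes act_ob: "\<lbrakk>m \<in> Ob D; x \<in> Ob C\<rbrakk> \<Longrightarrow> m \<diamond>\<^bsub>D\<^esub> x \<in> Ob D"
    and act_ar: "\<lbrakk>f \<in> Hom D m n; u \<in> Hom C x y\<rbrakk>
      \<Longrightarrow> f \<diamond>\<^sub>a\<^bsub>D\<^esub> u \<in> Hom D (m \<diamond>\<^bsub>D\<^esub> x) (n \<diamond>\<^bsub>D\<^esub> y)"
    and act_ide: "\<lbrakk>m \<in> Ob D; x \<in> Ob C\<rbrakk> \<Longrightarrow> \<one>\<^bsub>D\<^esub> m \<diamond>\<^sub>a\<^bsub>D\<^esub> \<one>\<^bsub>C\<^esub> x = \<one>\<^bsub>D\<^esub> (m \<diamond>\<^bsub>D\<^esub> x)"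
    and act_comp: "\<lbrakk>f \<in> Hom D m n; g \<in> Hom D n p; u \<in> Hom C x y; v \<in> Hom C y z\<rbrakk>
      \<Longrightarrow> (g \<cdot>\<^bsub>D\<^esub> f) \<diamond>\<^sub>a\<^bsub>D\<^esub> (v \<cdot>\<^bsub>C\<^esub> u) = (g \<diamond>\<^sub>a\<^bsub>D\<^esub> v) \<cdot>\<^bsub>D\<^esub> (f \<diamond>\<^sub>a\<^bsub>D\<^esub> u)"
    and act_assoc_ob: "\<lbrakk>m \<in> Ob D; x \<in> Ob C; y \<in> Ob C\<rbrakk>
      \<Longrightarrow> (m \<diamond>\<^bsub>D\<^esub> x) \<diamond>\<^bsub>D\<^esub> y = m \<diamond>\<^bsub>D\<^esub> (x \<otimes>\<^bsub>C\<^esub> y)"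
    and act_assoc_ar: "\<lbrakk>f \<in> Ar D; u \<in> Ar C; v \<in> Ar C\<rbrakk>
      \<Longrightarrow> (f \<diamond>\<^sub>a\<^bsub>D\<^esub> u) \<diamond>\<^sub>a\<^bsub>D\<^esub> v = f \<diamond>\<^sub>a\<^bsub>D\<^esub> (u \<otimes>\<^sub>a\<^bsub>C\<^esub> v)"
    and act_unit_ob: "m \<in> Ob D \<Longrightarrow> m \<diamond>\<^bsub>D\<^esub> unitO C = m"
    and act_unit_ar: "f \<in> Ar D \<Longrightarrow> f \<diamond>\<^sub>a\<^bsub>D\<^esub> \<one>\<^bsub>C\<^esub> (unitO C) = f"
    and act_assoc_strict: "\<lbrakk>m \<in> Ob D; x \<in> Ob C; y \<in> Ob C\<rbrakk>
      \<Longrightarrow> act_assoc D m x y = \<one>\<^bsub>D\<^esub> (m \<diamond>\<^bsub>D\<^esub> x \<diamond>\<^bsub>D\<^esub> y)"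
    and act_unit_strict: "m \<in> Ob D \<Longrightarrow> act_unit D m = \<one>\<^bsub>D\<^esub> m"

definition regular :: "('o, 'a) moncat \<Rightarrow> ('o, 'a, 'o, 'a) rcat" where
  "regular C = \<lparr>Ob = Ob C, Ar = Ar C, Dom = Dom C, Cod = Cod C, Ide = Ide C, Comp = Comp C,
    actO = tenO C, actA = tenA C, act_assoc = assoc C, act_unit = runit C\<rparr>"


section \<open>Algebras and right modules\<close>

record ('o, 'a) alg =
  obj :: "'o"
  mul :: "'a"
  unt :: "'a"

definition algebra :: "('o, 'a) moncat \<Rightarrow> ('o, 'a) alg \<Rightarrow> bool" where
  "algebra C B \<longleftrightarrow>
    obj B \<in> Ob C \<and>
    mul B \<in> Hom C (obj B \<otimes>\<^bsub>C\<^esub> obj B) (obj B) \<and>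
    unt B \<in> Hom C (unitO C) (obj B) \<and>
    mul B \<cdot>\<^bsub>C\<^esub> (mul B \<otimes>\<^sub>a\<^bsub>C\<^esub> \<one>\<^bsub>C\<^esub> (obj B)) =
      mul B \<cdot>\<^bsub>C\<^esub> (\<one>\<^bsub>C\<^esub> (obj B) \<otimes>\<^sub>a\<^bsub>C\<^esub> mul B) \<cdot>\<^bsub>C\<^esub> assoc C (obj B) (obj B) (obj B) \<and>
    mul B \<cdot>\<^bsub>C\<^esub> (unt B \<otimes>\<^sub>a\<^bsub>C\<^esub> \<one>\<^bsub>C\<^esub> (obj B)) = lunit C (obj B) \<and>
    mul B \<cdot>\<^bsub>C\<^esub> (\<one>\<^bsub>C\<^esub> (obj B) \<otimes>\<^sub>a\<^bsub>C\<^esub> unt B) = runit C (obj B)"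

fun right_module ::
    "('o, 'a) moncat \<Rightarrow> ('m, 'n, 'o, 'a) rcat \<Rightarrow> ('o, 'a) alg \<Rightarrow> 'm \<times> 'n \<Rightarrow> bool" where
  "right_module C D B (M, \<rho>) \<longleftrightarrow>
    M \<in> Ob D \<and>
    \<rho> \<in> Hom D (M \<diamond>\<^bsub>D\<^esub> obj B) M \<and>
    \<rho> \<cdot>\<^bsub>D\<^esub> (\<rho> \<diamond>\<^sub>a\<^bsub>D\<^esub> \<one>\<^bsub>C\<^esub> (obj B)) =
      \<rho> \<cdot>\<^bsub>D\<^esub> (\<one>\<^bsub>D\<^esub> M \<diamond>\<^sub>a\<^bsub>D\<^esub> mul B) \<cdot>\<^bsub>D\<^esub> act_assoc D M (obj B) (obj B) \<and>
    \<rho> \<cdot>\<^bsub>D\<^esub> (\<one>\<^bsub>D\<^esub> M \<diamond>\<^sub>a\<^bsub>D\<^esub> unt B) = act_unit D M"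

text \<open>The action in a right category \<open>D\<close> over \<open>C\<close> is by objects of \<open>C\<close>, so the
  same definition covers modules in \<open>D\<close> over an algebra in \<open>C\<close> and, for \<open>D\<close> replaced by
  the category of right \<open>A\<close>-modules and \<open>C\<close> by that of \<open>A\<close>-bimodules, modules over an
  \<open>A\<close>-ring. Morphisms carry their source and target module, so that different hom-sets are
  disjoint.\<close>

definition rmod_cat ::
    "('o, 'a) moncat \<Rightarrow> ('m, 'n, 'o, 'a) rcat \<Rightarrow> ('o, 'a) alg
      \<Rightarrow> ('m \<times> 'n, ('m \<times> 'n) \<times> 'n \<times> ('m \<times> 'n)) cat" where
  "rmod_cat C D B =
    \<lparr>Ob = {P. right_module C D B P},
     Ar = {((M, \<rho>), f, (N, \<tau>)) | M \<rho> f N \<tau>.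
        right_module C D B (M, \<rho>) \<and> right_module C D B (N, \<tau>) \<and> f \<in> Hom D M N \<and>
        f \<cdot>\<^bsub>D\<^esub> \<rho> = \<tau> \<cdot>\<^bsub>D\<^esub> (f \<diamond>\<^sub>a\<^bsub>D\<^esub> \<one>\<^bsub>C\<^esub> (obj B))},
     Dom = (\<lambda>(P, f, Q). P),
     Cod = (\<lambda>(P, f, Q). Q),
     Ide = (\<lambda>P. (P, \<one>\<^bsub>D\<^esub> (fst P), P)),
     Comp = (\<lambda>(Q, g, R) (P, f, Q'). (P, g \<cdot>\<^bsub>D\<^esub> f, R))\<rparr>"


section \<open>Relative tensor products\<close>

text \<open>From here on \<open>C\<close> and \<open>D\<close> are strict, and associators and unitors in them are omitted.\<close>

fun left_module :: "('o, 'a) moncat \<Rightarrow> ('o, 'a) alg \<Rightarrow> 'o \<times> 'a \<Rightarrow> bool" where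
  "left_module C A (Y, l) \<longleftrightarrow>
    Y \<in> Ob C \<and>
    l \<in> Hom C (obj A \<otimes>\<^bsub>C\<^esub> Y) Y \<and>
    l \<cdot>\<^bsub>C\<^esub> (mul A \<otimes>\<^sub>a\<^bsub>C\<^esub> \<one>\<^bsub>C\<^esub> Y) = l \<cdot>\<^bsub>C\<^esub> (\<one>\<^bsub>C\<^esub> (obj A) \<otimes>\<^sub>a\<^bsub>C\<^esub> l) \<and>
    l \<cdot>\<^bsub>C\<^esub> (unt A \<otimes>\<^sub>a\<^bsub>C\<^esub> \<one>\<^bsub>C\<^esub> Y) = \<one>\<^bsub>C\<^esub> Y"

text \<open>A bimodule \<open>(Y, l, r)\<close> has left action \<open>l\<close> and right action \<open>r\<close>.\<close>

fun bimodule :: "('o, 'a) moncat \<Rightarrow> ('o, 'a) alg \<Rightarrow> 'o \<times> 'a \<times> 'a \<Rightarrow> bool" where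
  "bimodule C A (Y, l, r) \<longleftrightarrow>
    left_module C A (Y, l) \<and> right_module C (regular C) A (Y, r) \<and>
    r \<cdot>\<^bsub>C\<^esub> (l \<otimes>\<^sub>a\<^bsub>C\<^esub> \<one>\<^bsub>C\<^esub> (obj A)) = l \<cdot>\<^bsub>C\<^esub> (\<one>\<^bsub>C\<^esub> (obj A) \<otimes>\<^sub>a\<^bsub>C\<^esub> r)"

fun left_part :: "'o \<times> 'a \<times> 'a \<Rightarrow> 'o \<times> 'a" where
  "left_part (Y, l, r) = (Y, l)"

fun right_part :: "'o \<times> 'a \<times> 'a \<Rightarrow> 'o \<times> 'a" where
  "right_part (Y, l, r) = (Y, r)"

text \<open>\<open>qmap C D P Q\<close> is the coequalizer \<open>q\<close> of a right module \<open>P\<close> in \<open>D\<close> and a left module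
  \<open>Q\<close>; its codomain is the relative tensor product. The algebra enters only through the two
  actions. Taking \<open>D = regular C\<close> gives the tensor product of a right and a left module
  in \<open>C\<close>.\<close>

fun qmap :: "('o, 'a) moncat \<Rightarrow> ('m, 'n, 'o, 'a) rcat \<Rightarrow> 'm \<times> 'n \<Rightarrow> 'o \<times> 'a \<Rightarrow> 'n" where
  "qmap C D (M, \<rho>) (Y, l) = coeq D (\<rho> \<diamond>\<^sub>a\<^bsub>D\<^esub> \<one>\<^bsub>C\<^esub> Y) (\<one>\<^bsub>D\<^esub> M \<diamond>\<^sub>a\<^bsub>D\<^esub> l)"

definition coflat :: "('o, 'a) moncat \<Rightarrow> ('m, 'n, 'o, 'a) rcat \<Rightarrow> 'o \<Rightarrow> bool" where
  "coflat C D X \<longleftrightarrow>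
    (\<forall>f g q. is_coequalizer D f g q \<longrightarrow>
      is_coequalizer D (f \<diamond>\<^sub>a\<^bsub>D\<^esub> \<one>\<^bsub>C\<^esub> X) (g \<diamond>\<^sub>a\<^bsub>D\<^esub> \<one>\<^bsub>C\<^esub> X) (q \<diamond>\<^sub>a\<^bsub>D\<^esub> \<one>\<^bsub>C\<^esub> X))"

definition robust ::
    "('o, 'a) moncat \<Rightarrow> ('m, 'n, 'o, 'a) rcat \<Rightarrow> ('o, 'a) alg \<Rightarrow> 'o \<times> 'a \<Rightarrow> bool" where
  "robust C D A Q \<longleftrightarrow>
    (\<forall>M \<in> Ob D. \<forall>Z \<rho>. right_module C (regular C) A (Z, \<rho>) \<longrightarrow>
      iso_in D (factor D (qmap C D (M \<diamond>\<^bsub>D\<^esub> Z, \<one>\<^bsub>D\<^esub> M \<diamond>\<^sub>a\<^bsub>D\<^esub> \<rho>) Q)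
                         (\<one>\<^bsub>D\<^esub> M \<diamond>\<^sub>a\<^bsub>D\<^esub> qmap C (regular C) (Z, \<rho>) Q)))"

text \<open>The relative tensor product \<open>M \<diamond>\<^sub>A Y\<close> of a right module \<open>M\<close> in \<open>D\<close> and a bimodule \<open>Y\<close>,
  with the right action induced by that of \<open>Y\<close>.\<close>

fun rel_ob ::
    "('o, 'a) moncat \<Rightarrow> ('m, 'n, 'o, 'a) rcat \<Rightarrow> ('o, 'a) alg
      \<Rightarrow> 'm \<times> 'n \<Rightarrow> 'o \<times> 'a \<times> 'a \<Rightarrow> 'm \<times> 'n" where
  "rel_ob C D A (M, \<rho>) (Y, l, r) =
    (let q = qmap C D (M, \<rho>) (Y, l)
     in (Cod D q, factor D (q \<diamond>\<^sub>a\<^bsub>D\<^esub> \<one>\<^bsub>C\<^esub> (obj A)) (q \<cdot>\<^bsub>D\<^esub> (\<one>\<^bsub>D\<^esub> M \<diamond>\<^sub>a\<^bsub>D\<^esub> r))))"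

text \<open>The morphism \<open>f \<diamond>\<^sub>A g\<close> induced by \<open>f : P \<rightarrow> P'\<close> and \<open>g : Y \<rightarrow> Y'\<close>.\<close>

definition rel_ar ::
    "('o, 'a) moncat \<Rightarrow> ('m, 'n, 'o, 'a) rcat
      \<Rightarrow> 'm \<times> 'n \<Rightarrow> 'n \<Rightarrow> 'm \<times> 'n \<Rightarrow> 'o \<times> 'a \<times> 'a \<Rightarrow> 'a \<Rightarrow> 'o \<times> 'a \<times> 'a \<Rightarrow> 'n" where
  "rel_ar C D P f P' Y g Y' =
    factor D (qmap C D P (left_part Y)) (qmap C D P' (left_part Y') \<cdot>\<^bsub>D\<^esub> (f \<diamond>\<^sub>a\<^bsub>D\<^esub> g))"

text \<open>\<open>Y \<otimes>\<^sub>A Z\<close> as a bimodule.\<close>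

fun bimod_ten ::
    "('o, 'a) moncat \<Rightarrow> ('o, 'a) alg \<Rightarrow> 'o \<times> 'a \<times> 'a \<Rightarrow> 'o \<times> 'a \<times> 'a \<Rightarrow> 'o \<times> 'a \<times> 'a" where
  "bimod_ten C A (Y, l, r) (Z, l', r') =
    (let q = qmap C (regular C) (Y, r) (Z, l');
         (T, t) = rel_ob C (regular C) A (Y, r) (Z, l', r')
     in (T, factor C (\<one>\<^bsub>C\<^esub> (obj A) \<otimes>\<^sub>a\<^bsub>C\<^esub> q) (q \<cdot>\<^bsub>C\<^esub> (l \<otimes>\<^sub>a\<^bsub>C\<^esub> \<one>\<^bsub>C\<^esub> Z)), t))"

text \<open>The canonical morphism \<open>(P \<diamond>\<^sub>A Y) \<diamond>\<^sub>A Z \<rightarrow> P \<diamond>\<^sub>A (Y \<otimes>\<^sub>A Z)\<close>, determined by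
  \<open>u \<cdot> q \<cdot> (q \<diamond> Z) = q \<cdot> (M \<diamond> q)\<close> where \<open>M\<close> is the object underlying \<open>P\<close>.\<close>

definition rel_assoc ::
    "('o, 'a) moncat \<Rightarrow> ('m, 'n, 'o, 'a) rcat \<Rightarrow> ('o, 'a) alg
      \<Rightarrow> 'm \<times> 'n \<Rightarrow> 'o \<times> 'a \<times> 'a \<Rightarrow> 'o \<times> 'a \<times> 'a \<Rightarrow> 'n" where
  "rel_assoc C D A P Y Z =
    factor D
      (qmap C D (rel_ob C D A P Y) (left_part Z) \<cdot>\<^bsub>D\<^esub>
        (qmap C D P (left_part Y) \<diamond>\<^sub>a\<^bsub>D\<^esub> \<one>\<^bsub>C\<^esub> (fst Z)))
      (qmap C D P (left_part (bimod_ten C A Y Z)) \<cdot>\<^bsub>D\<^esub>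
        (\<one>\<^bsub>D\<^esub> (fst P) \<diamond>\<^sub>a\<^bsub>D\<^esub> qmap C (regular C) (right_part Y) (left_part Z)))"

definition unit_bimod :: "('o, 'a) alg \<Rightarrow> 'o \<times> 'a \<times> 'a" where
  "unit_bimod A = (obj A, mul A, mul A)"

definition admissible_bimodule ::
    "('o, 'a) moncat \<Rightarrow> ('m, 'n, 'o, 'a) rcat \<Rightarrow> ('o, 'a) alg \<Rightarrow> 'o \<times> 'a \<times> 'a \<Rightarrow> bool" where
  "admissible_bimodule C D A Y \<longleftrightarrow>
    bimodule C A Y \<and>
    coflat C (regular C) (fst Y) \<and> coflat C D (fst Y) \<and>
    robust C (regular C) A (left_part Y) \<and> robust C D A (left_part Y)"

text \<open>The monoidal category of bimodules that are left coflat, \<open>D\<close>-coflat, left robust and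
  \<open>D\<close>-robust.\<close>

definition bimod_cat ::
    "('o, 'a) moncat \<Rightarrow> ('m, 'n, 'o, 'a) rcat \<Rightarrow> ('o, 'a) alg
      \<Rightarrow> ('o \<times> 'a \<times> 'a, ('o \<times> 'a \<times> 'a) \<times> 'a \<times> ('o \<times> 'a \<times> 'a)) moncat" where
  "bimod_cat C D A =
    \<lparr>Ob = {Y. admissible_bimodule C D A Y},
     Ar = {((Y, l, r), f, (Z, l', r')) | Y l r f Z l' r'.
        admissible_bimodule C D A (Y, l, r) \<and> admissible_bimodule C D A (Z, l', r') \<and>
        f \<in> Hom C Y Z \<and>
        f \<cdot>\<^bsub>C\<^esub> l = l' \<cdot>\<^bsub>C\<^esub> (\<one>\<^bsub>C\<^esub> (obj A) \<otimes>\<^sub>a\<^bsub>C\<^esub> f) \<and>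
        f \<cdot>\<^bsub>C\<^esub> r = r' \<cdot>\<^bsub>C\<^esub> (f \<otimes>\<^sub>a\<^bsub>C\<^esub> \<one>\<^bsub>C\<^esub> (obj A))},
     Dom = (\<lambda>(Y, f, Z). Y),
     Cod = (\<lambda>(Y, f, Z). Z),
     Ide = (\<lambda>Y. (Y, \<one>\<^bsub>C\<^esub> (fst Y), Y)),
     Comp = (\<lambda>(Z, g, W) (Y, f, Z'). (Y, g \<cdot>\<^bsub>C\<^esub> f, W)),
     tenO = bimod_ten C A,
     tenA = (\<lambda>(Y, f, Y') (Z, g, Z').
        (bimod_ten C A Y Z,
         rel_ar C (regular C) (right_part Y) f (right_part Y') Z g Z',
         bimod_ten C A Y' Z')),
     unitO = unit_bimod A,
     assoc = (\<lambda>Y Z W.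
        (bimod_ten C A (bimod_ten C A Y Z) W,
         rel_assoc C (regular C) A (right_part Y) Z W,
         bimod_ten C A Y (bimod_ten C A Z W))),
     lunit = (\<lambda>(Y, l, r).
        (bimod_ten C A (unit_bimod A) (Y, l, r),
         factor C (qmap C (regular C) (obj A, mul A) (Y, l)) l,
         (Y, l, r))),
     runit = (\<lambda>(Y, l, r).
        (bimod_ten C A (Y, l, r) (unit_bimod A),
         factor C (qmap C (regular C) (Y, r) (obj A, mul A)) r,
         (Y, l, r)))\<rparr>"

text \<open>The category of right \<open>A\<close>-modules in \<open>D\<close> as a right category over the previous one.\<close>

definition rmod_rcat ::
    "('o, 'a) moncat \<Rightarrow> ('m, 'n, 'o, 'a) rcat \<Rightarrow> ('o, 'a) alg
      \<Rightarrow> ('m \<times> 'n, ('m \<times> 'n) \<times> 'n \<times> ('m \<times> 'n),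
          'o \<times> 'a \<times> 'a, ('o \<times> 'a \<times> 'a) \<times> 'a \<times> ('o \<times> 'a \<times> 'a)) rcat" where
  "rmod_rcat C D A =
    \<lparr>Ob = Ob (rmod_cat C D A), Ar = Ar (rmod_cat C D A),
     Dom = Dom (rmod_cat C D A), Cod = Cod (rmod_cat C D A),
     Ide = Ide (rmod_cat C D A), Comp = Comp (rmod_cat C D A),
     actO = rel_ob C D A,
     actA = (\<lambda>(P, f, P') (Y, g, Y').
        (rel_ob C D A P Y, rel_ar C D P f P' Y g Y', rel_ob C D A P' Y')),
     act_assoc = (\<lambda>P Y Z.
        (rel_ob C D A (rel_ob C D A P Y) Z,
         rel_assoc C D A P Y Z,
         rel_ob C D A P (bimod_ten C A Y Z))),
     act_unit = (\<lambda>(M, \<rho>).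
        (rel_ob C D A (M, \<rho>) (unit_bimod A),
         factor D (qmap C D (M, \<rho>) (obj A, mul A)) \<rho>,
         (M, \<rho>)))\<rparr>"

text \<open>The coflatness of \<open>A\<close> is what makes \<open>bimod_cat\<close> monoidal (with unit \<open>A\<close>) and
  \<open>rmod_rcat\<close> a right category over it.\<close>

definition compatible_ring ::
    "('o, 'a) moncat \<Rightarrow> ('m, 'n, 'o, 'a) rcat \<Rightarrow> ('o, 'a) alg
      \<Rightarrow> ('o \<times> 'a \<times> 'a, ('o \<times> 'a \<times> 'a) \<times> 'a \<times> ('o \<times> 'a \<times> 'a)) alg \<Rightarrow> bool" where
  "compatible_ring C D A R \<longleftrightarrow>
    coflat C (regular C) (obj A) \<and> coflat C D (obj A) \<and> algebra (bimod_cat C D A) R"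

abbreviation ring_rmod_cat where
  "ring_rmod_cat C D A R \<equiv> rmod_cat (bimod_cat C D A) (rmod_rcat C D A) R"


section \<open>Wreaths\<close>

locale wreath = strict_monoidal_category C
  for C :: "('o, 'a) moncat" (structure) +
  fixes A :: "('o, 'a) alg" and X :: 'o and \<psi> \<zeta> \<sigma> :: 'a
  assumes alg: "algebra C A"
    and X_in: "X \<in> Ob C"
    and psi_in: "\<psi> \<in> Hom C (X \<otimes> obj A) (obj A \<otimes> X)"
    and zeta_in: "\<zeta> \<in> Hom C (X \<otimes> X) (obj A \<otimes> X)"
    and sigma_in: "\<sigma> \<in> Hom C (unitO C) (obj A \<otimes> X)"
    and psi_mul: "\<psi> \<cdot> (\<one> X \<otimes>\<^sub>a mul A) =
      (mul A \<otimes>\<^sub>a \<one> X) \<cdot> (\<one> (obj A) \<otimes>\<^sub>a \<psi>) \<cdot> (\<psi> \<otimes>\<^sub>a \<one> (obj A))"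
    and psi_unt: "\<psi> \<cdot> (\<one> X \<otimes>\<^sub>a unt A) = unt A \<otimes>\<^sub>a \<one> X"
    and zeta_linear: "(mul A \<otimes>\<^sub>a \<one> X) \<cdot> (\<one> (obj A) \<otimes>\<^sub>a \<psi>) \<cdot> (\<zeta> \<otimes>\<^sub>a \<one> (obj A)) =
      (mul A \<otimes>\<^sub>a \<one> X) \<cdot> (\<one> (obj A) \<otimes>\<^sub>a \<zeta>) \<cdot> (\<psi> \<otimes>\<^sub>a \<one> X) \<cdot> (\<one> X \<otimes>\<^sub>a \<psi>)"
    and zeta_assoc: "(mul A \<otimes>\<^sub>a \<one> X) \<cdot> (\<one> (obj A) \<otimes>\<^sub>a \<zeta>) \<cdot> (\<psi> \<otimes>\<^sub>a \<one> X) \<cdot> (\<one> X \<otimes>\<^sub>a \<zeta>) =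
      (mul A \<otimes>\<^sub>a \<one> X) \<cdot> (\<one> (obj A) \<otimes>\<^sub>a \<zeta>) \<cdot> (\<zeta> \<otimes>\<^sub>a \<one> X)"
    and sigma_linear: "(mul A \<otimes>\<^sub>a \<one> X) \<cdot> (\<one> (obj A) \<otimes>\<^sub>a \<sigma>) =
      (mul A \<otimes>\<^sub>a \<one> X) \<cdot> (\<one> (obj A) \<otimes>\<^sub>a \<psi>) \<cdot> (\<sigma> \<otimes>\<^sub>a \<one> (obj A))"
    and sigma_right: "(mul A \<otimes>\<^sub>a \<one> X) \<cdot> (\<one> (obj A) \<otimes>\<^sub>a \<zeta>) \<cdot> (\<psi> \<otimes>\<^sub>a \<one> X) \<cdot> (\<one> X \<otimes>\<^sub>a \<sigma>) =
      unt A \<otimes>\<^sub>a \<one> X"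
    and sigma_left: "(mul A \<otimes>\<^sub>a \<one> X) \<cdot> (\<one> (obj A) \<otimes>\<^sub>a \<zeta>) \<cdot> (\<sigma> \<otimes>\<^sub>a \<one> X) =
      unt A \<otimes>\<^sub>a \<one> X"

definition wreath_product ::
    "('o, 'a) moncat \<Rightarrow> ('o, 'a) alg \<Rightarrow> 'o \<Rightarrow> 'a \<Rightarrow> 'a \<Rightarrow> 'a \<Rightarrow> ('o, 'a) alg" where
  "wreath_product C A X \<psi> \<zeta> \<sigma> =
    \<lparr>obj = obj A \<otimes>\<^bsub>C\<^esub> X,
     mul = (mul A \<otimes>\<^sub>a\<^bsub>C\<^esub> \<one>\<^bsub>C\<^esub> X) \<cdot>\<^bsub>C\<^esub> (mul A \<otimes>\<^sub>a\<^bsub>C\<^esub> \<zeta>) \<cdot>\<^bsub>C\<^esub>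
       (\<one>\<^bsub>C\<^esub> (obj A) \<otimes>\<^sub>a\<^bsub>C\<^esub> \<psi> \<otimes>\<^sub>a\<^bsub>C\<^esub> \<one>\<^bsub>C\<^esub> X),
     unt = \<sigma>\<rparr>"

definition wreath_bimod ::
    "('o, 'a) moncat \<Rightarrow> ('o, 'a) alg \<Rightarrow> 'o \<Rightarrow> 'a \<Rightarrow> 'o \<times> 'a \<times> 'a" where
  "wreath_bimod C A X \<psi> =
    (obj A \<otimes>\<^bsub>C\<^esub> X,
     mul A \<otimes>\<^sub>a\<^bsub>C\<^esub> \<one>\<^bsub>C\<^esub> X,
     (mul A \<otimes>\<^sub>a\<^bsub>C\<^esub> \<one>\<^bsub>C\<^esub> X) \<cdot>\<^bsub>C\<^esub> (\<one>\<^bsub>C\<^esub> (obj A) \<otimes>\<^sub>a\<^bsub>C\<^esub> \<psi>))"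

definition wreath_ring ::
    "('o, 'a) moncat \<Rightarrow> ('o, 'a) alg \<Rightarrow> 'o \<Rightarrow> 'a \<Rightarrow> 'a \<Rightarrow> 'a
      \<Rightarrow> ('o \<times> 'a \<times> 'a, ('o \<times> 'a \<times> 'a) \<times> 'a \<times> ('o \<times> 'a \<times> 'a)) alg" where
  "wreath_ring C A X \<psi> \<zeta> \<sigma> =
    (let Y = wreath_bimod C A X \<psi>
     in \<lparr>obj = Y,
         mul = (bimod_ten C A Y Y,
           factor C (qmap C (regular C) (right_part Y) (left_part Y))
             ((mul A \<otimes>\<^sub>a\<^bsub>C\<^esub> \<one>\<^bsub>C\<^esub> X) \<cdot>\<^bsub>C\<^esub> (\<one>\<^bsub>C\<^esub> (obj A) \<otimes>\<^sub>a\<^bsub>C\<^esub> \<zeta>) \<cdot>\<^bsub>C\<^esub>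
              (mul A \<otimes>\<^sub>a\<^bsub>C\<^esub> \<one>\<^bsub>C\<^esub> X \<otimes>\<^sub>a\<^bsub>C\<^esub> \<one>\<^bsub>C\<^esub> X) \<cdot>\<^bsub>C\<^esub>
              (\<one>\<^bsub>C\<^esub> (obj A) \<otimes>\<^sub>a\<^bsub>C\<^esub> \<psi> \<otimes>\<^sub>a\<^bsub>C\<^esub> \<one>\<^bsub>C\<^esub> X)),
           Y),
         unt = (unit_bimod A,
           (mul A \<otimes>\<^sub>a\<^bsub>C\<^esub> \<one>\<^bsub>C\<^esub> X) \<cdot>\<^bsub>C\<^esub> (\<one>\<^bsub>C\<^esub> (obj A) \<otimes>\<^sub>a\<^bsub>C\<^esub> \<sigma>),
           Y)\<rparr>)"

end

theory Submission
  imports Defs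
begin

text \<open>
  The algebra \<open>A # X\<close> is what remains of the \<open>A\<close>-ring \<open>A \<otimes> X\<close> when the actions of \<open>A\<close> are
  forgotten, and forgetting them loses nothing: \<open>A\<close> acts on a ring through the unit of the
  ring. The theorem is therefore an instance of \<open>ring_modules_isomorphic\<close>, which concerns an
  arbitrary \<open>A\<close>-ring \<open>Y\<close> compatible with \<open>D\<close>. Let \<open>m : Y \<otimes>\<^sub>A Y \<rightarrow> Y\<close> be its multiplication and
  \<open>u : A \<rightarrow> Y\<close> its unit. Its underlying algebra in \<open>C\<close> has the multiplication \<open>m \<cdot> q\<^sub>Y\<close>,
  where \<open>q\<^sub>Y : Y \<otimes> Y \<rightarrow> Y \<otimes>\<^sub>A Y\<close> is the coequalizer, and the unit \<open>u \<cdot> unt A\<close>.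

  A module over the ring is an \<open>A\<close>-module \<open>(M, \<rho>)\<close> with an action \<open>t : M \<diamond>\<^sub>A Y \<rightarrow> M\<close>. Put
  \<open>\<tau> = t \<cdot> q : M \<diamond> Y \<rightarrow> M\<close>, with \<open>q\<close> the coequalizer. The axioms for \<open>t\<close>, tested on the
  objects \<open>M \<diamond> Y \<diamond> A\<close>, \<open>M \<diamond> Y \<diamond> Y\<close> and \<open>M \<diamond> A\<close>, say that \<open>\<tau>\<close> is right \<open>A\<close>-linear, that it is
  associative for \<open>m \<cdot> q\<^sub>Y\<close>, and that \<open>\<tau> \<cdot> (M \<diamond> u) = \<rho>\<close> (\<open>ring_module_iff\<close>). Coflatness of \<open>A\<close>
  and \<open>Y\<close> makes \<open>q \<diamond> A\<close> and \<open>q \<diamond> Y\<close> coequalizers, hence such tests conclusive; robustness of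
  \<open>Y\<close> makes \<open>A \<otimes> q\<^sub>Y\<close> a coequalizer, so that the left action on \<open>Y \<otimes>\<^sub>A Y\<close> is the expected one.

  The last condition also gives the inverse: a module \<open>(M, \<tau>)\<close> over the underlying algebra is
  an \<open>A\<close>-module by \<open>\<rho> = \<tau> \<cdot> (M \<diamond> u)\<close>. The unit laws of the ring say that both actions of \<open>A\<close>
  on \<open>Y\<close> are multiplications by \<open>u\<close> in the underlying algebra (\<open>mul_unit_left\<close>,
  \<open>mul_unit_right\<close>), so associativity of \<open>\<tau>\<close> contains its balancedness, by which \<open>\<tau>\<close>
  factors through \<open>q\<close>, and its right linearity (\<open>underlying_ring_action\<close>).

  For a wreath it remains to identify the underlying algebra of \<open>A \<otimes> X\<close> with \<open>A # X\<close>: the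
  product of \<open>A # X\<close> is balanced over \<open>A\<close> by the multiplicativity of \<open>\<psi>\<close>
  (\<open>wreath_mul_balanced\<close>), so composing the ring multiplication with \<open>q\<^sub>Y\<close> returns it.
\<close>

section \<open>Epimorphisms, coequalizers and isomorphisms of categories\<close>

lemma in_Hom_iff: "f \<in> Hom C x y \<longleftrightarrow> f \<in> Ar C \<and> Dom C f = x \<and> Cod C f = y"
  by (simp add: Hom_def)

definition epi :: "('o, 'a, 'e) cat_scheme \<Rightarrow> 'a \<Rightarrow> bool" where
  "epi C q \<longleftrightarrow> q \<in> Ar C \<and>
    (\<forall>u\<in>Ar C. \<forall>v\<in>Ar C. Dom C u = Cod C q \<and> Dom C v = Cod C q \<and>
      u \<cdot>\<^bsub>C\<^esub> q = v \<cdot>\<^bsub>C\<^esub> q \<longrightarrow> u = v)"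

lemma epiD:
  "\<lbrakk>epi C q; u \<cdot>\<^bsub>C\<^esub> q = v \<cdot>\<^bsub>C\<^esub> q; u \<in> Ar C; v \<in> Ar C; Dom C u = Cod C q; Dom C v = Cod C q\<rbrakk>
    \<Longrightarrow> u = v"
  by (auto simp: epi_def)

lemma epi_cancel:
  "\<lbrakk>epi C q; u \<in> Ar C; v \<in> Ar C; Dom C u = Cod C q; Dom C v = Cod C q\<rbrakk>
    \<Longrightarrow> u \<cdot>\<^bsub>C\<^esub> q = v \<cdot>\<^bsub>C\<^esub> q \<longleftrightarrow> u = v"
  using epiD[of C q u v] by metis

context category
begin

lemma dom_ob [simp]: "f \<in> Ar C \<Longrightarrow> Dom C f \<in> Ob C"
  and cod_ob [simp]: "f \<in> Ar C \<Longrightarrow> Cod C f \<in> Ob C"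
  by (rule dom_in cod_in, assumption)+

lemma ide_ar [simp]:
  assumes "x \<in> Ob C"
  shows "\<one> x \<in> Ar C" "Dom C (\<one> x) = x" "Cod C (\<one> x) = x"
  using ide_in[OF assms] by (simp_all add: in_Hom_iff)

lemma comp_ar [simp]:
  assumes "g \<in> Ar C" "f \<in> Ar C" "Dom C g = Cod C f"
  shows "g \<cdot> f \<in> Ar C" "Dom C (g \<cdot> f) = Dom C f" "Cod C (g \<cdot> f) = Cod C g"
  using comp_in[of f "Dom C f" "Cod C f" g "Cod C g"] assms by (simp_all add: in_Hom_iff)

lemma comp_assoc_ar [simp]:
  "\<lbrakk>f \<in> Ar C; g \<in> Ar C; h \<in> Ar C; Dom C g = Cod C f; Dom C h = Cod C g\<rbrakk>
    \<Longrightarrow> (h \<cdot> g) \<cdot> f = h \<cdot> g \<cdot> f"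
  using comp_assoc[of f "Dom C f" "Cod C f" g "Cod C g" h "Cod C h"] by (simp add: in_Hom_iff)

lemma comp_ide_ar [simp]:
  "\<lbrakk>f \<in> Ar C; Cod C f = x\<rbrakk> \<Longrightarrow> \<one> x \<cdot> f = f"
  "\<lbrakk>f \<in> Ar C; Dom C f = x\<rbrakk> \<Longrightarrow> f \<cdot> \<one> x = f"
  using comp_ide_left[of f "Dom C f" x] comp_ide_right[of f x "Cod C f"]
  by (simp_all add: in_Hom_iff)

text \<open>Composites are kept nested to the right, where the left-hand side of an equation
  \<open>g \<cdot> f = k\<close> occurs only with a tail.\<close>

lemma reassoc:
  "\<lbrakk>g \<cdot> f = k; f \<in> Ar C; g \<in> Ar C; h \<in> Ar C; Dom C g = Cod C f; Dom C f = Cod C h\<rbrakk>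
    \<Longrightarrow> g \<cdot> f \<cdot> h = k \<cdot> h"
  using comp_assoc_ar[of h f g] by simp

lemma epi_comp:
  assumes "epi C p" "epi C q" "Dom C q = Cod C p"
  shows "epi C (q \<cdot> p)"
proof -
  have ar: "p \<in> Ar C" "q \<in> Ar C" using assms(1,2) by (simp_all add: epi_def)
  have "u = v" if "u \<in> Ar C" "v \<in> Ar C" "Dom C u = Cod C q" "Dom C v = Cod C q"
    "u \<cdot> q \<cdot> p = v \<cdot> q \<cdot> p" for u v
  proof -
    have "u \<cdot> q = v \<cdot> q"
      by (rule epiD[OF assms(1)]) (use that ar assms(3) in simp_all)
    then show ?thesis
      by (rule epiD[OF assms(2)]) (use that in simp_all)
  qed
  then show ?thesis using ar assms(3) by (simp add: epi_def)
qed

lemma coequalizer_epi: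
  assumes "is_coequalizer C f g q"
  shows "epi C q"
proof -
  have ar: "f \<in> Ar C" "g \<in> Ar C" "q \<in> Ar C" "Dom C q = Cod C f"
      "Dom C g = Dom C f" "Cod C g = Cod C f" "q \<cdot> f = q \<cdot> g"
    using assms by (simp_all add: is_coequalizer_def in_Hom_iff)
  have "u = v" if uv: "u \<in> Ar C" "v \<in> Ar C" "Dom C u = Cod C q" "Dom C v = Cod C q"
    "u \<cdot> q = v \<cdot> q" for u v
  proof -
    have cod: "Cod C v = Cod C u"
      using uv ar comp_ar(3)[of u q] comp_ar(3)[of v q] by simp
    have "\<exists>!w. w \<in> Hom C (Cod C q) (Cod C (u \<cdot> q)) \<and> w \<cdot> q = u \<cdot> q"
    proof -
      have "(u \<cdot> q) \<cdot> f = (u \<cdot> q) \<cdot> g" using uv(1,3) ar by simp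
      then show ?thesis
        using assms uv(1,3) ar unfolding is_coequalizer_def by (metis comp_ar(1,2))
    qed
    then show "u = v"
      using uv cod ar(3) by (auto simp: in_Hom_iff)
  qed
  then show ?thesis using ar by (simp add: epi_def)
qed

text \<open>\<open>factor\<close> is a definite description, so nothing is known about it before \<open>h\<close> is known to
  factor through \<open>q\<close>. Either a factorization is at hand and \<open>q\<close> is an epimorphism, or the
  universal property of \<open>q\<close> supplies one, as in \<open>coequalizer_factor\<close> below.\<close>

lemma factor_eqI:
  assumes "epi C q" "u \<in> Ar C" "Dom C u = Cod C q" "u \<cdot> q = h"
  shows "factor C q h = u"
proof -
  have "q \<in> Ar C" using assms(1) by (simp add: epi_def)
  then have "Cod C h = Cod C u" using assms comp_ar(3)[of u q] by simp
  then show ?thesis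
    unfolding factor_def using assms
    by (intro the_equality) (auto simp: in_Hom_iff intro: epiD[OF assms(1)])
qed

lemma coequalizer_factor:
  assumes "is_coequalizer C f g q" "h \<in> Ar C" "Dom C h = Dom C q" "h \<cdot> f = h \<cdot> g"
  shows "factor C q h \<in> Ar C" "Dom C (factor C q h) = Cod C q"
    "Cod C (factor C q h) = Cod C h" "factor C q h \<cdot> q = h"
proof -
  have "\<exists>!w. w \<in> Hom C (Cod C q) (Cod C h) \<and> w \<cdot> q = h"
    using assms by (simp add: is_coequalizer_def)
  from theI'[OF this] show "factor C q h \<in> Ar C" "Dom C (factor C q h) = Cod C q"
    "Cod C (factor C q h) = Cod C h" "factor C q h \<cdot> q = h"
    by (simp_all add: factor_def in_Hom_iff)
qed

lemma coequalizer_iso_comp: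
  assumes q: "is_coequalizer C f g q" and c: "iso_in C c" "Dom C c = Cod C q"
  shows "is_coequalizer C f g (c \<cdot> q)"
proof -
  have ar: "f \<in> Ar C" "g \<in> Ar C" "q \<in> Ar C" "Dom C q = Cod C f"
      "Dom C g = Dom C f" "Cod C g = Cod C f" "q \<cdot> f = q \<cdot> g"
    using q by (simp_all add: is_coequalizer_def in_Hom_iff)
  obtain d where d: "d \<in> Ar C" "Dom C d = Cod C c" "Cod C d = Dom C c"
      "d \<cdot> c = \<one> (Dom C c)" "c \<cdot> d = \<one> (Cod C c)" and c_ar: "c \<in> Ar C"
    using c by (auto simp: iso_in_def in_Hom_iff)
  have epi_c: "u = v" if "u \<in> Ar C" "v \<in> Ar C" "Dom C u = Cod C c" "Dom C v = Cod C c"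
      "u \<cdot> c \<cdot> q = v \<cdot> c \<cdot> q" for u v
  proof -
    have "u \<cdot> c = v \<cdot> c"
      by (rule epiD[OF coequalizer_epi[OF q]]) (use that c_ar c ar in simp_all)
    then have "(u \<cdot> c) \<cdot> d = (v \<cdot> c) \<cdot> d" by simp
    then show ?thesis using that c_ar d by simp
  qed
  have "\<exists>!u. u \<in> Hom C (Cod C c) (Cod C h) \<and> u \<cdot> c \<cdot> q = h"
    if h: "h \<in> Ar C" "Dom C h = Cod C f" "h \<cdot> f = h \<cdot> g" for h
  proof (rule ex1I)
    let ?u = "factor C q h \<cdot> d"
    note fac = coequalizer_factor[OF q h(1) _ h(3)]
    have "d \<cdot> c \<cdot> q = q" using d c_ar c ar reassoc[of d c "\<one> (Dom C c)" q] by simp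
    then show "?u \<in> Hom C (Cod C c) (Cod C h) \<and> ?u \<cdot> c \<cdot> q = h"
      using fac h ar d c c_ar by (simp add: in_Hom_iff)
    then show "v = ?u" if "v \<in> Hom C (Cod C c) (Cod C h) \<and> v \<cdot> c \<cdot> q = h" for v
      using that epi_c[of v ?u] by (simp add: in_Hom_iff)
  qed
  then show ?thesis
    using ar c c_ar by (simp add: is_coequalizer_def in_Hom_iff)
qed

end

lemma coeq_is_coequalizer:
  assumes "has_coequalizers C" "f \<in> Ar C" "g \<in> Ar C"
    "Dom C g = Dom C f" "Cod C g = Cod C f"
  shows "is_coequalizer C f g (coeq C f g)"
proof -
  have "\<exists>q. is_coequalizer C f g q"
    by (rule assms(1)[unfolded has_coequalizers_def, rule_format])
      (simp_all add: in_Hom_iff assms(2-5))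
  then show ?thesis
    unfolding coeq_def by (rule someI_ex)
qed

text \<open>The inverse of a functor that is bijective on objects and on arrows is again a functor, so
  functoriality has to be checked in one direction only.\<close>

lemma isomorphic_categoriesI:
  assumes F: "cat_functor C D Fo Fa"
    and G_ob: "\<And>y. y \<in> Ob D \<Longrightarrow> Go y \<in> Ob C \<and> Fo (Go y) = y"
    and G_ar: "\<And>g y y'. g \<in> Hom D y y' \<Longrightarrow> Ga g \<in> Hom C (Go y) (Go y') \<and> Fa (Ga g) = g"
    and GF_ob: "\<And>x. x \<in> Ob C \<Longrightarrow> Go (Fo x) = x"
    and GF_ar: "\<And>f. f \<in> Ar C \<Longrightarrow> Ga (Fa f) = f"
  shows "isomorphic_categories C D"
proof -
  interpret cat_functor C D Fo Fa by (fact F)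
  have "cat_functor D C Go Ga"
  proof
    fix y assume y: "y \<in> Ob D"
    have "Ga (\<one>\<^bsub>D\<^esub> (Fo (Go y))) = Ga (Fa (\<one>\<^bsub>C\<^esub> (Go y)))"
      using map_ide G_ob[OF y] by simp
    then show "Ga (\<one>\<^bsub>D\<^esub> y) = \<one>\<^bsub>C\<^esub> (Go y)"
      using G_ob[OF y] GF_ar by simp
  next
    fix f x y g z assume f: "f \<in> Hom D x y" and g: "g \<in> Hom D y z"
    have "Ga (g \<cdot>\<^bsub>D\<^esub> f) = Ga (Fa (Ga g \<cdot>\<^bsub>C\<^esub> Ga f))"
      using map_comp[of "Ga f" "Go x" "Go y" "Ga g" "Go z"] G_ar[OF f] G_ar[OF g] by simp
    also have "\<dots> = Ga g \<cdot>\<^bsub>C\<^esub> Ga f"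
      using C.comp_in[of "Ga f" "Go x" "Go y" "Ga g" "Go z"] G_ar[OF f] G_ar[OF g]
      by (intro GF_ar) (simp add: in_Hom_iff)
    finally show "Ga (g \<cdot>\<^bsub>D\<^esub> f) = Ga g \<cdot>\<^bsub>C\<^esub> Ga f" .
  qed (use G_ob G_ar in simp_all)
  then show ?thesis
    unfolding isomorphic_categories_def using F G_ob G_ar GF_ob GF_ar
    by (intro exI[of _ Fo] exI[of _ Fa] exI[of _ Go] exI[of _ Ga]) (auto simp: in_Hom_iff)
qed

section \<open>Strict actions and the regular action\<close>

context strict_monoidal_category
begin

lemma ten_ar' [simp]:
  assumes "f \<in> Ar C" "g \<in> Ar C"
  shows "f \<otimes>\<^sub>a g \<in> Ar C" "Dom C (f \<otimes>\<^sub>a g) = Dom C f \<otimes> Dom C g"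
    "Cod C (f \<otimes>\<^sub>a g) = Cod C f \<otimes> Cod C g"
  using ten_ar[of f "Dom C f" "Cod C f" g "Dom C g" "Cod C g"] assms
  by (simp_all add: in_Hom_iff)

lemma ten_comp' [simp]:
  "\<lbrakk>f \<in> Ar C; g \<in> Ar C; f' \<in> Ar C; g' \<in> Ar C; Dom C g = Cod C f; Dom C g' = Cod C f'\<rbrakk>
    \<Longrightarrow> (g \<otimes>\<^sub>a g') \<cdot> (f \<otimes>\<^sub>a f') = (g \<cdot> f) \<otimes>\<^sub>a (g' \<cdot> f')"
  using ten_comp[of f "Dom C f" "Cod C f" g "Cod C g" f' "Dom C f'" "Cod C f'" g' "Cod C g'"]
  by (simp add: in_Hom_iff)

lemmas ten_simps [simp] = ten_ob unit_ob ten_ide ten_assoc_ob ten_assoc_ar ten_lunit_ob ten_runit_ob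
  ten_lunit_ar ten_runit_ar assoc_strict lunit_strict runit_strict

lemma left_module_iff:
  "left_module C A (Z, k) \<longleftrightarrow> Z \<in> Ob C \<and> k \<in> Ar C \<and> Dom C k = obj A \<otimes> Z \<and> Cod C k = Z \<and>
    k \<cdot> (mul A \<otimes>\<^sub>a \<one> Z) = k \<cdot> (\<one> (obj A) \<otimes>\<^sub>a k) \<and> k \<cdot> (unt A \<otimes>\<^sub>a \<one> Z) = \<one> Z"
  by (auto simp: in_Hom_iff)

end

lemma regular_simps [simp]:
  "Ob (regular C) = Ob C" "Ar (regular C) = Ar C" "Dom (regular C) = Dom C"
  "Cod (regular C) = Cod C" "Ide (regular C) = Ide C" "Comp (regular C) = Comp C"
  "actO (regular C) = tenO C" "actA (regular C) = tenA C"
  "act_assoc (regular C) = assoc C" "act_unit (regular C) = runit C"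
  by (simp_all add: regular_def)

lemma Hom_regular [simp]: "Hom (regular C) = Hom C"
  by (simp add: Hom_def fun_eq_iff)

lemma is_coequalizer_regular [simp]: "is_coequalizer (regular C) = is_coequalizer C"
  by (simp add: is_coequalizer_def fun_eq_iff)

lemma has_coequalizers_regular [simp]: "has_coequalizers (regular C) = has_coequalizers C"
  by (simp add: has_coequalizers_def)

lemma factor_regular [simp]: "factor (regular C) = factor C"
  by (simp add: factor_def fun_eq_iff)

lemma (in strict_monoidal_category) regular_right_category:
  "strict_right_category C (regular C)"
proof -
  have "category (regular C)"
    using category_axioms by (simp add: category_def)
  then show ?thesis
    using strict_monoidal_category_axioms
    by (auto simp: strict_right_category_def strict_right_category_axioms_def ten_ob ten_ar ten_ide
        ten_comp)
qed

lemma coflatD: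
  "\<lbrakk>coflat M D Z; is_coequalizer D f g q\<rbrakk>
    \<Longrightarrow> is_coequalizer D (f \<diamond>\<^sub>a\<^bsub>D\<^esub> \<one>\<^bsub>M\<^esub> Z) (g \<diamond>\<^sub>a\<^bsub>D\<^esub> \<one>\<^bsub>M\<^esub> Z) (q \<diamond>\<^sub>a\<^bsub>D\<^esub> \<one>\<^bsub>M\<^esub> Z)"
  by (simp add: coflat_def)

context strict_right_category
begin

lemma act_ar' [simp]:
  assumes "f \<in> Ar D" "g \<in> Ar C"
  shows "f \<diamond>\<^sub>a\<^bsub>D\<^esub> g \<in> Ar D" "Dom D (f \<diamond>\<^sub>a\<^bsub>D\<^esub> g) = Dom D f \<diamond>\<^bsub>D\<^esub> Dom C g"
    "Cod D (f \<diamond>\<^sub>a\<^bsub>D\<^esub> g) = Cod D f \<diamond>\<^bsub>D\<^esub> Cod C g"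
  using act_ar[of f "Dom D f" "Cod D f" g "Dom C g" "Cod C g"] assms
  by (simp_all add: in_Hom_iff)

lemma act_comp' [simp]:
  "\<lbrakk>f \<in> Ar D; g \<in> Ar D; u \<in> Ar C; v \<in> Ar C; Dom D g = Cod D f; Dom C v = Cod C u\<rbrakk>
    \<Longrightarrow> (g \<diamond>\<^sub>a\<^bsub>D\<^esub> v) \<cdot>\<^bsub>D\<^esub> (f \<diamond>\<^sub>a\<^bsub>D\<^esub> u) = (g \<cdot>\<^bsub>D\<^esub> f) \<diamond>\<^sub>a\<^bsub>D\<^esub> (v \<cdot>\<^bsub>C\<^esub> u)"
  using act_comp[of f "Dom D f" "Cod D f" g "Cod D g" u "Dom C u" "Cod C u" v "Cod C v"]
  by (simp add: in_Hom_iff)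

lemmas act_simps [simp] = act_ob act_assoc_ob act_assoc_ar act_unit_ob
  act_unit_ar act_assoc_strict act_unit_strict act_ide

lemma act_functor:
  assumes "Z \<in> Ob C"
  shows "cat_functor D D (\<lambda>M. M \<diamond>\<^bsub>D\<^esub> Z) (\<lambda>f. f \<diamond>\<^sub>a\<^bsub>D\<^esub> \<one>\<^bsub>C\<^esub> Z)"
  using assms by unfold_locales (auto simp: in_Hom_iff)

text \<open>The identity of \<open>M \<diamond> x\<close> is hidden in the nested product on the left-hand side, so that
  the interchange law alone does not rewrite it.\<close>

lemma act_interchange:
  assumes "f \<in> Ar D" "Dom D f = M \<diamond>\<^bsub>D\<^esub> x" "M \<in> Ob D" "x \<in> Ob C" "v \<in> Ar C"
    "Cod C v = z"
  shows "(f \<diamond>\<^sub>a\<^bsub>D\<^esub> \<one>\<^bsub>C\<^esub> z) \<cdot>\<^bsub>D\<^esub> (\<one>\<^bsub>D\<^esub> M \<diamond>\<^sub>a\<^bsub>D\<^esub> (\<one>\<^bsub>C\<^esub> x \<otimes>\<^sub>a\<^bsub>C\<^esub> v)) = f \<diamond>\<^sub>a\<^bsub>D\<^esub> v"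
proof -
  have "\<one>\<^bsub>D\<^esub> M \<diamond>\<^sub>a\<^bsub>D\<^esub> (\<one>\<^bsub>C\<^esub> x \<otimes>\<^sub>a\<^bsub>C\<^esub> v) = \<one>\<^bsub>D\<^esub> (M \<diamond>\<^bsub>D\<^esub> x) \<diamond>\<^sub>a\<^bsub>D\<^esub> v"
    using assms act_assoc_ar[of "\<one>\<^bsub>D\<^esub> M" "\<one>\<^bsub>C\<^esub> x" v] by simp
  then show ?thesis using assms C.cod_ob[of v] by auto
qed

lemma right_module_iff:
  assumes "obj B \<in> Ob C" "mul B \<in> Hom C (obj B \<otimes>\<^bsub>C\<^esub> obj B) (obj B)"
  shows "right_module C D B (M, \<rho>) \<longleftrightarrow> M \<in> Ob D \<and> \<rho> \<in> Ar D \<and> Dom D \<rho> = M \<diamond>\<^bsub>D\<^esub> obj B \<and>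
    Cod D \<rho> = M \<and> \<rho> \<cdot>\<^bsub>D\<^esub> (\<rho> \<diamond>\<^sub>a\<^bsub>D\<^esub> \<one>\<^bsub>C\<^esub> (obj B)) = \<rho> \<cdot>\<^bsub>D\<^esub> (\<one>\<^bsub>D\<^esub> M \<diamond>\<^sub>a\<^bsub>D\<^esub> mul B) \<and>
    \<rho> \<cdot>\<^bsub>D\<^esub> (\<one>\<^bsub>D\<^esub> M \<diamond>\<^sub>a\<^bsub>D\<^esub> unt B) = \<one>\<^bsub>D\<^esub> M"
  using assms by (auto simp: in_Hom_iff)

end

lemma (in strict_monoidal_category) ten_interchange:
  assumes "f \<in> Ar C" "Dom C f = y \<otimes> x" "y \<in> Ob C" "x \<in> Ob C" "v \<in> Ar C" "Cod C v = z"
  shows "(f \<otimes>\<^sub>a \<one> z) \<cdot> (\<one> y \<otimes>\<^sub>a (\<one> x \<otimes>\<^sub>a v)) = f \<otimes>\<^sub>a v"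
  using strict_right_category.act_interchange[OF regular_right_category, of f y x v z] assms
  by simp


section \<open>Module categories\<close>

(* Unfolding these would replace a relative tensor product by its construction. *)
declare qmap.simps [simp del] rel_ob.simps [simp del] bimod_ten.simps [simp del]
  right_module.simps [simp del] left_module.simps [simp del] bimodule.simps [simp del]

lemma rmod_cat_simps [simp]:
  "P \<in> Ob (rmod_cat C D B) \<longleftrightarrow> right_module C D B P"
  "Dom (rmod_cat C D B) (P, f, Q) = P"
  "Cod (rmod_cat C D B) (P, f, Q) = Q"
  "Ide (rmod_cat C D B) P = (P, \<one>\<^bsub>D\<^esub> (fst P), P)"
  "Comp (rmod_cat C D B) (Q, g, S) (P, f, Q') = (P, g \<cdot>\<^bsub>D\<^esub> f, S)"
  by (simp_all add: rmod_cat_def)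

lemma rmod_cat_ar [simp]:
  "(P, f, Q) \<in> Ar (rmod_cat C D B) \<longleftrightarrow> right_module C D B P \<and> right_module C D B Q \<and>
    f \<in> Hom D (fst P) (fst Q) \<and> f \<cdot>\<^bsub>D\<^esub> snd P = snd Q \<cdot>\<^bsub>D\<^esub> (f \<diamond>\<^sub>a\<^bsub>D\<^esub> \<one>\<^bsub>C\<^esub> (obj B))"
  by (cases P; cases Q) (auto simp: rmod_cat_def)

lemma right_module_ar:
  "right_module C D B P \<Longrightarrow> fst P \<in> Ob D \<and> snd P \<in> Hom D (fst P \<diamond>\<^bsub>D\<^esub> obj B) (fst P)"
  by (cases P) (simp add: right_module.simps)

text \<open>Linear maps compose because acting by \<open>B\<close> is functorial. The hypothesis is about this
  one endofunctor, so that the lemma covers both the strict action of \<open>C\<close> on \<open>D\<close> and the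
  relative tensor product with an \<open>A\<close>-ring on the category of \<open>A\<close>-modules.\<close>

lemma rmod_cat_category:
  assumes "cat_functor D D (\<lambda>M. M \<diamond>\<^bsub>D\<^esub> obj B) (\<lambda>f. f \<diamond>\<^sub>a\<^bsub>D\<^esub> \<one>\<^bsub>C\<^esub> (obj B))"
  shows "category (rmod_cat C D B)"
proof -
  interpret cat_functor D D "\<lambda>M. M \<diamond>\<^bsub>D\<^esub> obj B" "\<lambda>f. f \<diamond>\<^sub>a\<^bsub>D\<^esub> \<one>\<^bsub>C\<^esub> (obj B)"
    by (fact assms)
  have T: "f \<diamond>\<^sub>a\<^bsub>D\<^esub> \<one>\<^bsub>C\<^esub> (obj B) \<in> Ar D"
      "Dom D (f \<diamond>\<^sub>a\<^bsub>D\<^esub> \<one>\<^bsub>C\<^esub> (obj B)) = Dom D f \<diamond>\<^bsub>D\<^esub> obj B"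
      "Cod D (f \<diamond>\<^sub>a\<^bsub>D\<^esub> \<one>\<^bsub>C\<^esub> (obj B)) = Cod D f \<diamond>\<^bsub>D\<^esub> obj B" if "f \<in> Ar D" for f
    using map_ar[of f "Dom D f" "Cod D f"] that by (simp_all add: in_Hom_iff)
  have Tcomp: "(g \<cdot>\<^bsub>D\<^esub> f) \<diamond>\<^sub>a\<^bsub>D\<^esub> \<one>\<^bsub>C\<^esub> (obj B) =
      (g \<diamond>\<^sub>a\<^bsub>D\<^esub> \<one>\<^bsub>C\<^esub> (obj B)) \<cdot>\<^bsub>D\<^esub> (f \<diamond>\<^sub>a\<^bsub>D\<^esub> \<one>\<^bsub>C\<^esub> (obj B))"
    if "f \<in> Ar D" "g \<in> Ar D" "Dom D g = Cod D f" for f g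
    using map_comp[of f "Dom D f" "Cod D f" g "Cod D g"] that by (simp add: in_Hom_iff)
  show ?thesis
  proof
    show "\<one>\<^bsub>rmod_cat C D B\<^esub> P \<in> Hom (rmod_cat C D B) P P" if "P \<in> Ob (rmod_cat C D B)" for P
      using that right_module_ar[of C D B P] map_ide[of "fst P"] by (simp add: in_Hom_iff)
  next
    fix F P Q G S
    assume F: "F \<in> Hom (rmod_cat C D B) P Q" and G: "G \<in> Hom (rmod_cat C D B) Q S"
    obtain f where f: "F = (P, f, Q)" using F by (cases F) (auto simp: in_Hom_iff)
    obtain g where g: "G = (Q, g, S)" using G by (cases G) (auto simp: in_Hom_iff)
    have ar: "f \<in> Ar D" "g \<in> Ar D" "Dom D f = fst P" "Cod D f = fst Q" "Dom D g = fst Q"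
        "Cod D g = fst S"
      and eq: "f \<cdot>\<^bsub>D\<^esub> snd P = snd Q \<cdot>\<^bsub>D\<^esub> (f \<diamond>\<^sub>a\<^bsub>D\<^esub> \<one>\<^bsub>C\<^esub> (obj B))"
        "g \<cdot>\<^bsub>D\<^esub> snd Q = snd S \<cdot>\<^bsub>D\<^esub> (g \<diamond>\<^sub>a\<^bsub>D\<^esub> \<one>\<^bsub>C\<^esub> (obj B))"
      and md: "right_module C D B P" "right_module C D B Q" "right_module C D B S"
      using F G by (simp_all add: f g in_Hom_iff)
    note ars = md[THEN right_module_ar, unfolded in_Hom_iff]
    have "(g \<cdot>\<^bsub>D\<^esub> f) \<cdot>\<^bsub>D\<^esub> snd P = g \<cdot>\<^bsub>D\<^esub> snd Q \<cdot>\<^bsub>D\<^esub> (f \<diamond>\<^sub>a\<^bsub>D\<^esub> \<one>\<^bsub>C\<^esub> (obj B))"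
      using ar ars by (simp add: eq(1))
    also have "\<dots> = snd S \<cdot>\<^bsub>D\<^esub> ((g \<cdot>\<^bsub>D\<^esub> f) \<diamond>\<^sub>a\<^bsub>D\<^esub> \<one>\<^bsub>C\<^esub> (obj B))"
      using ar ars T by (simp add: C.reassoc[OF eq(2)] Tcomp)
    finally show "G \<cdot>\<^bsub>rmod_cat C D B\<^esub> F \<in> Hom (rmod_cat C D B) P S"
      using ar md by (simp add: f g in_Hom_iff)
  qed (auto simp: in_Hom_iff right_module_ar)
qed

lemma rmod_rcat_simps [simp]:
  "Ob (rmod_rcat C D A) = Ob (rmod_cat C D A)"
  "Ar (rmod_rcat C D A) = Ar (rmod_cat C D A)"
  "Dom (rmod_rcat C D A) = Dom (rmod_cat C D A)"
  "Cod (rmod_rcat C D A) = Cod (rmod_cat C D A)"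
  "Ide (rmod_rcat C D A) = Ide (rmod_cat C D A)"
  "Comp (rmod_rcat C D A) = Comp (rmod_cat C D A)"
  "actO (rmod_rcat C D A) = rel_ob C D A"
  "actA (rmod_rcat C D A) (P, f, P') (Z, g, Z') =
    (rel_ob C D A P Z, rel_ar C D P f P' Z g Z', rel_ob C D A P' Z')"
  "act_assoc (rmod_rcat C D A) P Z W = (rel_ob C D A (rel_ob C D A P Z) W,
    rel_assoc C D A P Z W, rel_ob C D A P (bimod_ten C A Z W))"
  "act_unit (rmod_rcat C D A) (M, \<rho>) = (rel_ob C D A (M, \<rho>) (unit_bimod A),
    factor D (qmap C D (M, \<rho>) (obj A, mul A)) \<rho>, (M, \<rho>))"
  by (simp_all add: rmod_rcat_def)

lemma Hom_rmod_rcat [simp]: "Hom (rmod_rcat C D A) = Hom (rmod_cat C D A)"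
  by (simp add: Hom_def fun_eq_iff)

lemma bimod_cat_simps [simp]:
  "Ob (bimod_cat C D A) = {Z. admissible_bimodule C D A Z}"
  "Dom (bimod_cat C D A) (P, f, Q) = P"
  "Cod (bimod_cat C D A) (P, f, Q) = Q"
  "Ide (bimod_cat C D A) P = (P, \<one>\<^bsub>C\<^esub> (fst P), P)"
  "Comp (bimod_cat C D A) (Q, g, S) (P, f, Q') = (P, g \<cdot>\<^bsub>C\<^esub> f, S)"
  "tenO (bimod_cat C D A) = bimod_ten C A"
  "tenA (bimod_cat C D A) (P, f, P') (Q, g, Q') = (bimod_ten C A P Q,
    rel_ar C (regular C) (right_part P) f (right_part P') Q g Q', bimod_ten C A P' Q')"
  "unitO (bimod_cat C D A) = unit_bimod A"
  "lunit (bimod_cat C D A) (Y, l, r) = (bimod_ten C A (unit_bimod A) (Y, l, r),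
    factor C (qmap C (regular C) (obj A, mul A) (Y, l)) l, (Y, l, r))"
  "runit (bimod_cat C D A) (Y, l, r) = (bimod_ten C A (Y, l, r) (unit_bimod A),
    factor C (qmap C (regular C) (Y, r) (obj A, mul A)) r, (Y, l, r))"
  by (simp_all add: bimod_cat_def)

lemma bimod_cat_ar [simp]:
  "((Y, l, r), f, (Z, l', r')) \<in> Ar (bimod_cat C D A) \<longleftrightarrow>
    admissible_bimodule C D A (Y, l, r) \<and> admissible_bimodule C D A (Z, l', r') \<and>
    f \<in> Hom C Y Z \<and> f \<cdot>\<^bsub>C\<^esub> l = l' \<cdot>\<^bsub>C\<^esub> (\<one>\<^bsub>C\<^esub> (obj A) \<otimes>\<^sub>a\<^bsub>C\<^esub> f) \<and>
    f \<cdot>\<^bsub>C\<^esub> r = r' \<cdot>\<^bsub>C\<^esub> (f \<otimes>\<^sub>a\<^bsub>C\<^esub> \<one>\<^bsub>C\<^esub> (obj A))"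
  by (simp add: bimod_cat_def)

section \<open>Relative tensor products\<close>

text \<open>With \<open>regular C\<close> for \<open>D\<close> the results below are about the tensor product over \<open>A\<close> in \<open>C\<close>.\<close>

locale algebra_in_right_category = strict_right_category C D
  for C :: "('o, 'a) moncat" (structure) and D :: "('m, 'n, 'o, 'a) rcat" +
  fixes A :: "('o, 'a) alg"
  assumes alg_A: "algebra C A"
    and coequalizers_D: "has_coequalizers D"
begin

lemma A_ar [simp]:
  "obj A \<in> Ob C" "mul A \<in> Ar C" "Dom C (mul A) = obj A \<otimes> obj A" "Cod C (mul A) = obj A"
  "unt A \<in> Ar C" "Dom C (unt A) = unitO C" "Cod C (unt A) = obj A"
  using alg_A by (simp_all add: algebra_def in_Hom_iff)

lemma A_mul:
  "mul A \<cdot> (mul A \<otimes>\<^sub>a \<one> (obj A)) = mul A \<cdot> (\<one> (obj A) \<otimes>\<^sub>a mul A)"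
  "mul A \<cdot> (unt A \<otimes>\<^sub>a \<one> (obj A)) = \<one> (obj A)"
  "mul A \<cdot> (\<one> (obj A) \<otimes>\<^sub>a unt A) = \<one> (obj A)"
  using alg_A by (simp_all add: algebra_def in_Hom_iff)

lemma right_A_module_iff:
  "right_module C D A (M, \<rho>) \<longleftrightarrow> M \<in> Ob D \<and> \<rho> \<in> Ar D \<and> Dom D \<rho> = M \<diamond>\<^bsub>D\<^esub> obj A \<and>
    Cod D \<rho> = M \<and> \<rho> \<cdot>\<^bsub>D\<^esub> (\<rho> \<diamond>\<^sub>a\<^bsub>D\<^esub> \<one> (obj A)) = \<rho> \<cdot>\<^bsub>D\<^esub> (\<one>\<^bsub>D\<^esub> M \<diamond>\<^sub>a\<^bsub>D\<^esub> mul A) \<and>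
    \<rho> \<cdot>\<^bsub>D\<^esub> (\<one>\<^bsub>D\<^esub> M \<diamond>\<^sub>a\<^bsub>D\<^esub> unt A) = \<one>\<^bsub>D\<^esub> M"
  by (rule right_module_iff) (simp_all add: in_Hom_iff)

lemma right_A_module_eqs:
  assumes "right_module C D A (M, \<rho>)"
  shows "\<rho> \<cdot>\<^bsub>D\<^esub> (\<rho> \<diamond>\<^sub>a\<^bsub>D\<^esub> \<one> (obj A)) = \<rho> \<cdot>\<^bsub>D\<^esub> (\<one>\<^bsub>D\<^esub> M \<diamond>\<^sub>a\<^bsub>D\<^esub> mul A)"
    "\<rho> \<cdot>\<^bsub>D\<^esub> (\<one>\<^bsub>D\<^esub> M \<diamond>\<^sub>a\<^bsub>D\<^esub> unt A) = \<one>\<^bsub>D\<^esub> M"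
  using assms unfolding right_A_module_iff by blast+

lemma qmap_coequalizer:
  assumes "right_module C D A (M, \<rho>)" "left_module C A (Z, k)"
  shows "is_coequalizer D (\<rho> \<diamond>\<^sub>a\<^bsub>D\<^esub> \<one> Z) (\<one>\<^bsub>D\<^esub> M \<diamond>\<^sub>a\<^bsub>D\<^esub> k) (qmap C D (M, \<rho>) (Z, k))"
  unfolding qmap.simps using assms coequalizers_D
  by (intro coeq_is_coequalizer) (simp_all add: C.left_module_iff right_A_module_iff)

lemma qmap_ar:
  assumes "right_module C D A (M, \<rho>)" "left_module C A (Z, k)"
  shows "qmap C D (M, \<rho>) (Z, k) \<in> Ar D" "Dom D (qmap C D (M, \<rho>) (Z, k)) = M \<diamond>\<^bsub>D\<^esub> Z"
    "qmap C D (M, \<rho>) (Z, k) \<cdot>\<^bsub>D\<^esub> (\<rho> \<diamond>\<^sub>a\<^bsub>D\<^esub> \<one> Z) =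
      qmap C D (M, \<rho>) (Z, k) \<cdot>\<^bsub>D\<^esub> (\<one>\<^bsub>D\<^esub> M \<diamond>\<^sub>a\<^bsub>D\<^esub> k)"
  using qmap_coequalizer[OF assms] assms
  by (simp_all add: is_coequalizer_def C.left_module_iff right_A_module_iff)

text \<open>The morphism \<open>f \<diamond> g\<close> commutes with both actions of \<open>A\<close> that the coequalizer identifies,
  by linearity of \<open>f\<close> for the one and of \<open>g\<close> for the other.\<close>

lemma rel_ar_qmap:
  fixes k :: 'a and s :: 'a and k' :: 'a and s' :: 'a
  assumes P: "right_module C D A (M, \<rho>)" and P': "right_module C D A (M', \<rho>')"
    and Z: "left_module C A (Z, k)" and Z': "left_module C A (Z', k')"
    and f: "f \<in> Hom D M M'" "f \<cdot>\<^bsub>D\<^esub> \<rho> = \<rho>' \<cdot>\<^bsub>D\<^esub> (f \<diamond>\<^sub>a\<^bsub>D\<^esub> \<one> (obj A))"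
    and g: "g \<in> Hom C Z Z'" "g \<cdot> k = k' \<cdot> (\<one> (obj A) \<otimes>\<^sub>a g)"
  defines "w \<equiv> rel_ar C D (M, \<rho>) f (M', \<rho>') (Z, k, s) g (Z', k', s')"
  shows "w \<in> Ar D" "Dom D w = Cod D (qmap C D (M, \<rho>) (Z, k))"
    "Cod D w = Cod D (qmap C D (M', \<rho>') (Z', k'))"
    "w \<cdot>\<^bsub>D\<^esub> qmap C D (M, \<rho>) (Z, k) = qmap C D (M', \<rho>') (Z', k') \<cdot>\<^bsub>D\<^esub> (f \<diamond>\<^sub>a\<^bsub>D\<^esub> g)"
proof -
  let ?q = "qmap C D (M, \<rho>) (Z, k)" and ?q' = "qmap C D (M', \<rho>') (Z', k')"
  note ar = qmap_ar(1,2)[OF P Z] qmap_ar(1,2)[OF P' Z']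
    P[unfolded right_A_module_iff] P'[unfolded right_A_module_iff]
    Z[unfolded C.left_module_iff] Z'[unfolded C.left_module_iff] f(1) g(1)
  have "(?q' \<cdot>\<^bsub>D\<^esub> (f \<diamond>\<^sub>a\<^bsub>D\<^esub> g)) \<cdot>\<^bsub>D\<^esub> (\<rho> \<diamond>\<^sub>a\<^bsub>D\<^esub> \<one> Z) = ?q' \<cdot>\<^bsub>D\<^esub> ((f \<cdot>\<^bsub>D\<^esub> \<rho>) \<diamond>\<^sub>a\<^bsub>D\<^esub> g)"
    using ar by (simp add: in_Hom_iff)
  also have "\<dots> = ?q' \<cdot>\<^bsub>D\<^esub> (\<rho>' \<diamond>\<^sub>a\<^bsub>D\<^esub> \<one> Z') \<cdot>\<^bsub>D\<^esub> ((f \<diamond>\<^sub>a\<^bsub>D\<^esub> \<one> (obj A)) \<diamond>\<^sub>a\<^bsub>D\<^esub> g)"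
    unfolding f(2) using ar by (simp add: in_Hom_iff del: act_assoc_ar)
  also have "\<dots> = ?q' \<cdot>\<^bsub>D\<^esub> (\<one>\<^bsub>D\<^esub> M' \<diamond>\<^sub>a\<^bsub>D\<^esub> k') \<cdot>\<^bsub>D\<^esub> (f \<diamond>\<^sub>a\<^bsub>D\<^esub> (\<one> (obj A) \<otimes>\<^sub>a g))"
    using ar by (simp add: in_Hom_iff D.reassoc[OF qmap_ar(3)[OF P' Z']] del: act_comp')
  also have "\<dots> = (?q' \<cdot>\<^bsub>D\<^esub> (f \<diamond>\<^sub>a\<^bsub>D\<^esub> g)) \<cdot>\<^bsub>D\<^esub> (\<one>\<^bsub>D\<^esub> M \<diamond>\<^sub>a\<^bsub>D\<^esub> k)"
    using ar by (simp add: in_Hom_iff g(2))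
  finally have "(?q' \<cdot>\<^bsub>D\<^esub> (f \<diamond>\<^sub>a\<^bsub>D\<^esub> g)) \<cdot>\<^bsub>D\<^esub> (\<rho> \<diamond>\<^sub>a\<^bsub>D\<^esub> \<one> Z) =
    (?q' \<cdot>\<^bsub>D\<^esub> (f \<diamond>\<^sub>a\<^bsub>D\<^esub> g)) \<cdot>\<^bsub>D\<^esub> (\<one>\<^bsub>D\<^esub> M \<diamond>\<^sub>a\<^bsub>D\<^esub> k)" .
  from D.coequalizer_factor[OF qmap_coequalizer[OF P Z] _ _ this]
  show "w \<in> Ar D" "Dom D w = Cod D ?q" "Cod D w = Cod D ?q'"
    "w \<cdot>\<^bsub>D\<^esub> ?q = ?q' \<cdot>\<^bsub>D\<^esub> (f \<diamond>\<^sub>a\<^bsub>D\<^esub> g)"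
    unfolding w_def rel_ar_def left_part.simps using ar by (simp_all add: in_Hom_iff)
qed

text \<open>The object \<open>M \<diamond> W\<close> is an \<open>A\<close>-module through \<open>W\<close>, and \<open>(M \<diamond> W) \<diamond>\<^sub>A Z\<close> is by definition a
  coequalizer of the two morphisms here. Robustness identifies it with \<open>M \<diamond> (W \<otimes>\<^sub>A Z)\<close>.\<close>

lemma robust_coequalizer:
  assumes rob: "robust C D A (Z, k)" and Z: "left_module C A (Z, k)" and M: "M \<in> Ob D"
    and W: "right_module C (regular C) A (W, \<rho>)" and C: "has_coequalizers C"
  shows "is_coequalizer D (\<one>\<^bsub>D\<^esub> M \<diamond>\<^sub>a\<^bsub>D\<^esub> (\<rho> \<otimes>\<^sub>a \<one> Z)) (\<one>\<^bsub>D\<^esub> M \<diamond>\<^sub>a\<^bsub>D\<^esub> (\<one> W \<otimes>\<^sub>a k))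
    (\<one>\<^bsub>D\<^esub> M \<diamond>\<^sub>a\<^bsub>D\<^esub> qmap C (regular C) (W, \<rho>) (Z, k))"
proof -
  interpret reg: algebra_in_right_category C "regular C" A
    using C.regular_right_category alg_A C
    by (simp add: algebra_in_right_category_def algebra_in_right_category_axioms_def)
  let ?q = "qmap C D (M \<diamond>\<^bsub>D\<^esub> W, \<one>\<^bsub>D\<^esub> M \<diamond>\<^sub>a\<^bsub>D\<^esub> \<rho>) (Z, k)"
  let ?p = "qmap C (regular C) (W, \<rho>) (Z, k)"
  note ar = Z[unfolded C.left_module_iff] M reg.qmap_ar(1,2)[OF W Z, simplified]
  have W': "W \<in> Ob C" "\<rho> \<in> Ar C" "Dom C \<rho> = W \<otimes> obj A" "Cod C \<rho> = W"
      "\<rho> \<cdot> (\<rho> \<otimes>\<^sub>a \<one> (obj A)) = \<rho> \<cdot> (\<one> W \<otimes>\<^sub>a mul A)" "\<rho> \<cdot> (\<one> W \<otimes>\<^sub>a unt A) = \<one> W"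
    using W by (simp_all add: reg.right_A_module_iff)
  have P: "right_module C D A (M \<diamond>\<^bsub>D\<^esub> W, \<one>\<^bsub>D\<^esub> M \<diamond>\<^sub>a\<^bsub>D\<^esub> \<rho>)"
    unfolding right_A_module_iff using W' M
    by (simp add: act_ide[symmetric] del: act_ide)
  have q: "is_coequalizer D (\<one>\<^bsub>D\<^esub> M \<diamond>\<^sub>a\<^bsub>D\<^esub> (\<rho> \<otimes>\<^sub>a \<one> Z)) (\<one>\<^bsub>D\<^esub> M \<diamond>\<^sub>a\<^bsub>D\<^esub> (\<one> W \<otimes>\<^sub>a k)) ?q"
    using qmap_coequalizer[OF P Z] W' ar by (simp add: act_ide[symmetric] del: act_ide)
  have "(\<one>\<^bsub>D\<^esub> M \<diamond>\<^sub>a\<^bsub>D\<^esub> ?p) \<cdot>\<^bsub>D\<^esub> (\<one>\<^bsub>D\<^esub> M \<diamond>\<^sub>a\<^bsub>D\<^esub> (\<rho> \<otimes>\<^sub>a \<one> Z)) =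
    (\<one>\<^bsub>D\<^esub> M \<diamond>\<^sub>a\<^bsub>D\<^esub> ?p) \<cdot>\<^bsub>D\<^esub> (\<one>\<^bsub>D\<^esub> M \<diamond>\<^sub>a\<^bsub>D\<^esub> (\<one> W \<otimes>\<^sub>a k))"
    using ar W' reg.qmap_ar(3)[OF W Z] by simp
  note c = D.coequalizer_factor[OF q _ _ this]
  have "iso_in D (factor D ?q (\<one>\<^bsub>D\<^esub> M \<diamond>\<^sub>a\<^bsub>D\<^esub> ?p))"
    using rob M W unfolding robust_def by blast
  from D.coequalizer_iso_comp[OF q this] show ?thesis
    using c ar W' qmap_ar(1,2)[OF P Z] by simp
qed

end

section \<open>Rings over an algebra\<close>

text \<open>An \<open>A\<close>-ring given by its components: the bimodule \<open>(Y, l, r)\<close>, the multiplication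
  \<open>m : Y \<otimes>\<^sub>A Y \<rightarrow> Y\<close> and the unit \<open>u : A \<rightarrow> Y\<close>, without the sources and targets that morphisms
  of bimodules carry.\<close>

locale ring_over_algebra = algebra_in_right_category C D A
  for C :: "('o, 'a) moncat" (structure) and D :: "('m, 'n, 'o, 'a) rcat" and A +
  fixes Y :: 'o and l r m u :: 'a
  assumes coequalizers_C: "has_coequalizers C"
    and compatible: "compatible_ring C D A
      \<lparr>obj = (Y, l, r), mul = (bimod_ten C A (Y, l, r) (Y, l, r), m, (Y, l, r)),
       unt = (unit_bimod A, u, (Y, l, r))\<rparr>"
begin

abbreviation R where
  "R \<equiv> \<lparr>obj = (Y, l, r), mul = (bimod_ten C A (Y, l, r) (Y, l, r), m, (Y, l, r)),
    unt = (unit_bimod A, u, (Y, l, r))\<rparr>"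

abbreviation q\<^sub>Y where "q\<^sub>Y \<equiv> qmap C (regular C) (Y, r) (Y, l)"

text \<open>The underlying algebra of the ring in \<open>C\<close>.\<close>

abbreviation B where "B \<equiv> \<lparr>obj = Y, mul = m \<cdot> q\<^sub>Y, unt = u \<cdot> unt A\<rparr>"

lemma regular_algebra: "algebra_in_right_category C (regular C) A"
  using C.regular_right_category alg_A coequalizers_C
  by (simp add: algebra_in_right_category_def algebra_in_right_category_axioms_def)

interpretation reg: algebra_in_right_category C "regular C" A
  by (rule regular_algebra)

lemma coflat: "coflat C D (obj A)" "coflat C D Y"
  and robust: "robust C (regular C) A (Y, l)"
  and left_Y: "left_module C A (Y, l)"
  and right_Y: "right_module C (regular C) A (Y, r)"
  and Y_bimodule: "r \<cdot> (l \<otimes>\<^sub>a \<one> (obj A)) = l \<cdot> (\<one> (obj A) \<otimes>\<^sub>a r)"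
  using compatible
  by (simp_all add: compatible_ring_def algebra_def admissible_bimodule_def bimodule.simps)

lemma Y_ar [simp]:
  "Y \<in> Ob C" "l \<in> Ar C" "Dom C l = obj A \<otimes> Y" "Cod C l = Y"
  "r \<in> Ar C" "Dom C r = Y \<otimes> obj A" "Cod C r = Y"
  using left_Y right_Y by (simp_all add: C.left_module_iff reg.right_A_module_iff)

lemmas qY_ar [simp] = reg.qmap_ar(1,2)[OF right_Y left_Y, simplified]
lemmas qY_eq = reg.qmap_ar(3)[OF right_Y left_Y, simplified]

text \<open>The left action of \<open>A\<close> on \<open>Y \<otimes>\<^sub>A Y\<close>.\<close>

definition L where "L = factor C (\<one> (obj A) \<otimes>\<^sub>a q\<^sub>Y) (q\<^sub>Y \<cdot> (l \<otimes>\<^sub>a \<one> Y))"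

lemma bimod_ten_Y:
  obtains t where "bimod_ten C A (Y, l, r) (Y, l, r) = (Cod C q\<^sub>Y, L, t)"
  by (auto simp: bimod_ten.simps rel_ob.simps Let_def L_def)

text \<open>The action \<open>l \<otimes> Y\<close> descends along \<open>A \<otimes> q\<^sub>Y\<close>: this is a coequalizer because \<open>Y\<close> is robust, and
  \<open>l \<otimes> Y\<close> respects the identification because \<open>l\<close> commutes with \<open>r\<close>.\<close>

lemma L_ar [simp]: "L \<in> Ar C" "Dom C L = obj A \<otimes> Cod C q\<^sub>Y" "Cod C L = Cod C q\<^sub>Y"
  and L_eq: "L \<cdot> (\<one> (obj A) \<otimes>\<^sub>a q\<^sub>Y) = q\<^sub>Y \<cdot> (l \<otimes>\<^sub>a \<one> Y)"
proof -
  have coeq: "is_coequalizer C (\<one> (obj A) \<otimes>\<^sub>a (r \<otimes>\<^sub>a \<one> Y)) (\<one> (obj A) \<otimes>\<^sub>a (\<one> Y \<otimes>\<^sub>a l))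
      (\<one> (obj A) \<otimes>\<^sub>a q\<^sub>Y)"
    using reg.robust_coequalizer[OF robust left_Y _ right_Y coequalizers_C, of "obj A"] by simp
  have "(q\<^sub>Y \<cdot> (l \<otimes>\<^sub>a \<one> Y)) \<cdot> (\<one> (obj A) \<otimes>\<^sub>a (r \<otimes>\<^sub>a \<one> Y)) =
      q\<^sub>Y \<cdot> ((l \<cdot> (\<one> (obj A) \<otimes>\<^sub>a r)) \<otimes>\<^sub>a \<one> Y)"
    by (simp add: C.ten_assoc_ar[symmetric] del: C.ten_assoc_ar)
  also have "\<dots> = q\<^sub>Y \<cdot> (r \<otimes>\<^sub>a \<one> Y) \<cdot> ((l \<otimes>\<^sub>a \<one> (obj A)) \<otimes>\<^sub>a \<one> Y)"
    by (simp add: Y_bimodule[symmetric] del: C.ten_assoc_ar)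
  also have "\<dots> = q\<^sub>Y \<cdot> (\<one> Y \<otimes>\<^sub>a l) \<cdot> (l \<otimes>\<^sub>a \<one> (obj A \<otimes> Y))"
    by (subst C.reassoc[OF qY_eq]) simp_all
  also have "\<dots> = (q\<^sub>Y \<cdot> (l \<otimes>\<^sub>a \<one> Y)) \<cdot> (\<one> (obj A) \<otimes>\<^sub>a (\<one> Y \<otimes>\<^sub>a l))"
    using reg.act_interchange[of l "obj A" Y l Y] by simp
  finally have "(q\<^sub>Y \<cdot> (l \<otimes>\<^sub>a \<one> Y)) \<cdot> (\<one> (obj A) \<otimes>\<^sub>a (r \<otimes>\<^sub>a \<one> Y)) =
    (q\<^sub>Y \<cdot> (l \<otimes>\<^sub>a \<one> Y)) \<cdot> (\<one> (obj A) \<otimes>\<^sub>a (\<one> Y \<otimes>\<^sub>a l))" .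
  from C.coequalizer_factor[OF coeq _ _ this]
  show "L \<in> Ar C" "Dom C L = obj A \<otimes> Cod C q\<^sub>Y" "Cod C L = Cod C q\<^sub>Y"
    "L \<cdot> (\<one> (obj A) \<otimes>\<^sub>a q\<^sub>Y) = q\<^sub>Y \<cdot> (l \<otimes>\<^sub>a \<one> Y)"
    by (simp_all add: L_def)
qed

lemma left_YY: "left_module C A (Cod C q\<^sub>Y, L)"
  and m_ar [simp]: "m \<in> Ar C" "Dom C m = Cod C q\<^sub>Y" "Cod C m = Y"
  and m_left: "m \<cdot> L = l \<cdot> (\<one> (obj A) \<otimes>\<^sub>a m)"
proof -
  obtain t where t: "bimod_ten C A (Y, l, r) (Y, l, r) = (Cod C q\<^sub>Y, L, t)"
    by (rule bimod_ten_Y)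
  show "left_module C A (Cod C q\<^sub>Y, L)" "m \<in> Ar C" "Dom C m = Cod C q\<^sub>Y" "Cod C m = Y"
    "m \<cdot> L = l \<cdot> (\<one> (obj A) \<otimes>\<^sub>a m)"
    using compatible
    by (simp_all add: compatible_ring_def algebra_def admissible_bimodule_def bimodule.simps
        in_Hom_iff t)
qed

lemma u_ar [simp]: "u \<in> Ar C" "Dom C u = obj A" "Cod C u = Y"
  and u_left: "u \<cdot> mul A = l \<cdot> (\<one> (obj A) \<otimes>\<^sub>a u)"
  and u_right: "u \<cdot> mul A = r \<cdot> (u \<otimes>\<^sub>a \<one> (obj A))"
proof -
  have "(unit_bimod A, u, (Y, l, r)) \<in> Ar (bimod_cat C D A)"
    using compatible by (simp add: compatible_ring_def algebra_def in_Hom_iff)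
  then show "u \<in> Ar C" "Dom C u = obj A" "Cod C u = Y"
    "u \<cdot> mul A = l \<cdot> (\<one> (obj A) \<otimes>\<^sub>a u)" "u \<cdot> mul A = r \<cdot> (u \<otimes>\<^sub>a \<one> (obj A))"
    unfolding unit_bimod_def bimod_cat_ar in_Hom_iff by blast+
qed

lemma left_A: "left_module C A (obj A, mul A)"
  and right_A: "right_module C (regular C) A (obj A, mul A)"
  by (simp_all add: C.left_module_iff reg.right_A_module_iff A_mul)

text \<open>The unit laws of the ring hold on \<open>A \<otimes>\<^sub>A Y\<close> and \<open>Y \<otimes>\<^sub>A A\<close>. Composed with the quotient maps
  from \<open>A \<otimes> Y\<close> and \<open>Y \<otimes> A\<close> they say that \<open>A\<close> acts on \<open>Y\<close> through \<open>u\<close> and the multiplication of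
  the underlying algebra.\<close>

lemma mul_unit_left: "(m \<cdot> q\<^sub>Y) \<cdot> (u \<otimes>\<^sub>a \<one> Y) = l"
proof -
  let ?w = "rel_ar C (regular C) (obj A, mul A) u (Y, r) (Y, l, r) (\<one> Y) (Y, l, r)"
  let ?q = "qmap C (regular C) (obj A, mul A) (Y, l)"
  have "m \<cdot> ?w = factor C ?q l"
    using compatible by (simp add: compatible_ring_def algebra_def unit_bimod_def)
  moreover have "?w \<in> Ar C" "Cod C ?w = Cod C q\<^sub>Y" "Dom C ?w = Cod C ?q"
    "?w \<cdot> ?q = q\<^sub>Y \<cdot> (u \<otimes>\<^sub>a \<one> Y)"
    using reg.rel_ar_qmap[OF right_A right_Y left_Y left_Y, of u "\<one> Y" r r]
    by (simp_all add: in_Hom_iff u_right)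
  moreover have "factor C ?q l \<cdot> ?q = l"
    using C.coequalizer_factor(4)[OF reg.qmap_coequalizer[OF right_A left_Y, simplified], of l]
      left_Y reg.qmap_ar(1,2)[OF right_A left_Y] by (simp add: C.left_module_iff)
  ultimately show ?thesis
    using reg.qmap_ar(1,2)[OF right_A left_Y] C.comp_assoc_ar[of ?q ?w m] by simp
qed

lemma mul_unit_right: "(m \<cdot> q\<^sub>Y) \<cdot> (\<one> Y \<otimes>\<^sub>a u) = r"
proof -
  let ?w = "rel_ar C (regular C) (Y, r) (\<one> Y) (Y, r) (obj A, mul A, mul A) u (Y, l, r)"
  let ?q = "qmap C (regular C) (Y, r) (obj A, mul A)"
  have "m \<cdot> ?w = factor C ?q r"
    using compatible by (simp add: compatible_ring_def algebra_def unit_bimod_def)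
  moreover have "?w \<in> Ar C" "Cod C ?w = Cod C q\<^sub>Y" "Dom C ?w = Cod C ?q"
    "?w \<cdot> ?q = q\<^sub>Y \<cdot> (\<one> Y \<otimes>\<^sub>a u)"
    using reg.rel_ar_qmap[OF right_Y right_Y left_A left_Y, of "\<one> Y" u "mul A" r]
    by (simp_all add: in_Hom_iff u_left)
  moreover have "factor C ?q r \<cdot> ?q = r"
    using C.coequalizer_factor(4)[OF reg.qmap_coequalizer[OF right_Y left_A, simplified], of r]
      right_Y reg.qmap_ar(1,2)[OF right_Y left_A] by (simp add: reg.right_A_module_iff)
  ultimately show ?thesis
    using reg.qmap_ar(1,2)[OF right_Y left_A] C.comp_assoc_ar[of ?q ?w m] by simp
qed

section \<open>Tensoring a module with the ring\<close>

abbreviation T where "T M \<rho> \<equiv> rel_ob C D A (M, \<rho>) (Y, l, r)"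
abbreviation q where "q M \<rho> \<equiv> qmap C D (M, \<rho>) (Y, l)"

text \<open>The right action of \<open>A\<close> on \<open>M \<diamond>\<^sub>A Y\<close>.\<close>

definition \<rho>T where
  "\<rho>T M \<rho> = factor D (q M \<rho> \<diamond>\<^sub>a\<^bsub>D\<^esub> \<one> (obj A)) (q M \<rho> \<cdot>\<^bsub>D\<^esub> (\<one>\<^bsub>D\<^esub> M \<diamond>\<^sub>a\<^bsub>D\<^esub> r))"

lemma T_eq: "T M \<rho> = (Cod D (q M \<rho>), \<rho>T M \<rho>)"
  by (simp add: rel_ob.simps Let_def \<rho>T_def)

context
  fixes M :: 'm and \<rho> :: 'n
  assumes P: "right_module C D A (M, \<rho>)"
begin

lemma M_ar [simp]: "M \<in> Ob D" "\<rho> \<in> Ar D" "Dom D \<rho> = M \<diamond>\<^bsub>D\<^esub> obj A" "Cod D \<rho> = M"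
  using P by (simp_all add: right_A_module_iff)

lemmas q_ar [simp] = qmap_ar(1,2)[OF P left_Y]
lemmas q_eq = qmap_ar(3)[OF P left_Y]
lemmas q_coequalizer = qmap_coequalizer[OF P left_Y]
lemmas q_coflat = coflatD[OF coflat(1) q_coequalizer] coflatD[OF coflat(2) q_coequalizer]

text \<open>Coflatness of \<open>A\<close> makes \<open>q \<diamond> A\<close> a coequalizer, along which the right action of \<open>Y\<close> descends
  because it commutes with the left one.\<close>

lemma \<rho>T_ar [simp]:
  "\<rho>T M \<rho> \<in> Ar D" "Dom D (\<rho>T M \<rho>) = Cod D (q M \<rho>) \<diamond>\<^bsub>D\<^esub> obj A"
  "Cod D (\<rho>T M \<rho>) = Cod D (q M \<rho>)"
  and \<rho>T_q: "\<rho>T M \<rho> \<cdot>\<^bsub>D\<^esub> (q M \<rho> \<diamond>\<^sub>a\<^bsub>D\<^esub> \<one> (obj A)) = q M \<rho> \<cdot>\<^bsub>D\<^esub> (\<one>\<^bsub>D\<^esub> M \<diamond>\<^sub>a\<^bsub>D\<^esub> r)"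
proof -
  have "(q M \<rho> \<cdot>\<^bsub>D\<^esub> (\<one>\<^bsub>D\<^esub> M \<diamond>\<^sub>a\<^bsub>D\<^esub> r)) \<cdot>\<^bsub>D\<^esub> ((\<rho> \<diamond>\<^sub>a\<^bsub>D\<^esub> \<one> Y) \<diamond>\<^sub>a\<^bsub>D\<^esub> \<one> (obj A)) =
      q M \<rho> \<cdot>\<^bsub>D\<^esub> (\<rho> \<diamond>\<^sub>a\<^bsub>D\<^esub> \<one> Y) \<cdot>\<^bsub>D\<^esub> (\<one>\<^bsub>D\<^esub> M \<diamond>\<^sub>a\<^bsub>D\<^esub> (\<one> (obj A) \<otimes>\<^sub>a r))"
    using act_interchange[of \<rho> M "obj A" r Y] by simp
  also have "\<dots> = q M \<rho> \<cdot>\<^bsub>D\<^esub> (\<one>\<^bsub>D\<^esub> M \<diamond>\<^sub>a\<^bsub>D\<^esub> (r \<cdot> (l \<otimes>\<^sub>a \<one> (obj A))))"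
    by (simp add: D.reassoc[OF q_eq] Y_bimodule)
  also have "\<dots> = (q M \<rho> \<cdot>\<^bsub>D\<^esub> (\<one>\<^bsub>D\<^esub> M \<diamond>\<^sub>a\<^bsub>D\<^esub> r)) \<cdot>\<^bsub>D\<^esub> ((\<one>\<^bsub>D\<^esub> M \<diamond>\<^sub>a\<^bsub>D\<^esub> l) \<diamond>\<^sub>a\<^bsub>D\<^esub> \<one> (obj A))"
    by simp
  finally have "(q M \<rho> \<cdot>\<^bsub>D\<^esub> (\<one>\<^bsub>D\<^esub> M \<diamond>\<^sub>a\<^bsub>D\<^esub> r)) \<cdot>\<^bsub>D\<^esub> ((\<rho> \<diamond>\<^sub>a\<^bsub>D\<^esub> \<one> Y) \<diamond>\<^sub>a\<^bsub>D\<^esub> \<one> (obj A)) =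
      (q M \<rho> \<cdot>\<^bsub>D\<^esub> (\<one>\<^bsub>D\<^esub> M \<diamond>\<^sub>a\<^bsub>D\<^esub> r)) \<cdot>\<^bsub>D\<^esub> ((\<one>\<^bsub>D\<^esub> M \<diamond>\<^sub>a\<^bsub>D\<^esub> l) \<diamond>\<^sub>a\<^bsub>D\<^esub> \<one> (obj A))" .
  from D.coequalizer_factor[OF q_coflat(1) _ _ this]
  show "\<rho>T M \<rho> \<in> Ar D" "Dom D (\<rho>T M \<rho>) = Cod D (q M \<rho>) \<diamond>\<^bsub>D\<^esub> obj A"
    "Cod D (\<rho>T M \<rho>) = Cod D (q M \<rho>)"
    "\<rho>T M \<rho> \<cdot>\<^bsub>D\<^esub> (q M \<rho> \<diamond>\<^sub>a\<^bsub>D\<^esub> \<one> (obj A)) = q M \<rho> \<cdot>\<^bsub>D\<^esub> (\<one>\<^bsub>D\<^esub> M \<diamond>\<^sub>a\<^bsub>D\<^esub> r)"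
    by (simp_all add: \<rho>T_def)
qed

text \<open>The axioms are inherited from \<open>r\<close>. Associativity is tested on \<open>M \<diamond> Y \<diamond> A \<diamond> A\<close>, which
  takes the coflatness of \<open>A\<close> twice.\<close>

lemma T_module: "right_module C D A (Cod D (q M \<rho>), \<rho>T M \<rho>)"
proof -
  let ?q = "q M \<rho>" and ?p = "\<rho>T M \<rho>"
  note rY = right_Y[unfolded reg.right_A_module_iff, simplified]
  have epi2: "epi D ((?q \<diamond>\<^sub>a\<^bsub>D\<^esub> \<one> (obj A)) \<diamond>\<^sub>a\<^bsub>D\<^esub> \<one> (obj A))"
    by (rule D.coequalizer_epi[OF coflatD[OF coflat(1) q_coflat(1)]])
  have "?p \<cdot>\<^bsub>D\<^esub> (?p \<diamond>\<^sub>a\<^bsub>D\<^esub> \<one> (obj A)) = ?p \<cdot>\<^bsub>D\<^esub> (\<one>\<^bsub>D\<^esub> (Cod D ?q) \<diamond>\<^sub>a\<^bsub>D\<^esub> mul A)"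
  proof (rule epiD[OF epi2])
    have "(?p \<cdot>\<^bsub>D\<^esub> (?p \<diamond>\<^sub>a\<^bsub>D\<^esub> \<one> (obj A))) \<cdot>\<^bsub>D\<^esub> ((?q \<diamond>\<^sub>a\<^bsub>D\<^esub> \<one> (obj A)) \<diamond>\<^sub>a\<^bsub>D\<^esub> \<one> (obj A)) =
        ?p \<cdot>\<^bsub>D\<^esub> ((?p \<cdot>\<^bsub>D\<^esub> (?q \<diamond>\<^sub>a\<^bsub>D\<^esub> \<one> (obj A))) \<diamond>\<^sub>a\<^bsub>D\<^esub> \<one> (obj A))"
      by (simp del: act_assoc_ar)
    also have "\<dots> = ?p \<cdot>\<^bsub>D\<^esub> (?q \<diamond>\<^sub>a\<^bsub>D\<^esub> \<one> (obj A)) \<cdot>\<^bsub>D\<^esub> ((\<one>\<^bsub>D\<^esub> M \<diamond>\<^sub>a\<^bsub>D\<^esub> r) \<diamond>\<^sub>a\<^bsub>D\<^esub> \<one> (obj A))"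
      by (simp add: \<rho>T_q del: act_assoc_ar)
    also have "\<dots> = ?q \<cdot>\<^bsub>D\<^esub> (\<one>\<^bsub>D\<^esub> M \<diamond>\<^sub>a\<^bsub>D\<^esub> (r \<cdot> (\<one> Y \<otimes>\<^sub>a mul A)))"
      by (subst D.reassoc[OF \<rho>T_q]) (simp_all add: rY)
    also have "\<dots> = ?p \<cdot>\<^bsub>D\<^esub> (?q \<diamond>\<^sub>a\<^bsub>D\<^esub> \<one> (obj A)) \<cdot>\<^bsub>D\<^esub> (\<one>\<^bsub>D\<^esub> M \<diamond>\<^sub>a\<^bsub>D\<^esub> (\<one> Y \<otimes>\<^sub>a mul A))"
      by (subst D.reassoc[OF \<rho>T_q]) simp_all
    also have "\<dots> = ?p \<cdot>\<^bsub>D\<^esub> (?q \<diamond>\<^sub>a\<^bsub>D\<^esub> mul A)"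
      using act_interchange[of ?q M Y "mul A" "obj A"] by simp
    also have "\<dots> = (?p \<cdot>\<^bsub>D\<^esub> (\<one>\<^bsub>D\<^esub> (Cod D ?q) \<diamond>\<^sub>a\<^bsub>D\<^esub> mul A)) \<cdot>\<^bsub>D\<^esub>
        ((?q \<diamond>\<^sub>a\<^bsub>D\<^esub> \<one> (obj A)) \<diamond>\<^sub>a\<^bsub>D\<^esub> \<one> (obj A))"
      by simp
    finally show "(?p \<cdot>\<^bsub>D\<^esub> (?p \<diamond>\<^sub>a\<^bsub>D\<^esub> \<one> (obj A))) \<cdot>\<^bsub>D\<^esub> ((?q \<diamond>\<^sub>a\<^bsub>D\<^esub> \<one> (obj A)) \<diamond>\<^sub>a\<^bsub>D\<^esub> \<one> (obj A)) =
        (?p \<cdot>\<^bsub>D\<^esub> (\<one>\<^bsub>D\<^esub> (Cod D ?q) \<diamond>\<^sub>a\<^bsub>D\<^esub> mul A)) \<cdot>\<^bsub>D\<^esub>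
        ((?q \<diamond>\<^sub>a\<^bsub>D\<^esub> \<one> (obj A)) \<diamond>\<^sub>a\<^bsub>D\<^esub> \<one> (obj A))" .
  qed simp_all
  moreover have "?p \<cdot>\<^bsub>D\<^esub> (\<one>\<^bsub>D\<^esub> (Cod D ?q) \<diamond>\<^sub>a\<^bsub>D\<^esub> unt A) = \<one>\<^bsub>D\<^esub> (Cod D ?q)"
  proof (rule epiD[OF D.coequalizer_epi[OF q_coequalizer]])
    have "(?p \<cdot>\<^bsub>D\<^esub> (\<one>\<^bsub>D\<^esub> (Cod D ?q) \<diamond>\<^sub>a\<^bsub>D\<^esub> unt A)) \<cdot>\<^bsub>D\<^esub> (?q \<diamond>\<^sub>a\<^bsub>D\<^esub> \<one> (unitO C)) =
        ?p \<cdot>\<^bsub>D\<^esub> (?q \<diamond>\<^sub>a\<^bsub>D\<^esub> unt A)"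
      by (simp del: act_unit_ar)
    also have "\<dots> = ?p \<cdot>\<^bsub>D\<^esub> (?q \<diamond>\<^sub>a\<^bsub>D\<^esub> \<one> (obj A)) \<cdot>\<^bsub>D\<^esub> (\<one>\<^bsub>D\<^esub> M \<diamond>\<^sub>a\<^bsub>D\<^esub> (\<one> Y \<otimes>\<^sub>a unt A))"
      using act_interchange[of ?q M Y "unt A" "obj A"] by simp
    also have "\<dots> = ?q \<cdot>\<^bsub>D\<^esub> (\<one>\<^bsub>D\<^esub> M \<diamond>\<^sub>a\<^bsub>D\<^esub> (r \<cdot> (\<one> Y \<otimes>\<^sub>a unt A)))"
      by (subst D.reassoc[OF \<rho>T_q]) simp_all
    finally show "(?p \<cdot>\<^bsub>D\<^esub> (\<one>\<^bsub>D\<^esub> (Cod D ?q) \<diamond>\<^sub>a\<^bsub>D\<^esub> unt A)) \<cdot>\<^bsub>D\<^esub> ?q = \<one>\<^bsub>D\<^esub> (Cod D ?q) \<cdot>\<^bsub>D\<^esub> ?q"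
      by (simp add: rY)
  qed simp_all
  ultimately show ?thesis
    by (simp add: right_A_module_iff)
qed

text \<open>Equations between morphisms out of \<open>(M \<diamond>\<^sub>A Y) \<diamond>\<^sub>A Y\<close> can be tested on \<open>M \<diamond> Y \<diamond> Y\<close>.\<close>

lemma qT_epi: "epi D (qmap C D (T M \<rho>) (Y, l) \<cdot>\<^bsub>D\<^esub> (q M \<rho> \<diamond>\<^sub>a\<^bsub>D\<^esub> \<one> Y))"
  unfolding T_eq using qmap_ar(2)[OF T_module left_Y]
  by (intro D.epi_comp D.coequalizer_epi[OF q_coflat(2)]
      D.coequalizer_epi[OF qmap_coequalizer[OF T_module left_Y]]) simp

text \<open>The morphism \<open>M \<diamond> Y \<diamond> Y \<rightarrow> M \<diamond>\<^sub>A (Y \<otimes>\<^sub>A Y)\<close> descends in two stages, along \<open>q \<diamond> Y\<close> by the left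
  action on \<open>Y \<otimes>\<^sub>A Y\<close>, and then along the quotient map to \<open>(M \<diamond>\<^sub>A Y) \<diamond>\<^sub>A Y\<close> because \<open>q\<^sub>Y\<close> identifies
  the two inner actions.\<close>

lemma rel_assoc_q:
  defines "v \<equiv> rel_assoc C D A (M, \<rho>) (Y, l, r) (Y, l, r)"
  shows "v \<in> Ar D" "Dom D v = Cod D (qmap C D (T M \<rho>) (Y, l))"
    "Cod D v = Cod D (qmap C D (M, \<rho>) (Cod C q\<^sub>Y, L))"
    "v \<cdot>\<^bsub>D\<^esub> qmap C D (T M \<rho>) (Y, l) \<cdot>\<^bsub>D\<^esub> (q M \<rho> \<diamond>\<^sub>a\<^bsub>D\<^esub> \<one> Y) =
      qmap C D (M, \<rho>) (Cod C q\<^sub>Y, L) \<cdot>\<^bsub>D\<^esub> (\<one>\<^bsub>D\<^esub> M \<diamond>\<^sub>a\<^bsub>D\<^esub> q\<^sub>Y)"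
proof -
  let ?q = "q M \<rho>" and ?p = "\<rho>T M \<rho>"
  let ?qT = "qmap C D (T M \<rho>) (Y, l)" and ?qL = "qmap C D (M, \<rho>) (Cod C q\<^sub>Y, L)"
  let ?h = "?qL \<cdot>\<^bsub>D\<^esub> (\<one>\<^bsub>D\<^esub> M \<diamond>\<^sub>a\<^bsub>D\<^esub> q\<^sub>Y)"
  note qL [simp] = qmap_ar(1,2)[OF P left_YY]
  note qT_coeq = qmap_coequalizer[OF T_module left_Y, folded T_eq]
  note qT [simp] = qmap_ar(1,2)[OF T_module left_Y, folded T_eq]
  obtain t where t: "bimod_ten C A (Y, l, r) (Y, l, r) = (Cod C q\<^sub>Y, L, t)"
    by (rule bimod_ten_Y)
  have v: "v = factor D (?qT \<cdot>\<^bsub>D\<^esub> (?q \<diamond>\<^sub>a\<^bsub>D\<^esub> \<one> Y)) ?h"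
    unfolding v_def rel_assoc_def by (simp add: t)
  have "?h \<cdot>\<^bsub>D\<^esub> ((\<rho> \<diamond>\<^sub>a\<^bsub>D\<^esub> \<one> Y) \<diamond>\<^sub>a\<^bsub>D\<^esub> \<one> Y) =
      ?qL \<cdot>\<^bsub>D\<^esub> (\<rho> \<diamond>\<^sub>a\<^bsub>D\<^esub> \<one> (Cod C q\<^sub>Y)) \<cdot>\<^bsub>D\<^esub> (\<one>\<^bsub>D\<^esub> M \<diamond>\<^sub>a\<^bsub>D\<^esub> (\<one> (obj A) \<otimes>\<^sub>a q\<^sub>Y))"
    using act_interchange[of \<rho> M "obj A" q\<^sub>Y "Cod C q\<^sub>Y"] by simp
  also have "\<dots> = ?qL \<cdot>\<^bsub>D\<^esub> (\<one>\<^bsub>D\<^esub> M \<diamond>\<^sub>a\<^bsub>D\<^esub> (L \<cdot> (\<one> (obj A) \<otimes>\<^sub>a q\<^sub>Y)))"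
    by (simp add: D.reassoc[OF qmap_ar(3)[OF P left_YY]])
  also have "\<dots> = ?h \<cdot>\<^bsub>D\<^esub> ((\<one>\<^bsub>D\<^esub> M \<diamond>\<^sub>a\<^bsub>D\<^esub> l) \<diamond>\<^sub>a\<^bsub>D\<^esub> \<one> Y)"
    by (simp add: L_eq)
  finally have "?h \<cdot>\<^bsub>D\<^esub> ((\<rho> \<diamond>\<^sub>a\<^bsub>D\<^esub> \<one> Y) \<diamond>\<^sub>a\<^bsub>D\<^esub> \<one> Y) =
    ?h \<cdot>\<^bsub>D\<^esub> ((\<one>\<^bsub>D\<^esub> M \<diamond>\<^sub>a\<^bsub>D\<^esub> l) \<diamond>\<^sub>a\<^bsub>D\<^esub> \<one> Y)" .
  note h1 = D.coequalizer_factor[OF q_coflat(2) _ _ this]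
  define h1 where "h1 = factor D (?q \<diamond>\<^sub>a\<^bsub>D\<^esub> \<one> Y) ?h"
  have h1_ar [simp]: "h1 \<in> Ar D" "Dom D h1 = Cod D ?q \<diamond>\<^bsub>D\<^esub> Y" "Cod D h1 = Cod D ?qL"
    and h1_q: "h1 \<cdot>\<^bsub>D\<^esub> (?q \<diamond>\<^sub>a\<^bsub>D\<^esub> \<one> Y) = ?h"
    using h1 by (simp_all add: h1_def)
  have h1_coeq: "h1 \<cdot>\<^bsub>D\<^esub> (?p \<diamond>\<^sub>a\<^bsub>D\<^esub> \<one> Y) = h1 \<cdot>\<^bsub>D\<^esub> (\<one>\<^bsub>D\<^esub> (Cod D ?q) \<diamond>\<^sub>a\<^bsub>D\<^esub> l)"
  proof (rule epiD[OF D.coequalizer_epi[OF coflatD[OF coflat(2) q_coflat(1)]]])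
    have "(h1 \<cdot>\<^bsub>D\<^esub> (?p \<diamond>\<^sub>a\<^bsub>D\<^esub> \<one> Y)) \<cdot>\<^bsub>D\<^esub> ((?q \<diamond>\<^sub>a\<^bsub>D\<^esub> \<one> (obj A)) \<diamond>\<^sub>a\<^bsub>D\<^esub> \<one> Y) =
        h1 \<cdot>\<^bsub>D\<^esub> ((?p \<cdot>\<^bsub>D\<^esub> (?q \<diamond>\<^sub>a\<^bsub>D\<^esub> \<one> (obj A))) \<diamond>\<^sub>a\<^bsub>D\<^esub> \<one> Y)"
      by (simp del: act_assoc_ar)
    also have "\<dots> = h1 \<cdot>\<^bsub>D\<^esub> (?q \<diamond>\<^sub>a\<^bsub>D\<^esub> \<one> Y) \<cdot>\<^bsub>D\<^esub> ((\<one>\<^bsub>D\<^esub> M \<diamond>\<^sub>a\<^bsub>D\<^esub> r) \<diamond>\<^sub>a\<^bsub>D\<^esub> \<one> Y)"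
      by (simp add: \<rho>T_q del: act_assoc_ar)
    also have "\<dots> = ?qL \<cdot>\<^bsub>D\<^esub> (\<one>\<^bsub>D\<^esub> M \<diamond>\<^sub>a\<^bsub>D\<^esub> (q\<^sub>Y \<cdot> (r \<otimes>\<^sub>a \<one> Y)))"
      by (subst D.reassoc[OF h1_q]) simp_all
    also have "\<dots> = h1 \<cdot>\<^bsub>D\<^esub> (?q \<diamond>\<^sub>a\<^bsub>D\<^esub> \<one> Y) \<cdot>\<^bsub>D\<^esub> (\<one>\<^bsub>D\<^esub> M \<diamond>\<^sub>a\<^bsub>D\<^esub> (\<one> Y \<otimes>\<^sub>a l))"
      by (subst D.reassoc[OF h1_q]) (simp_all add: qY_eq)
    also have "\<dots> = h1 \<cdot>\<^bsub>D\<^esub> (?q \<diamond>\<^sub>a\<^bsub>D\<^esub> l)"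
      using act_interchange[of ?q M Y l Y] by simp
    also have "\<dots> = (h1 \<cdot>\<^bsub>D\<^esub> (\<one>\<^bsub>D\<^esub> (Cod D ?q) \<diamond>\<^sub>a\<^bsub>D\<^esub> l)) \<cdot>\<^bsub>D\<^esub>
        ((?q \<diamond>\<^sub>a\<^bsub>D\<^esub> \<one> (obj A)) \<diamond>\<^sub>a\<^bsub>D\<^esub> \<one> Y)"
      by simp
    finally show "(h1 \<cdot>\<^bsub>D\<^esub> (?p \<diamond>\<^sub>a\<^bsub>D\<^esub> \<one> Y)) \<cdot>\<^bsub>D\<^esub> ((?q \<diamond>\<^sub>a\<^bsub>D\<^esub> \<one> (obj A)) \<diamond>\<^sub>a\<^bsub>D\<^esub> \<one> Y) =
        (h1 \<cdot>\<^bsub>D\<^esub> (\<one>\<^bsub>D\<^esub> (Cod D ?q) \<diamond>\<^sub>a\<^bsub>D\<^esub> l)) \<cdot>\<^bsub>D\<^esub>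
        ((?q \<diamond>\<^sub>a\<^bsub>D\<^esub> \<one> (obj A)) \<diamond>\<^sub>a\<^bsub>D\<^esub> \<one> Y)" .
  qed simp_all
  note h2 = D.coequalizer_factor[OF qT_coeq _ _ h1_coeq, simplified]
  have "v = factor D ?qT h1"
    unfolding v using h2
    by (intro D.factor_eqI[OF qT_epi]) (simp_all add: D.reassoc[OF h2(4)] h1_q)
  then show "v \<in> Ar D" "Dom D v = Cod D ?qT" "Cod D v = Cod D ?qL"
    "v \<cdot>\<^bsub>D\<^esub> ?qT \<cdot>\<^bsub>D\<^esub> (?q \<diamond>\<^sub>a\<^bsub>D\<^esub> \<one> Y) = ?h"
    using h2 by (simp_all add: D.reassoc[OF h2(4)] h1_q)
qed

end

(* Outside this context the rule M \<in> Ob D would have to guess an action on M. *)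
declare M_ar [simp del] q_ar [simp del] \<rho>T_ar [simp del]

section \<open>Modules over the ring\<close>

lemma rmod_A_category: "category (rmod_rcat C D A)"
proof -
  have "category (rmod_cat C D A)"
    by (rule rmod_cat_category[OF act_functor]) simp
  then show ?thesis by (simp add: category_def)
qed

lemma Y_linear_id: "\<one> Y \<in> Hom C Y Y" "\<one> Y \<cdot> l = l \<cdot> (\<one> (obj A) \<otimes>\<^sub>a \<one> Y)"
  by (simp_all add: in_Hom_iff)

abbreviation map_T where
  "map_T M \<rho> f M' \<rho>' \<equiv> rel_ar C D (M, \<rho>) f (M', \<rho>') (Y, l, r) (\<one> Y) (Y, l, r)"

lemma map_T_linear:
  assumes P: "right_module C D A (M, \<rho>)" and P': "right_module C D A (M', \<rho>')"
    and f: "f \<in> Hom D M M'" "f \<cdot>\<^bsub>D\<^esub> \<rho> = \<rho>' \<cdot>\<^bsub>D\<^esub> (f \<diamond>\<^sub>a\<^bsub>D\<^esub> \<one> (obj A))"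
  shows "map_T M \<rho> f M' \<rho>' \<cdot>\<^bsub>D\<^esub> \<rho>T M \<rho> = \<rho>T M' \<rho>' \<cdot>\<^bsub>D\<^esub> (map_T M \<rho> f M' \<rho>' \<diamond>\<^sub>a\<^bsub>D\<^esub> \<one> (obj A))"
proof (rule epiD[OF D.coequalizer_epi[OF q_coflat(1)[OF P]]])
  let ?w = "map_T M \<rho> f M' \<rho>'" and ?q = "q M \<rho>" and ?q' = "q M' \<rho>'"
  note w = rel_ar_qmap[OF P P' left_Y left_Y f Y_linear_id, of r r]
  note ar = M_ar[OF P] M_ar[OF P'] q_ar[OF P] q_ar[OF P'] \<rho>T_ar[OF P] \<rho>T_ar[OF P']
  have f_ar: "f \<in> Ar D" "Dom D f = M" "Cod D f = M'" using f(1) by (simp_all add: in_Hom_iff)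
  have "(?w \<cdot>\<^bsub>D\<^esub> \<rho>T M \<rho>) \<cdot>\<^bsub>D\<^esub> (?q \<diamond>\<^sub>a\<^bsub>D\<^esub> \<one> (obj A)) = (?w \<cdot>\<^bsub>D\<^esub> ?q) \<cdot>\<^bsub>D\<^esub> (\<one>\<^bsub>D\<^esub> M \<diamond>\<^sub>a\<^bsub>D\<^esub> r)"
    using w(1-3) by (simp add: ar \<rho>T_q[OF P])
  also have "\<dots> = ?q' \<cdot>\<^bsub>D\<^esub> (f \<diamond>\<^sub>a\<^bsub>D\<^esub> r)"
    unfolding w(4) by (simp add: ar f_ar)
  also have "\<dots> = (\<rho>T M' \<rho>' \<cdot>\<^bsub>D\<^esub> (?q' \<diamond>\<^sub>a\<^bsub>D\<^esub> \<one> (obj A))) \<cdot>\<^bsub>D\<^esub> ((f \<diamond>\<^sub>a\<^bsub>D\<^esub> \<one> Y) \<diamond>\<^sub>a\<^bsub>D\<^esub> \<one> (obj A))"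
    unfolding \<rho>T_q[OF P'] by (simp add: ar f_ar)
  also have "\<dots> = \<rho>T M' \<rho>' \<cdot>\<^bsub>D\<^esub> ((?w \<cdot>\<^bsub>D\<^esub> ?q) \<diamond>\<^sub>a\<^bsub>D\<^esub> \<one> (obj A))"
    unfolding w(4) by (simp add: ar f_ar del: act_assoc_ar)
  also have "\<dots> = (\<rho>T M' \<rho>' \<cdot>\<^bsub>D\<^esub> (?w \<diamond>\<^sub>a\<^bsub>D\<^esub> \<one> (obj A))) \<cdot>\<^bsub>D\<^esub> (?q \<diamond>\<^sub>a\<^bsub>D\<^esub> \<one> (obj A))"
    using w(1-3) by (simp add: ar)
  finally show "(?w \<cdot>\<^bsub>D\<^esub> \<rho>T M \<rho>) \<cdot>\<^bsub>D\<^esub> (?q \<diamond>\<^sub>a\<^bsub>D\<^esub> \<one> (obj A)) =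
    (\<rho>T M' \<rho>' \<cdot>\<^bsub>D\<^esub> (?w \<diamond>\<^sub>a\<^bsub>D\<^esub> \<one> (obj A))) \<cdot>\<^bsub>D\<^esub> (?q \<diamond>\<^sub>a\<^bsub>D\<^esub> \<one> (obj A))" .
qed (use rel_ar_qmap(1-3)[OF P P' left_Y left_Y f Y_linear_id, of r r]
      M_ar[OF P] M_ar[OF P'] q_ar[OF P] q_ar[OF P'] \<rho>T_ar[OF P] \<rho>T_ar[OF P'] in simp_all)

text \<open>The action of the ring on the category of \<open>A\<close>-modules, in the form in which
  \<open>rmod_cat_category\<close> takes it.\<close>

lemma tensor_functor:
  "cat_functor (rmod_rcat C D A) (rmod_rcat C D A) (\<lambda>P. rel_ob C D A P (Y, l, r))
    (\<lambda>F. F \<diamond>\<^sub>a\<^bsub>rmod_rcat C D A\<^esub> \<one>\<^bsub>bimod_cat C D A\<^esub> (Y, l, r))"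
proof (intro cat_functor.intro cat_functor_axioms.intro rmod_A_category)
  fix P assume "P \<in> Ob (rmod_rcat C D A)"
  then obtain M \<rho> where P: "P = (M, \<rho>)" "right_module C D A (M, \<rho>)"
    by (cases P) simp
  show "rel_ob C D A P (Y, l, r) \<in> Ob (rmod_rcat C D A)"
    using T_module[OF P(2)] by (simp add: P T_eq)
  have "map_T M \<rho> (\<one>\<^bsub>D\<^esub> M) M \<rho> = \<one>\<^bsub>D\<^esub> (Cod D (q M \<rho>))"
    unfolding rel_ar_def
    by (rule D.factor_eqI[OF D.coequalizer_epi]) (use P(2) q_coequalizer M_ar q_ar in simp_all)
  then show "\<one>\<^bsub>rmod_rcat C D A\<^esub> P \<diamond>\<^sub>a\<^bsub>rmod_rcat C D A\<^esub> \<one>\<^bsub>bimod_cat C D A\<^esub> (Y, l, r) =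
      \<one>\<^bsub>rmod_rcat C D A\<^esub> (rel_ob C D A P (Y, l, r))"
    by (simp add: P T_eq)
next
  fix F P P' assume F: "F \<in> Hom (rmod_rcat C D A) P P'"
  obtain M \<rho> M' \<rho>' f where *: "P = (M, \<rho>)" "P' = (M', \<rho>')" "F = (P, f, P')"
    using F by (cases P; cases P'; cases F) (auto simp: in_Hom_iff)
  have P: "right_module C D A (M, \<rho>)" "right_module C D A (M', \<rho>')"
    and f: "f \<in> Hom D M M'" "f \<cdot>\<^bsub>D\<^esub> \<rho> = \<rho>' \<cdot>\<^bsub>D\<^esub> (f \<diamond>\<^sub>a\<^bsub>D\<^esub> \<one> (obj A))"
    using F by (simp_all add: * in_Hom_iff)
  show "F \<diamond>\<^sub>a\<^bsub>rmod_rcat C D A\<^esub> \<one>\<^bsub>bimod_cat C D A\<^esub> (Y, l, r) \<in> Hom (rmod_rcat C D A)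
      (rel_ob C D A P (Y, l, r)) (rel_ob C D A P' (Y, l, r))"
    using map_T_linear[OF P f] T_module[OF P(1)] T_module[OF P(2)]
      rel_ar_qmap(1-3)[OF P left_Y left_Y f Y_linear_id, of r r]
    by (simp add: * T_eq in_Hom_iff)
next
  fix F P P' G P''
  assume F: "F \<in> Hom (rmod_rcat C D A) P P'" and G: "G \<in> Hom (rmod_rcat C D A) P' P''"
  obtain M \<rho> M' \<rho>' f where *: "P = (M, \<rho>)" "P' = (M', \<rho>')" "F = (P, f, P')"
    using F by (cases P; cases P'; cases F) (auto simp: in_Hom_iff)
  obtain M'' \<rho>'' g where **: "P'' = (M'', \<rho>'')" "G = (P', g, P'')"
    using G by (cases P''; cases G) (auto simp: in_Hom_iff)
  have P: "right_module C D A (M, \<rho>)" "right_module C D A (M', \<rho>')"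
      "right_module C D A (M'', \<rho>'')"
    and f: "f \<in> Hom D M M'" "f \<cdot>\<^bsub>D\<^esub> \<rho> = \<rho>' \<cdot>\<^bsub>D\<^esub> (f \<diamond>\<^sub>a\<^bsub>D\<^esub> \<one> (obj A))"
    and g: "g \<in> Hom D M' M''" "g \<cdot>\<^bsub>D\<^esub> \<rho>' = \<rho>'' \<cdot>\<^bsub>D\<^esub> (g \<diamond>\<^sub>a\<^bsub>D\<^esub> \<one> (obj A))"
    using F G by (simp_all add: * ** in_Hom_iff)
  note wf = rel_ar_qmap[OF P(1,2) left_Y left_Y f Y_linear_id, of r r]
  note wg = rel_ar_qmap[OF P(2,3) left_Y left_Y g Y_linear_id, of r r]
  have "map_T M \<rho> (g \<cdot>\<^bsub>D\<^esub> f) M'' \<rho>'' = map_T M' \<rho>' g M'' \<rho>'' \<cdot>\<^bsub>D\<^esub> map_T M \<rho> f M' \<rho>'"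
    unfolding rel_ar_def[of C D "(M, \<rho>)" "g \<cdot>\<^bsub>D\<^esub> f"] left_part.simps
  proof (rule D.factor_eqI[OF D.coequalizer_epi[OF q_coequalizer[OF P(1)]]])
    show "(map_T M' \<rho>' g M'' \<rho>'' \<cdot>\<^bsub>D\<^esub> map_T M \<rho> f M' \<rho>') \<cdot>\<^bsub>D\<^esub> q M \<rho> =
        q M'' \<rho>'' \<cdot>\<^bsub>D\<^esub> ((g \<cdot>\<^bsub>D\<^esub> f) \<diamond>\<^sub>a\<^bsub>D\<^esub> \<one> Y)"
      using f(1) g(1) wf wg M_ar[OF P(1)] M_ar[OF P(2)] M_ar[OF P(3)] q_ar[OF P(1)] q_ar[OF P(2)]
        q_ar[OF P(3)]
      by (simp add: in_Hom_iff D.reassoc[OF wg(4)])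
  qed (use wf wg in simp_all)
  then show "(G \<cdot>\<^bsub>rmod_rcat C D A\<^esub> F) \<diamond>\<^sub>a\<^bsub>rmod_rcat C D A\<^esub> \<one>\<^bsub>bimod_cat C D A\<^esub> (Y, l, r) =
      (G \<diamond>\<^sub>a\<^bsub>rmod_rcat C D A\<^esub> \<one>\<^bsub>bimod_cat C D A\<^esub> (Y, l, r)) \<cdot>\<^bsub>rmod_rcat C D A\<^esub>
      (F \<diamond>\<^sub>a\<^bsub>rmod_rcat C D A\<^esub> \<one>\<^bsub>bimod_cat C D A\<^esub> (Y, l, r))"
    by (simp add: * **)
qed

text \<open>The conditions on \<open>\<tau> : M \<diamond> Y \<rightarrow> M\<close> under which it comes from an action \<open>M \<diamond>\<^sub>A Y \<rightarrow> M\<close> of the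
  ring: it is balanced, right linear, associative and unital, in this order.\<close>

definition ring_action where
  "ring_action M \<rho> \<tau> \<longleftrightarrow> \<tau> \<in> Hom D (M \<diamond>\<^bsub>D\<^esub> Y) M \<and>
    \<tau> \<cdot>\<^bsub>D\<^esub> (\<rho> \<diamond>\<^sub>a\<^bsub>D\<^esub> \<one> Y) = \<tau> \<cdot>\<^bsub>D\<^esub> (\<one>\<^bsub>D\<^esub> M \<diamond>\<^sub>a\<^bsub>D\<^esub> l) \<and>
    \<tau> \<cdot>\<^bsub>D\<^esub> (\<one>\<^bsub>D\<^esub> M \<diamond>\<^sub>a\<^bsub>D\<^esub> r) = \<rho> \<cdot>\<^bsub>D\<^esub> (\<tau> \<diamond>\<^sub>a\<^bsub>D\<^esub> \<one> (obj A)) \<and>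
    \<tau> \<cdot>\<^bsub>D\<^esub> (\<tau> \<diamond>\<^sub>a\<^bsub>D\<^esub> \<one> Y) = \<tau> \<cdot>\<^bsub>D\<^esub> (\<one>\<^bsub>D\<^esub> M \<diamond>\<^sub>a\<^bsub>D\<^esub> (m \<cdot> q\<^sub>Y)) \<and>
    \<tau> \<cdot>\<^bsub>D\<^esub> (\<one>\<^bsub>D\<^esub> M \<diamond>\<^sub>a\<^bsub>D\<^esub> u) = \<rho>"

text \<open>This lemma and the next two translate the axioms for \<open>t : M \<diamond>\<^sub>A Y \<rightarrow> M\<close> into conditions on
  \<open>t \<cdot> q\<close>, each by composing with an epimorphism from an unreduced product, here from
  \<open>M \<diamond> Y \<diamond> A\<close>.\<close>

lemma module_map_iff:
  assumes P: "right_module C D A (M, \<rho>)"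
    and t: "t \<in> Ar D" "Dom D t = Cod D (q M \<rho>)" "Cod D t = M"
  shows "t \<cdot>\<^bsub>D\<^esub> \<rho>T M \<rho> = \<rho> \<cdot>\<^bsub>D\<^esub> (t \<diamond>\<^sub>a\<^bsub>D\<^esub> \<one> (obj A)) \<longleftrightarrow>
    (t \<cdot>\<^bsub>D\<^esub> q M \<rho>) \<cdot>\<^bsub>D\<^esub> (\<one>\<^bsub>D\<^esub> M \<diamond>\<^sub>a\<^bsub>D\<^esub> r) = \<rho> \<cdot>\<^bsub>D\<^esub> ((t \<cdot>\<^bsub>D\<^esub> q M \<rho>) \<diamond>\<^sub>a\<^bsub>D\<^esub> \<one> (obj A))"
    (is "?E \<longleftrightarrow> ?F")
proof -
  note ar = M_ar[OF P] q_ar[OF P] \<rho>T_ar[OF P] t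
  have 1: "(t \<cdot>\<^bsub>D\<^esub> q M \<rho>) \<cdot>\<^bsub>D\<^esub> (\<one>\<^bsub>D\<^esub> M \<diamond>\<^sub>a\<^bsub>D\<^esub> r) = (t \<cdot>\<^bsub>D\<^esub> \<rho>T M \<rho>) \<cdot>\<^bsub>D\<^esub> (q M \<rho> \<diamond>\<^sub>a\<^bsub>D\<^esub> \<one> (obj A))"
    by (simp add: ar \<rho>T_q[OF P])
  have 2: "\<rho> \<cdot>\<^bsub>D\<^esub> ((t \<cdot>\<^bsub>D\<^esub> q M \<rho>) \<diamond>\<^sub>a\<^bsub>D\<^esub> \<one> (obj A)) =
      (\<rho> \<cdot>\<^bsub>D\<^esub> (t \<diamond>\<^sub>a\<^bsub>D\<^esub> \<one> (obj A))) \<cdot>\<^bsub>D\<^esub> (q M \<rho> \<diamond>\<^sub>a\<^bsub>D\<^esub> \<one> (obj A))"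
    by (simp add: ar)
  show ?thesis
    unfolding 1 2
    by (rule epi_cancel[OF D.coequalizer_epi[OF q_coflat(1)[OF P]], symmetric])
      (simp_all add: ar)
qed

lemma action_assoc_iff:
  assumes P: "right_module C D A (M, \<rho>)"
    and t: "t \<in> Ar D" "Dom D t = Cod D (q M \<rho>)" "Cod D t = M"
      "t \<cdot>\<^bsub>D\<^esub> \<rho>T M \<rho> = \<rho> \<cdot>\<^bsub>D\<^esub> (t \<diamond>\<^sub>a\<^bsub>D\<^esub> \<one> (obj A))"
  shows "t \<cdot>\<^bsub>D\<^esub> rel_ar C D (T M \<rho>) t (M, \<rho>) (Y, l, r) (\<one> Y) (Y, l, r) =
      t \<cdot>\<^bsub>D\<^esub> rel_ar C D (M, \<rho>) (\<one>\<^bsub>D\<^esub> M) (M, \<rho>) (bimod_ten C A (Y, l, r) (Y, l, r)) m (Y, l, r) \<cdot>\<^bsub>D\<^esub>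
        rel_assoc C D A (M, \<rho>) (Y, l, r) (Y, l, r) \<longleftrightarrow>
    (t \<cdot>\<^bsub>D\<^esub> q M \<rho>) \<cdot>\<^bsub>D\<^esub> ((t \<cdot>\<^bsub>D\<^esub> q M \<rho>) \<diamond>\<^sub>a\<^bsub>D\<^esub> \<one> Y) =
      (t \<cdot>\<^bsub>D\<^esub> q M \<rho>) \<cdot>\<^bsub>D\<^esub> (\<one>\<^bsub>D\<^esub> M \<diamond>\<^sub>a\<^bsub>D\<^esub> (m \<cdot> q\<^sub>Y))"
    (is "t \<cdot>\<^bsub>D\<^esub> ?w1 = t \<cdot>\<^bsub>D\<^esub> ?w2 \<cdot>\<^bsub>D\<^esub> ?v \<longleftrightarrow> _")
proof -
  obtain s where s: "bimod_ten C A (Y, l, r) (Y, l, r) = (Cod C q\<^sub>Y, L, s)"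
    by (rule bimod_ten_Y)
  let ?qT = "qmap C D (T M \<rho>) (Y, l)" and ?qL = "qmap C D (M, \<rho>) (Cod C q\<^sub>Y, L)"
  let ?p = "?qT \<cdot>\<^bsub>D\<^esub> (q M \<rho> \<diamond>\<^sub>a\<^bsub>D\<^esub> \<one> Y)"
  note ar = M_ar[OF P] q_ar[OF P] \<rho>T_ar[OF P] t(1-3) qmap_ar(1,2)[OF P left_YY]
    qmap_ar(1,2)[OF T_module[OF P] left_Y, folded T_eq]
  have w1: "?w1 \<in> Ar D" "Dom D ?w1 = Cod D ?qT" "Cod D ?w1 = Cod D (q M \<rho>)"
      "?w1 \<cdot>\<^bsub>D\<^esub> ?qT = q M \<rho> \<cdot>\<^bsub>D\<^esub> (t \<diamond>\<^sub>a\<^bsub>D\<^esub> \<one> Y)"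
    using rel_ar_qmap[OF T_module[OF P] P left_Y left_Y _ t(4) Y_linear_id, of r r] t(1-3)
    by (simp_all add: in_Hom_iff T_eq)
  have w2: "?w2 \<in> Ar D" "Dom D ?w2 = Cod D ?qL" "Cod D ?w2 = Cod D (q M \<rho>)"
      "?w2 \<cdot>\<^bsub>D\<^esub> ?qL = q M \<rho> \<cdot>\<^bsub>D\<^esub> (\<one>\<^bsub>D\<^esub> M \<diamond>\<^sub>a\<^bsub>D\<^esub> m)"
    using rel_ar_qmap[OF P P left_YY left_Y _ _ _ m_left, of "\<one>\<^bsub>D\<^esub> M" s r] ar
    by (simp_all add: in_Hom_iff s)
  note v = rel_assoc_q[OF P]
  have 1: "(t \<cdot>\<^bsub>D\<^esub> q M \<rho>) \<cdot>\<^bsub>D\<^esub> ((t \<cdot>\<^bsub>D\<^esub> q M \<rho>) \<diamond>\<^sub>a\<^bsub>D\<^esub> \<one> Y) = (t \<cdot>\<^bsub>D\<^esub> ?w1) \<cdot>\<^bsub>D\<^esub> ?p"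
    using w1(1-3) by (simp add: ar D.reassoc[OF w1(4)])
  have "(t \<cdot>\<^bsub>D\<^esub> ?w2 \<cdot>\<^bsub>D\<^esub> ?v) \<cdot>\<^bsub>D\<^esub> ?p = t \<cdot>\<^bsub>D\<^esub> ?w2 \<cdot>\<^bsub>D\<^esub> ?qL \<cdot>\<^bsub>D\<^esub> (\<one>\<^bsub>D\<^esub> M \<diamond>\<^sub>a\<^bsub>D\<^esub> q\<^sub>Y)"
    using w2(1-3) v by (simp add: ar)
  also have "\<dots> = (t \<cdot>\<^bsub>D\<^esub> q M \<rho>) \<cdot>\<^bsub>D\<^esub> (\<one>\<^bsub>D\<^esub> M \<diamond>\<^sub>a\<^bsub>D\<^esub> (m \<cdot> q\<^sub>Y))"
    using w2(1-3) by (simp add: ar D.reassoc[OF w2(4)])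
  finally have 2: "(t \<cdot>\<^bsub>D\<^esub> q M \<rho>) \<cdot>\<^bsub>D\<^esub> (\<one>\<^bsub>D\<^esub> M \<diamond>\<^sub>a\<^bsub>D\<^esub> (m \<cdot> q\<^sub>Y)) =
    (t \<cdot>\<^bsub>D\<^esub> ?w2 \<cdot>\<^bsub>D\<^esub> ?v) \<cdot>\<^bsub>D\<^esub> ?p" by simp
  show ?thesis
    unfolding 1 2
    by (rule epi_cancel[OF qT_epi[OF P], symmetric])
      (use w1(1-3) w2(1-3) v(1-3) in \<open>simp_all add: ar\<close>)
qed

lemma action_unit_iff:
  assumes P: "right_module C D A (M, \<rho>)"
    and t: "t \<in> Ar D" "Dom D t = Cod D (q M \<rho>)" "Cod D t = M"
  shows "t \<cdot>\<^bsub>D\<^esub> rel_ar C D (M, \<rho>) (\<one>\<^bsub>D\<^esub> M) (M, \<rho>) (obj A, mul A, mul A) u (Y, l, r) =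
      factor D (qmap C D (M, \<rho>) (obj A, mul A)) \<rho> \<longleftrightarrow>
    (t \<cdot>\<^bsub>D\<^esub> q M \<rho>) \<cdot>\<^bsub>D\<^esub> (\<one>\<^bsub>D\<^esub> M \<diamond>\<^sub>a\<^bsub>D\<^esub> u) = \<rho>"
    (is "t \<cdot>\<^bsub>D\<^esub> ?w = factor D ?q \<rho> \<longleftrightarrow> _")
proof -
  note ar = M_ar[OF P] q_ar[OF P] t qmap_ar(1,2)[OF P left_A]
  have w: "?w \<in> Ar D" "Dom D ?w = Cod D ?q" "Cod D ?w = Cod D (q M \<rho>)"
      "?w \<cdot>\<^bsub>D\<^esub> ?q = q M \<rho> \<cdot>\<^bsub>D\<^esub> (\<one>\<^bsub>D\<^esub> M \<diamond>\<^sub>a\<^bsub>D\<^esub> u)"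
    using rel_ar_qmap[OF P P left_A left_Y _ _ _ u_left, of "\<one>\<^bsub>D\<^esub> M" "mul A" r] ar
    by (simp_all add: in_Hom_iff)
  have v: "factor D ?q \<rho> \<in> Ar D" "Dom D (factor D ?q \<rho>) = Cod D ?q"
      "factor D ?q \<rho> \<cdot>\<^bsub>D\<^esub> ?q = \<rho>"
    using D.coequalizer_factor[OF qmap_coequalizer[OF P left_A] _ _ right_A_module_eqs(1)[OF P]]
    by (simp_all add: ar)
  have 1: "(t \<cdot>\<^bsub>D\<^esub> q M \<rho>) \<cdot>\<^bsub>D\<^esub> (\<one>\<^bsub>D\<^esub> M \<diamond>\<^sub>a\<^bsub>D\<^esub> u) = (t \<cdot>\<^bsub>D\<^esub> ?w) \<cdot>\<^bsub>D\<^esub> ?q"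
    using w by (simp add: ar)
  have "t \<cdot>\<^bsub>D\<^esub> ?w = factor D ?q \<rho> \<longleftrightarrow>
      (t \<cdot>\<^bsub>D\<^esub> ?w) \<cdot>\<^bsub>D\<^esub> ?q = factor D ?q \<rho> \<cdot>\<^bsub>D\<^esub> ?q"
    by (rule epi_cancel[OF D.coequalizer_epi[OF qmap_coequalizer[OF P left_A]], symmetric])
      (use w(1-3) v(1,2) in \<open>simp_all add: ar\<close>)
  then show ?thesis
    unfolding 1 v(3) .
qed

lemma ring_module_iff:
  "right_module (bimod_cat C D A) (rmod_rcat C D A) R ((M, \<rho>), \<alpha>) \<longleftrightarrow>
    right_module C D A (M, \<rho>) \<and> (\<exists>t. \<alpha> = (T M \<rho>, t, (M, \<rho>)) \<and>
      t \<in> Hom D (Cod D (q M \<rho>)) M \<and> ring_action M \<rho> (t \<cdot>\<^bsub>D\<^esub> q M \<rho>))"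
  (is "?lhs \<longleftrightarrow> ?rhs")
proof (cases "right_module C D A (M, \<rho>) \<and>
    (\<exists>t. \<alpha> = (T M \<rho>, t, (M, \<rho>)) \<and> t \<in> Hom D (Cod D (q M \<rho>)) M)")
  (* A structure arrow of D_A is a triple that records its source and target. *)
  case False
  have "\<not> ?lhs"
  proof
    assume ?lhs
    then have P: "right_module C D A (M, \<rho>)" and a: "\<alpha> \<in> Hom (rmod_cat C D A) (T M \<rho>) (M, \<rho>)"
      by (simp_all add: right_module.simps[of "bimod_cat C D A"])
    have "\<exists>t. \<alpha> = (T M \<rho>, t, (M, \<rho>)) \<and> t \<in> Hom D (Cod D (q M \<rho>)) M"
      using a by (cases \<alpha>) (auto simp: in_Hom_iff T_eq)
    then show False using P False by blast
  qed
  then show ?thesis using False by blast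
next
  case True
  then obtain t where P: "right_module C D A (M, \<rho>)" and \<alpha>: "\<alpha> = (T M \<rho>, t, (M, \<rho>))"
    and t: "t \<in> Ar D" "Dom D t = Cod D (q M \<rho>)" "Cod D t = M"
    by (auto simp: in_Hom_iff)
  let ?lin = "t \<cdot>\<^bsub>D\<^esub> \<rho>T M \<rho> = \<rho> \<cdot>\<^bsub>D\<^esub> (t \<diamond>\<^sub>a\<^bsub>D\<^esub> \<one> (obj A))"
  let ?w1 = "rel_ar C D (T M \<rho>) t (M, \<rho>) (Y, l, r) (\<one> Y) (Y, l, r)"
  let ?w2 = "rel_ar C D (M, \<rho>) (\<one>\<^bsub>D\<^esub> M) (M, \<rho>) (bimod_ten C A (Y, l, r) (Y, l, r)) m (Y, l, r)"
  let ?w3 = "rel_ar C D (M, \<rho>) (\<one>\<^bsub>D\<^esub> M) (M, \<rho>) (obj A, mul A, mul A) u (Y, l, r)"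
  let ?v = "rel_assoc C D A (M, \<rho>) (Y, l, r) (Y, l, r)"
  have "?lhs \<longleftrightarrow> ?lin \<and> t \<cdot>\<^bsub>D\<^esub> ?w1 = t \<cdot>\<^bsub>D\<^esub> ?w2 \<cdot>\<^bsub>D\<^esub> ?v \<and>
      t \<cdot>\<^bsub>D\<^esub> ?w3 = factor D (qmap C D (M, \<rho>) (obj A, mul A)) \<rho>"
    using P t T_module[OF P]
    by (simp add: right_module.simps[of "bimod_cat C D A"] \<alpha> unit_bimod_def in_Hom_iff)
      (simp add: T_eq)
  also have "\<dots> \<longleftrightarrow>
      (t \<cdot>\<^bsub>D\<^esub> q M \<rho>) \<cdot>\<^bsub>D\<^esub> (\<one>\<^bsub>D\<^esub> M \<diamond>\<^sub>a\<^bsub>D\<^esub> r) = \<rho> \<cdot>\<^bsub>D\<^esub> ((t \<cdot>\<^bsub>D\<^esub> q M \<rho>) \<diamond>\<^sub>a\<^bsub>D\<^esub> \<one> (obj A)) \<and>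
      (t \<cdot>\<^bsub>D\<^esub> q M \<rho>) \<cdot>\<^bsub>D\<^esub> ((t \<cdot>\<^bsub>D\<^esub> q M \<rho>) \<diamond>\<^sub>a\<^bsub>D\<^esub> \<one> Y) =
        (t \<cdot>\<^bsub>D\<^esub> q M \<rho>) \<cdot>\<^bsub>D\<^esub> (\<one>\<^bsub>D\<^esub> M \<diamond>\<^sub>a\<^bsub>D\<^esub> (m \<cdot> q\<^sub>Y)) \<and>
      (t \<cdot>\<^bsub>D\<^esub> q M \<rho>) \<cdot>\<^bsub>D\<^esub> (\<one>\<^bsub>D\<^esub> M \<diamond>\<^sub>a\<^bsub>D\<^esub> u) = \<rho>"
    using action_assoc_iff[OF P t] action_unit_iff[OF P t] module_map_iff[OF P t] by blast
  also have "\<dots> \<longleftrightarrow> ring_action M \<rho> (t \<cdot>\<^bsub>D\<^esub> q M \<rho>)"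
    using t q_ar[OF P] M_ar[OF P] q_eq[OF P] by (simp add: ring_action_def in_Hom_iff)
  also have "\<dots> \<longleftrightarrow> ?rhs"
    using P t by (auto simp: \<alpha> in_Hom_iff)
  finally show ?thesis .
qed

section \<open>Modules over the underlying algebra\<close>

lemma underlying_module_iff:
  "right_module C D B (M, \<tau>) \<longleftrightarrow> M \<in> Ob D \<and> \<tau> \<in> Ar D \<and> Dom D \<tau> = M \<diamond>\<^bsub>D\<^esub> Y \<and> Cod D \<tau> = M \<and>
    \<tau> \<cdot>\<^bsub>D\<^esub> (\<tau> \<diamond>\<^sub>a\<^bsub>D\<^esub> \<one> Y) = \<tau> \<cdot>\<^bsub>D\<^esub> (\<one>\<^bsub>D\<^esub> M \<diamond>\<^sub>a\<^bsub>D\<^esub> (m \<cdot> q\<^sub>Y)) \<and>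
    \<tau> \<cdot>\<^bsub>D\<^esub> (\<one>\<^bsub>D\<^esub> M \<diamond>\<^sub>a\<^bsub>D\<^esub> (u \<cdot> unt A)) = \<one>\<^bsub>D\<^esub> M"
  by (subst right_module_iff) (simp_all add: in_Hom_iff)

lemma ring_action_underlying:
  assumes P: "right_module C D A (M, \<rho>)" and \<tau>: "ring_action M \<rho> \<tau>"
  shows "right_module C D B (M, \<tau>)"
proof -
  have ar: "\<tau> \<in> Ar D" "Dom D \<tau> = M \<diamond>\<^bsub>D\<^esub> Y" "Cod D \<tau> = M"
    and assoc: "\<tau> \<cdot>\<^bsub>D\<^esub> (\<tau> \<diamond>\<^sub>a\<^bsub>D\<^esub> \<one> Y) = \<tau> \<cdot>\<^bsub>D\<^esub> (\<one>\<^bsub>D\<^esub> M \<diamond>\<^sub>a\<^bsub>D\<^esub> (m \<cdot> q\<^sub>Y))"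
    and \<rho>: "\<tau> \<cdot>\<^bsub>D\<^esub> (\<one>\<^bsub>D\<^esub> M \<diamond>\<^sub>a\<^bsub>D\<^esub> u) = \<rho>"
    using \<tau> unfolding ring_action_def in_Hom_iff by blast+
  have "\<tau> \<cdot>\<^bsub>D\<^esub> (\<one>\<^bsub>D\<^esub> M \<diamond>\<^sub>a\<^bsub>D\<^esub> (u \<cdot> unt A)) =
      (\<tau> \<cdot>\<^bsub>D\<^esub> (\<one>\<^bsub>D\<^esub> M \<diamond>\<^sub>a\<^bsub>D\<^esub> u)) \<cdot>\<^bsub>D\<^esub> (\<one>\<^bsub>D\<^esub> M \<diamond>\<^sub>a\<^bsub>D\<^esub> unt A)"
    using ar M_ar[OF P] by simp
  also have "\<dots> = \<one>\<^bsub>D\<^esub> M"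
    unfolding \<rho> right_A_module_eqs(2)[OF P] ..
  finally show ?thesis
    using ar assoc M_ar[OF P] by (simp add: underlying_module_iff)
qed

text \<open>Restriction along \<open>u\<close>. As \<open>A\<close> acts on \<open>Y\<close> through \<open>u\<close>, each of the linearity conditions is
  the associativity of \<open>\<tau>\<close> composed with \<open>u\<close>: in the first factor of \<open>Y \<otimes> Y\<close> this
  gives balancedness, in the second right linearity, and in both that \<open>\<rho>\<close> is an action.\<close>

lemma underlying_ring_action:
  assumes N: "right_module C D B (M, \<tau>)"
  defines "\<rho> \<equiv> \<tau> \<cdot>\<^bsub>D\<^esub> (\<one>\<^bsub>D\<^esub> M \<diamond>\<^sub>a\<^bsub>D\<^esub> u)"
  shows "right_module C D A (M, \<rho>)" "ring_action M \<rho> \<tau>"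
proof -
  have ar [simp]: "M \<in> Ob D" "\<tau> \<in> Ar D" "Dom D \<tau> = M \<diamond>\<^bsub>D\<^esub> Y" "Cod D \<tau> = M"
    and assoc: "\<tau> \<cdot>\<^bsub>D\<^esub> (\<tau> \<diamond>\<^sub>a\<^bsub>D\<^esub> \<one> Y) = \<tau> \<cdot>\<^bsub>D\<^esub> (\<one>\<^bsub>D\<^esub> M \<diamond>\<^sub>a\<^bsub>D\<^esub> (m \<cdot> q\<^sub>Y))"
    and unit: "\<tau> \<cdot>\<^bsub>D\<^esub> (\<one>\<^bsub>D\<^esub> M \<diamond>\<^sub>a\<^bsub>D\<^esub> (u \<cdot> unt A)) = \<one>\<^bsub>D\<^esub> M"
    using N unfolding underlying_module_iff by blast+
  have \<rho> [simp]: "\<rho> \<in> Ar D" "Dom D \<rho> = M \<diamond>\<^bsub>D\<^esub> obj A" "Cod D \<rho> = M"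
    by (simp_all add: \<rho>_def)
  have \<rho>_comp: "\<rho> \<cdot>\<^bsub>D\<^esub> g = \<tau> \<cdot>\<^bsub>D\<^esub> (\<one>\<^bsub>D\<^esub> M \<diamond>\<^sub>a\<^bsub>D\<^esub> u) \<cdot>\<^bsub>D\<^esub> g"
    if "g \<in> Ar D" "Cod D g = M \<diamond>\<^bsub>D\<^esub> obj A" for g
    using that by (simp add: \<rho>_def)
  have left: "\<tau> \<cdot>\<^bsub>D\<^esub> (\<rho> \<diamond>\<^sub>a\<^bsub>D\<^esub> \<one> Y) = \<tau> \<cdot>\<^bsub>D\<^esub> (\<one>\<^bsub>D\<^esub> M \<diamond>\<^sub>a\<^bsub>D\<^esub> l)"
  proof -
    have "\<tau> \<cdot>\<^bsub>D\<^esub> (\<rho> \<diamond>\<^sub>a\<^bsub>D\<^esub> \<one> Y) =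
        (\<tau> \<cdot>\<^bsub>D\<^esub> (\<tau> \<diamond>\<^sub>a\<^bsub>D\<^esub> \<one> Y)) \<cdot>\<^bsub>D\<^esub> ((\<one>\<^bsub>D\<^esub> M \<diamond>\<^sub>a\<^bsub>D\<^esub> u) \<diamond>\<^sub>a\<^bsub>D\<^esub> \<one> Y)"
      unfolding \<rho>_def by (simp del: act_assoc_ar)
    also have "\<dots> = \<tau> \<cdot>\<^bsub>D\<^esub> (\<one>\<^bsub>D\<^esub> M \<diamond>\<^sub>a\<^bsub>D\<^esub> ((m \<cdot> q\<^sub>Y) \<cdot> (u \<otimes>\<^sub>a \<one> Y)))"
      unfolding assoc by simp
    finally show ?thesis unfolding mul_unit_left .
  qed
  have right: "\<rho> \<cdot>\<^bsub>D\<^esub> (\<tau> \<diamond>\<^sub>a\<^bsub>D\<^esub> \<one> (obj A)) = \<tau> \<cdot>\<^bsub>D\<^esub> (\<one>\<^bsub>D\<^esub> M \<diamond>\<^sub>a\<^bsub>D\<^esub> r)"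
  proof -
    have "\<rho> \<cdot>\<^bsub>D\<^esub> (\<tau> \<diamond>\<^sub>a\<^bsub>D\<^esub> \<one> (obj A)) = (\<tau> \<cdot>\<^bsub>D\<^esub> (\<tau> \<diamond>\<^sub>a\<^bsub>D\<^esub> \<one> Y)) \<cdot>\<^bsub>D\<^esub> (\<one>\<^bsub>D\<^esub> M \<diamond>\<^sub>a\<^bsub>D\<^esub> (\<one> Y \<otimes>\<^sub>a u))"
      using act_interchange[of \<tau> M Y u Y] by (simp add: \<rho>_def)
    also have "\<dots> = \<tau> \<cdot>\<^bsub>D\<^esub> (\<one>\<^bsub>D\<^esub> M \<diamond>\<^sub>a\<^bsub>D\<^esub> ((m \<cdot> q\<^sub>Y) \<cdot> (\<one> Y \<otimes>\<^sub>a u)))"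
      unfolding assoc by simp
    finally show ?thesis unfolding mul_unit_right .
  qed
  have "\<rho> \<cdot>\<^bsub>D\<^esub> (\<rho> \<diamond>\<^sub>a\<^bsub>D\<^esub> \<one> (obj A)) = \<rho> \<cdot>\<^bsub>D\<^esub> (\<one>\<^bsub>D\<^esub> M \<diamond>\<^sub>a\<^bsub>D\<^esub> mul A)"
  proof -
    have "\<rho> \<cdot>\<^bsub>D\<^esub> (\<rho> \<diamond>\<^sub>a\<^bsub>D\<^esub> \<one> (obj A)) =
        (\<tau> \<cdot>\<^bsub>D\<^esub> (\<rho> \<diamond>\<^sub>a\<^bsub>D\<^esub> \<one> Y)) \<cdot>\<^bsub>D\<^esub> (\<one>\<^bsub>D\<^esub> M \<diamond>\<^sub>a\<^bsub>D\<^esub> (\<one> (obj A) \<otimes>\<^sub>a u))"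
      using act_interchange[of \<rho> M "obj A" u Y] by (simp add: \<rho>_comp)
    also have "\<dots> = \<tau> \<cdot>\<^bsub>D\<^esub> (\<one>\<^bsub>D\<^esub> M \<diamond>\<^sub>a\<^bsub>D\<^esub> (l \<cdot> (\<one> (obj A) \<otimes>\<^sub>a u)))"
      unfolding left by simp
    also have "\<dots> = \<rho> \<cdot>\<^bsub>D\<^esub> (\<one>\<^bsub>D\<^esub> M \<diamond>\<^sub>a\<^bsub>D\<^esub> mul A)"
      unfolding u_left[symmetric] \<rho>_def by simp
    finally show ?thesis .
  qed
  moreover have "\<rho> \<cdot>\<^bsub>D\<^esub> (\<one>\<^bsub>D\<^esub> M \<diamond>\<^sub>a\<^bsub>D\<^esub> unt A) = \<one>\<^bsub>D\<^esub> M"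
    using unit by (simp add: \<rho>_def)
  ultimately show "right_module C D A (M, \<rho>)"
    by (simp add: right_A_module_iff)
  show "ring_action M \<rho> \<tau>"
    unfolding ring_action_def in_Hom_iff
    using left right assoc by (simp add: \<rho>_def[symmetric])
qed

definition to_module where
  "to_module = (\<lambda>((M, \<rho>), (_, t, _)). (M, t \<cdot>\<^bsub>D\<^esub> q M \<rho>))"

definition to_ring_module where
  "to_ring_module = (\<lambda>(M, \<tau>). let \<rho> = \<tau> \<cdot>\<^bsub>D\<^esub> (\<one>\<^bsub>D\<^esub> M \<diamond>\<^sub>a\<^bsub>D\<^esub> u)
    in ((M, \<rho>), (T M \<rho>, factor D (q M \<rho>) \<tau>, (M, \<rho>))))"

lemma ring_module_cases:
  assumes "right_module (bimod_cat C D A) (rmod_rcat C D A) R S"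
  obtains M \<rho> t where "S = ((M, \<rho>), (T M \<rho>, t, (M, \<rho>)))" "right_module C D A (M, \<rho>)"
    "t \<in> Hom D (Cod D (q M \<rho>)) M" "ring_action M \<rho> (t \<cdot>\<^bsub>D\<^esub> q M \<rho>)"
  using assms ring_module_iff by (cases S) auto

lemma to_module:
  assumes S: "right_module (bimod_cat C D A) (rmod_rcat C D A) R S"
  shows "right_module C D B (to_module S)" "to_ring_module (to_module S) = S"
proof -
  obtain M \<rho> t where *: "S = ((M, \<rho>), (T M \<rho>, t, (M, \<rho>)))" "right_module C D A (M, \<rho>)"
    "t \<in> Hom D (Cod D (q M \<rho>)) M" "ring_action M \<rho> (t \<cdot>\<^bsub>D\<^esub> q M \<rho>)"
    using S by (rule ring_module_cases)
  show "right_module C D B (to_module S)"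
    using ring_action_underlying[OF *(2,4)] by (simp add: *(1) to_module_def)
  have "(t \<cdot>\<^bsub>D\<^esub> q M \<rho>) \<cdot>\<^bsub>D\<^esub> (\<one>\<^bsub>D\<^esub> M \<diamond>\<^sub>a\<^bsub>D\<^esub> u) = \<rho>"
    using *(4) by (simp only: ring_action_def)
  moreover have "factor D (q M \<rho>) (t \<cdot>\<^bsub>D\<^esub> q M \<rho>) = t"
    by (rule D.factor_eqI[OF D.coequalizer_epi[OF q_coequalizer[OF *(2)]]])
      (use *(3) in \<open>simp_all add: in_Hom_iff\<close>)
  ultimately show "to_ring_module (to_module S) = S"
    by (simp add: *(1) to_module_def to_ring_module_def Let_def)
qed

lemma to_ring_module:
  assumes N: "right_module C D B N"
  shows "right_module (bimod_cat C D A) (rmod_rcat C D A) R (to_ring_module N)"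
    "to_module (to_ring_module N) = N"
proof -
  obtain M \<tau> where M: "N = (M, \<tau>)" by (cases N)
  define \<rho> where "\<rho> = \<tau> \<cdot>\<^bsub>D\<^esub> (\<one>\<^bsub>D\<^esub> M \<diamond>\<^sub>a\<^bsub>D\<^esub> u)"
  note P = underlying_ring_action[OF N[unfolded M], folded \<rho>_def]
  have \<tau>: "\<tau> \<in> Ar D" "Dom D \<tau> = Dom D (q M \<rho>)" "Cod D \<tau> = M"
      "\<tau> \<cdot>\<^bsub>D\<^esub> (\<rho> \<diamond>\<^sub>a\<^bsub>D\<^esub> \<one> Y) = \<tau> \<cdot>\<^bsub>D\<^esub> (\<one>\<^bsub>D\<^esub> M \<diamond>\<^sub>a\<^bsub>D\<^esub> l)"
    using P(2) unfolding ring_action_def in_Hom_iff q_ar(2)[OF P(1)] by blast+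
  note t = D.coequalizer_factor[OF q_coequalizer[OF P(1)] \<tau>(1,2,4)]
  show "right_module (bimod_cat C D A) (rmod_rcat C D A) R (to_ring_module N)"
    using P t \<tau>(3) by (simp add: M to_ring_module_def \<rho>_def[symmetric] ring_module_iff in_Hom_iff)
  show "to_module (to_ring_module N) = N"
    using t by (simp add: M to_ring_module_def to_module_def Let_def \<rho>_def[symmetric])
qed

text \<open>A morphism \<open>f\<close> that commutes with \<open>\<tau>\<close> commutes with \<open>\<rho> = \<tau> \<cdot> (M \<diamond> u)\<close>. Only then is
  \<open>f \<diamond>\<^sub>A Y\<close> defined, so linearity over \<open>A\<close> has to be settled before linearity over the ring.\<close>

lemma ring_module_map_iff:
  assumes S: "right_module (bimod_cat C D A) (rmod_rcat C D A) R S"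
    and S': "right_module (bimod_cat C D A) (rmod_rcat C D A) R S'"
  shows "(S, (fst S, f, fst S'), S') \<in> Ar (ring_rmod_cat C D A R) \<longleftrightarrow>
    (to_module S, f, to_module S') \<in> Ar (rmod_cat C D B)"
proof -
  obtain M \<rho> t where *: "S = ((M, \<rho>), (T M \<rho>, t, (M, \<rho>)))" "right_module C D A (M, \<rho>)"
    "t \<in> Hom D (Cod D (q M \<rho>)) M" "ring_action M \<rho> (t \<cdot>\<^bsub>D\<^esub> q M \<rho>)"
    using S by (rule ring_module_cases)
  obtain M' \<rho>' t' where **: "S' = ((M', \<rho>'), (T M' \<rho>', t', (M', \<rho>')))"
    "right_module C D A (M', \<rho>')" "t' \<in> Hom D (Cod D (q M' \<rho>')) M'"
    "ring_action M' \<rho>' (t' \<cdot>\<^bsub>D\<^esub> q M' \<rho>')"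
    using S' by (rule ring_module_cases)
  note ar = M_ar[OF *(2)] M_ar[OF **(2)] q_ar[OF *(2)] q_ar[OF **(2)]
  have t: "t \<in> Ar D" "Dom D t = Cod D (q M \<rho>)" "Cod D t = M"
    and t': "t' \<in> Ar D" "Dom D t' = Cod D (q M' \<rho>')" "Cod D t' = M'"
    and \<rho>: "(t \<cdot>\<^bsub>D\<^esub> q M \<rho>) \<cdot>\<^bsub>D\<^esub> (\<one>\<^bsub>D\<^esub> M \<diamond>\<^sub>a\<^bsub>D\<^esub> u) = \<rho>"
      "(t' \<cdot>\<^bsub>D\<^esub> q M' \<rho>') \<cdot>\<^bsub>D\<^esub> (\<one>\<^bsub>D\<^esub> M' \<diamond>\<^sub>a\<^bsub>D\<^esub> u) = \<rho>'"
    using *(3,4) **(3,4) by (simp_all only: in_Hom_iff ring_action_def)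
  let ?lin = "f \<cdot>\<^bsub>D\<^esub> \<rho> = \<rho>' \<cdot>\<^bsub>D\<^esub> (f \<diamond>\<^sub>a\<^bsub>D\<^esub> \<one> (obj A))"
  let ?map = "f \<cdot>\<^bsub>D\<^esub> t \<cdot>\<^bsub>D\<^esub> q M \<rho> = (t' \<cdot>\<^bsub>D\<^esub> q M' \<rho>') \<cdot>\<^bsub>D\<^esub> (f \<diamond>\<^sub>a\<^bsub>D\<^esub> \<one> Y)"
  show ?thesis
  proof (cases "f \<in> Hom D M M'")
    case False
    then show ?thesis by (auto simp: *(1) **(1) to_module_def in_Hom_iff)
  next
    case f: True
    then have f_ar: "f \<in> Ar D" "Dom D f = M" "Cod D f = M'" by (simp_all add: in_Hom_iff)
    have lin: ?lin if ?map
    proof -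
      have "f \<cdot>\<^bsub>D\<^esub> \<rho> = (f \<cdot>\<^bsub>D\<^esub> t \<cdot>\<^bsub>D\<^esub> q M \<rho>) \<cdot>\<^bsub>D\<^esub> (\<one>\<^bsub>D\<^esub> M \<diamond>\<^sub>a\<^bsub>D\<^esub> u)"
        using f_ar t ar by (subst \<rho>(1)[symmetric]) simp
      also have "\<dots> = ((t' \<cdot>\<^bsub>D\<^esub> q M' \<rho>') \<cdot>\<^bsub>D\<^esub> (\<one>\<^bsub>D\<^esub> M' \<diamond>\<^sub>a\<^bsub>D\<^esub> u)) \<cdot>\<^bsub>D\<^esub> (f \<diamond>\<^sub>a\<^bsub>D\<^esub> \<one> (obj A))"
        unfolding that using f_ar t' ar by simp
      finally show ?thesis unfolding \<rho>(2) .
    qed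
    have map: "f \<cdot>\<^bsub>D\<^esub> t = t' \<cdot>\<^bsub>D\<^esub> map_T M \<rho> f M' \<rho>' \<longleftrightarrow> ?map" if ?lin
    proof -
      note w = rel_ar_qmap[OF *(2) **(2) left_Y left_Y f that Y_linear_id, of r r]
      have 1: "f \<cdot>\<^bsub>D\<^esub> t \<cdot>\<^bsub>D\<^esub> q M \<rho> = (f \<cdot>\<^bsub>D\<^esub> t) \<cdot>\<^bsub>D\<^esub> q M \<rho>"
        using f_ar t ar by simp
      have 2: "(t' \<cdot>\<^bsub>D\<^esub> q M' \<rho>') \<cdot>\<^bsub>D\<^esub> (f \<diamond>\<^sub>a\<^bsub>D\<^esub> \<one> Y) = (t' \<cdot>\<^bsub>D\<^esub> map_T M \<rho> f M' \<rho>') \<cdot>\<^bsub>D\<^esub> q M \<rho>"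
        using w f_ar t' ar by simp
      show ?thesis
        unfolding 1 2
        by (rule epi_cancel[OF D.coequalizer_epi[OF q_coequalizer[OF *(2)]], symmetric])
          (use w(1-3) f_ar t t' ar in simp_all)
    qed
    have "(S, (fst S, f, fst S'), S') \<in> Ar (ring_rmod_cat C D A R) \<longleftrightarrow>
        ?lin \<and> f \<cdot>\<^bsub>D\<^esub> t = t' \<cdot>\<^bsub>D\<^esub> map_T M \<rho> f M' \<rho>'"
      using S S' f *(2) **(2) unfolding *(1) **(1) by (simp add: in_Hom_iff)
    also have "\<dots> \<longleftrightarrow> ?map" using lin map by blast
    also have "\<dots> \<longleftrightarrow> (to_module S, f, to_module S') \<in> Ar (rmod_cat C D B)"
      using to_module(1)[OF S] to_module(1)[OF S'] f
      unfolding *(1) **(1) by (simp add: to_module_def)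
    finally show ?thesis .
  qed
qed

text \<open>The correspondence changes only the structure morphisms and leaves \<open>M\<close> and \<open>f\<close> alone, and
  \<open>(\<rho>, t)\<close> and \<open>\<tau>\<close> determine each other; hence an isomorphism of categories.\<close>

theorem ring_modules_isomorphic:
  "isomorphic_categories (ring_rmod_cat C D A R) (rmod_cat C D B)"
proof (rule isomorphic_categoriesI)
  let ?Fa = "\<lambda>(S, F, S'). (to_module S, fst (snd F), to_module S')"
  let ?Ga = "\<lambda>(N, f, N').
    (to_ring_module N, (fst (to_ring_module N), f, fst (to_ring_module N')), to_ring_module N')"
  have F: "\<exists>f. F = (S, (fst S, f, fst S'), S') \<and>
      right_module (bimod_cat C D A) (rmod_rcat C D A) R S \<and>
      right_module (bimod_cat C D A) (rmod_rcat C D A) R S'"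
    if "F \<in> Hom (ring_rmod_cat C D A R) S S'" for F S S'
  proof -
    obtain S\<^sub>1 P f P' S\<^sub>2 where "F = (S\<^sub>1, (P, f, P'), S\<^sub>2)"
      by (metis prod_cases3)
    then show ?thesis using that by (auto simp: in_Hom_iff)
  qed
  have ring_cat: "category (ring_rmod_cat C D A R)"
    by (rule rmod_cat_category) (simp add: tensor_functor[simplified])
  have mod_cat: "category (rmod_cat C D B)"
    by (rule rmod_cat_category) (simp add: act_functor)
  show "cat_functor (ring_rmod_cat C D A R) (rmod_cat C D B) to_module ?Fa"
  proof (intro cat_functor.intro cat_functor_axioms.intro ring_cat mod_cat)
    fix S assume S: "S \<in> Ob (ring_rmod_cat C D A R)"
    then show "to_module S \<in> Ob (rmod_cat C D B)" using to_module by simp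
    show "?Fa (\<one>\<^bsub>ring_rmod_cat C D A R\<^esub> S) = \<one>\<^bsub>rmod_cat C D B\<^esub> (to_module S)"
      using S by (auto elim!: ring_module_cases simp: to_module_def)
  next
    fix F S S' assume F_in: "F \<in> Hom (ring_rmod_cat C D A R) S S'"
    then obtain f where f: "F = (S, (fst S, f, fst S'), S')"
        "right_module (bimod_cat C D A) (rmod_rcat C D A) R S"
        "right_module (bimod_cat C D A) (rmod_rcat C D A) R S'"
      using F by blast
    have "(to_module S, f, to_module S') \<in> Ar (rmod_cat C D B)"
      using ring_module_map_iff[OF f(2,3), of f] F_in
      by (simp add: f(1) in_Hom_iff del: rmod_cat_ar)
    then show "?Fa F \<in> Hom (rmod_cat C D B) (to_module S) (to_module S')"
      by (simp add: f(1) in_Hom_iff del: rmod_cat_ar)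
  next
    fix F S S' G S''
    assume "F \<in> Hom (ring_rmod_cat C D A R) S S'" "G \<in> Hom (ring_rmod_cat C D A R) S' S''"
    with F[OF this(1)] F[OF this(2)]
    show "?Fa (G \<cdot>\<^bsub>ring_rmod_cat C D A R\<^esub> F) = ?Fa G \<cdot>\<^bsub>rmod_cat C D B\<^esub> ?Fa F"
      by auto
  qed
  show "to_ring_module N \<in> Ob (ring_rmod_cat C D A R) \<and> to_module (to_ring_module N) = N"
    if "N \<in> Ob (rmod_cat C D B)" for N
    using that to_ring_module by simp
  show "?Ga g \<in> Hom (ring_rmod_cat C D A R) (to_ring_module N) (to_ring_module N') \<and>
      ?Fa (?Ga g) = g" if "g \<in> Hom (rmod_cat C D B) N N'" for g N N'
  proof -
    obtain N\<^sub>1 f N\<^sub>2 where "g = (N\<^sub>1, f, N\<^sub>2)" by (rule prod_cases3)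
    then have g: "g = (N, f, N')" using that by (simp add: in_Hom_iff)
    have N: "right_module C D B N" "right_module C D B N'" and "g \<in> Ar (rmod_cat C D B)"
      using that by (simp_all add: g in_Hom_iff)
    then show ?thesis
      using ring_module_map_iff[OF to_ring_module(1)[OF N(1)] to_ring_module(1)[OF N(2)], of f]
        to_ring_module(2)[OF N(1)] to_ring_module(2)[OF N(2)]
      unfolding g in_Hom_iff by (simp del: rmod_cat_ar)
  qed
  show "to_ring_module (to_module S) = S" if "S \<in> Ob (ring_rmod_cat C D A R)" for S
    using that to_module by simp
  show "?Ga (?Fa G) = G" if G: "G \<in> Ar (ring_rmod_cat C D A R)" for G
  proof -
    obtain S S' where "G \<in> Hom (ring_rmod_cat C D A R) S S'"
      using G unfolding in_Hom_iff by blast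
    then obtain f where f: "G = (S, (fst S, f, fst S'), S')"
        "right_module (bimod_cat C D A) (rmod_rcat C D A) R S"
        "right_module (bimod_cat C D A) (rmod_rcat C D A) R S'"
      using F by blast
    show ?thesis
      by (simp add: f(1) to_module(2)[OF f(2)] to_module(2)[OF f(3)])
  qed
qed

end

section \<open>The ring of a wreath\<close>

context wreath
begin

lemma wreath_ar [simp]:
  "obj A \<in> Ob C" "X \<in> Ob C"
  "mul A \<in> Ar C" "Dom C (mul A) = obj A \<otimes> obj A" "Cod C (mul A) = obj A"
  "unt A \<in> Ar C" "Dom C (unt A) = unitO C" "Cod C (unt A) = obj A"
  "\<psi> \<in> Ar C" "Dom C \<psi> = X \<otimes> obj A" "Cod C \<psi> = obj A \<otimes> X"
  "\<zeta> \<in> Ar C" "Dom C \<zeta> = X \<otimes> X" "Cod C \<zeta> = obj A \<otimes> X"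
  "\<sigma> \<in> Ar C" "Dom C \<sigma> = unitO C" "Cod C \<sigma> = obj A \<otimes> X"
  using alg X_in psi_in zeta_in sigma_in by (simp_all add: algebra_def in_Hom_iff)

text \<open>In terms of elements, \<open>\<kappa>\<close> is the product \<open>x (a x')\<close> in \<open>A # X\<close> of \<open>x\<close> in \<open>X\<close> and \<open>a x'\<close> in
  \<open>A \<otimes> X\<close>. The full product is its left \<open>A\<close>-linear extension (\<open>wreath_mul_\<kappa>\<close>).\<close>

definition \<kappa> where "\<kappa> = (mul A \<otimes>\<^sub>a \<one> X) \<cdot> (\<one> (obj A) \<otimes>\<^sub>a \<zeta>) \<cdot> (\<psi> \<otimes>\<^sub>a \<one> X)"

definition wreath_mul where
  "wreath_mul = (mul A \<otimes>\<^sub>a \<one> X) \<cdot> (mul A \<otimes>\<^sub>a \<zeta>) \<cdot> (\<one> (obj A) \<otimes>\<^sub>a \<psi> \<otimes>\<^sub>a \<one> X)"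

lemma \<kappa>_ar [simp]: "\<kappa> \<in> Ar C" "Dom C \<kappa> = X \<otimes> (obj A \<otimes> X)" "Cod C \<kappa> = obj A \<otimes> X"
  by (simp_all add: \<kappa>_def)

lemma mul_assoc_X: "(mul A \<otimes>\<^sub>a \<one> X) \<cdot> (mul A \<otimes>\<^sub>a \<one> (obj A \<otimes> X)) =
    (mul A \<otimes>\<^sub>a \<one> X) \<cdot> (\<one> (obj A) \<otimes>\<^sub>a (mul A \<otimes>\<^sub>a \<one> X))"
proof -
  have "(mul A \<otimes>\<^sub>a \<one> X) \<cdot> ((mul A \<otimes>\<^sub>a \<one> (obj A)) \<otimes>\<^sub>a \<one> X) =
      (mul A \<otimes>\<^sub>a \<one> X) \<cdot> ((\<one> (obj A) \<otimes>\<^sub>a mul A) \<otimes>\<^sub>a \<one> X)"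
    using alg by (simp add: algebra_def del: ten_assoc_ar)
  then show ?thesis by simp
qed

lemma wreath_mul_\<kappa>: "wreath_mul = (mul A \<otimes>\<^sub>a \<one> X) \<cdot> (\<one> (obj A) \<otimes>\<^sub>a \<kappa>)"
proof -
  have "wreath_mul = (mul A \<otimes>\<^sub>a \<one> X) \<cdot> (mul A \<otimes>\<^sub>a \<one> (obj A \<otimes> X)) \<cdot>
      (\<one> (obj A) \<otimes>\<^sub>a (\<one> (obj A) \<otimes>\<^sub>a \<zeta>)) \<cdot> (\<one> (obj A) \<otimes>\<^sub>a (\<psi> \<otimes>\<^sub>a \<one> X))"
    using reassoc[OF ten_interchange[of "mul A" "obj A" "obj A" \<zeta> "obj A \<otimes> X"],
        of "\<one> (obj A) \<otimes>\<^sub>a (\<psi> \<otimes>\<^sub>a \<one> X)"]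
    by (simp add: wreath_mul_def del: ten_comp')
  also have "\<dots> = (mul A \<otimes>\<^sub>a \<one> X) \<cdot> (\<one> (obj A) \<otimes>\<^sub>a \<kappa>)"
    by (simp add: reassoc[OF mul_assoc_X] \<kappa>_def)
  finally show ?thesis .
qed

lemma wreath_mul_ar [simp]: "wreath_mul \<in> Ar C" "Dom C wreath_mul = obj A \<otimes> (X \<otimes> (obj A \<otimes> X))"
  "Cod C wreath_mul = obj A \<otimes> X"
  by (simp_all add: wreath_mul_\<kappa>)

lemma wreath_mul_left:
  "wreath_mul \<cdot> (mul A \<otimes>\<^sub>a \<one> (X \<otimes> (obj A \<otimes> X))) =
    (mul A \<otimes>\<^sub>a \<one> X) \<cdot> (\<one> (obj A) \<otimes>\<^sub>a wreath_mul)"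
proof -
  have "wreath_mul \<cdot> (mul A \<otimes>\<^sub>a \<one> (X \<otimes> (obj A \<otimes> X))) = (mul A \<otimes>\<^sub>a \<one> X) \<cdot> (mul A \<otimes>\<^sub>a \<kappa>)"
    by (simp add: wreath_mul_\<kappa>)
  also have "\<dots> = (mul A \<otimes>\<^sub>a \<one> X) \<cdot> (mul A \<otimes>\<^sub>a \<one> (obj A \<otimes> X)) \<cdot>
      (\<one> (obj A) \<otimes>\<^sub>a (\<one> (obj A) \<otimes>\<^sub>a \<kappa>))"
    using ten_interchange[of "mul A" "obj A" "obj A" \<kappa> "obj A \<otimes> X"] by simp
  also have "\<dots> = (mul A \<otimes>\<^sub>a \<one> X) \<cdot> (\<one> (obj A) \<otimes>\<^sub>a wreath_mul)"
    by (simp add: reassoc[OF mul_assoc_X] wreath_mul_\<kappa>)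
  finally show ?thesis .
qed

text \<open>The balancedness \<open>x (a y) = (x a) y\<close> for \<open>x\<close> in \<open>X\<close> and \<open>y\<close> in \<open>A \<otimes> X\<close>, which is the
  compatibility of \<open>\<psi>\<close> with the multiplication of \<open>A\<close>. It extends to all of \<open>A \<otimes> X\<close> in place of
  \<open>X\<close> in \<open>wreath_mul_balanced\<close> by left linearity.\<close>

lemma \<kappa>_mul: "\<kappa> \<cdot> (\<one> X \<otimes>\<^sub>a (mul A \<otimes>\<^sub>a \<one> X)) = wreath_mul \<cdot> (\<psi> \<otimes>\<^sub>a \<one> (obj A \<otimes> X))"
proof -
  have "\<kappa> \<cdot> (\<one> X \<otimes>\<^sub>a (mul A \<otimes>\<^sub>a \<one> X)) =
      (mul A \<otimes>\<^sub>a \<one> X) \<cdot> (\<one> (obj A) \<otimes>\<^sub>a \<zeta>) \<cdot> ((\<psi> \<cdot> (\<one> X \<otimes>\<^sub>a mul A)) \<otimes>\<^sub>a \<one> X)"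
    unfolding \<kappa>_def by (simp add: ten_assoc_ar[symmetric] del: ten_assoc_ar)
  also have "\<dots> = (mul A \<otimes>\<^sub>a \<one> X) \<cdot> (\<one> (obj A) \<otimes>\<^sub>a \<zeta>) \<cdot> ((mul A \<otimes>\<^sub>a \<one> X) \<otimes>\<^sub>a \<one> X) \<cdot>
      ((\<one> (obj A) \<otimes>\<^sub>a \<psi>) \<otimes>\<^sub>a \<one> X) \<cdot> ((\<psi> \<otimes>\<^sub>a \<one> (obj A)) \<otimes>\<^sub>a \<one> X)"
    unfolding psi_mul by (simp del: ten_assoc_ar)
  also have "\<dots> = wreath_mul \<cdot> (\<psi> \<otimes>\<^sub>a \<one> (obj A \<otimes> X))"
    by (simp add: wreath_mul_def reassoc[OF ten_comp'])
  finally show ?thesis .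
qed

lemma wreath_mul_balanced:
  "wreath_mul \<cdot> (((mul A \<otimes>\<^sub>a \<one> X) \<cdot> (\<one> (obj A) \<otimes>\<^sub>a \<psi>)) \<otimes>\<^sub>a \<one> (obj A \<otimes> X)) =
    wreath_mul \<cdot> (\<one> (obj A \<otimes> X) \<otimes>\<^sub>a (mul A \<otimes>\<^sub>a \<one> X))"
proof -
  have "((mul A \<otimes>\<^sub>a \<one> X) \<cdot> (\<one> (obj A) \<otimes>\<^sub>a \<psi>)) \<otimes>\<^sub>a \<one> (obj A \<otimes> X) =
      ((mul A \<otimes>\<^sub>a \<one> X) \<otimes>\<^sub>a \<one> (obj A \<otimes> X)) \<cdot> ((\<one> (obj A) \<otimes>\<^sub>a \<psi>) \<otimes>\<^sub>a \<one> (obj A \<otimes> X))"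
    by (simp del: ten_assoc_ar)
  then have "wreath_mul \<cdot> (((mul A \<otimes>\<^sub>a \<one> X) \<cdot> (\<one> (obj A) \<otimes>\<^sub>a \<psi>)) \<otimes>\<^sub>a \<one> (obj A \<otimes> X)) =
      wreath_mul \<cdot> (mul A \<otimes>\<^sub>a \<one> (X \<otimes> (obj A \<otimes> X))) \<cdot> (\<one> (obj A) \<otimes>\<^sub>a (\<psi> \<otimes>\<^sub>a \<one> (obj A \<otimes> X)))"
    by simp
  also have "\<dots> = (mul A \<otimes>\<^sub>a \<one> X) \<cdot> (\<one> (obj A) \<otimes>\<^sub>a (\<kappa> \<cdot> (\<one> X \<otimes>\<^sub>a (mul A \<otimes>\<^sub>a \<one> X))))"
    by (simp add: reassoc[OF wreath_mul_left] \<kappa>_mul)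
  also have "\<dots> = wreath_mul \<cdot> (\<one> (obj A) \<otimes>\<^sub>a (\<one> X \<otimes>\<^sub>a (mul A \<otimes>\<^sub>a \<one> X)))"
    by (simp add: wreath_mul_\<kappa>)
  also have "\<one> (obj A) \<otimes>\<^sub>a (\<one> X \<otimes>\<^sub>a (mul A \<otimes>\<^sub>a \<one> X)) = \<one> (obj A \<otimes> X) \<otimes>\<^sub>a (mul A \<otimes>\<^sub>a \<one> X)"
    using ten_assoc_ar[of "\<one> (obj A)" "\<one> X" "mul A \<otimes>\<^sub>a \<one> X"] by simp
  finally show ?thesis .
qed

text \<open>The multiplication of the ring is given by a composite in which \<open>\<zeta>\<close> is applied after the
  multiplication of \<open>A\<close> instead of beside it.\<close>

lemma wreath_mul_alt:
  "(mul A \<otimes>\<^sub>a \<one> X) \<cdot> (\<one> (obj A) \<otimes>\<^sub>a \<zeta>) \<cdot> (mul A \<otimes>\<^sub>a \<one> X \<otimes>\<^sub>a \<one> X) \<cdot> (\<one> (obj A) \<otimes>\<^sub>a \<psi> \<otimes>\<^sub>a \<one> X) =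
    wreath_mul"
  by (simp add: wreath_mul_def reassoc[OF ten_comp'])

lemma unit_sigma: "((mul A \<otimes>\<^sub>a \<one> X) \<cdot> (\<one> (obj A) \<otimes>\<^sub>a \<sigma>)) \<cdot> unt A = \<sigma>"
proof -
  have "(\<one> (obj A) \<otimes>\<^sub>a \<sigma>) \<cdot> (unt A \<otimes>\<^sub>a \<one> (unitO C)) =
      (unt A \<otimes>\<^sub>a \<one> (obj A \<otimes> X)) \<cdot> (\<one> (unitO C) \<otimes>\<^sub>a \<sigma>)"
    by (simp del: ten_lunit_ar ten_runit_ar)
  then have 1: "(\<one> (obj A) \<otimes>\<^sub>a \<sigma>) \<cdot> unt A = (unt A \<otimes>\<^sub>a \<one> (obj A \<otimes> X)) \<cdot> \<sigma>"
    by (simp del: ten_comp')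
  have "(mul A \<otimes>\<^sub>a \<one> X) \<cdot> ((unt A \<otimes>\<^sub>a \<one> (obj A)) \<otimes>\<^sub>a \<one> X) = \<one> (obj A \<otimes> X)"
    using alg by (simp add: algebra_def del: ten_assoc_ar)
  then have 2: "(mul A \<otimes>\<^sub>a \<one> X) \<cdot> (unt A \<otimes>\<^sub>a \<one> (obj A \<otimes> X)) = \<one> (obj A \<otimes> X)"
    by simp
  show ?thesis
    by (simp add: 1 reassoc[OF 2])
qed

end

theorem theorem4p4:
  fixes C :: "('o, 'a) moncat" and D :: "('m, 'n, 'o, 'a) rcat"
    and A :: "('o, 'a) alg" and X :: 'o and \<psi> \<zeta> \<sigma> :: 'a
  assumes "strict_monoidal_category C" and "has_coequalizers C"
    and "strict_right_category C D" and "has_coequalizers D"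
    and "wreath C A X \<psi> \<zeta> \<sigma>"
    and "compatible_ring C D A (wreath_ring C A X \<psi> \<zeta> \<sigma>)"
  shows "isomorphic_categories
    (ring_rmod_cat C D A (wreath_ring C A X \<psi> \<zeta> \<sigma>))
    (rmod_cat C D (wreath_product C A X \<psi> \<zeta> \<sigma>))"
proof -
  interpret wreath C A X \<psi> \<zeta> \<sigma> by (fact assms(5))
  let ?Y = "obj A \<otimes>\<^bsub>C\<^esub> X" and ?l = "mul A \<otimes>\<^sub>a\<^bsub>C\<^esub> \<one>\<^bsub>C\<^esub> X"
  let ?r = "(mul A \<otimes>\<^sub>a\<^bsub>C\<^esub> \<one>\<^bsub>C\<^esub> X) \<cdot>\<^bsub>C\<^esub> (\<one>\<^bsub>C\<^esub> (obj A) \<otimes>\<^sub>a\<^bsub>C\<^esub> \<psi>)"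
  let ?q = "qmap C (regular C) (?Y, ?r) (?Y, ?l)"
  let ?m = "factor C ?q wreath_mul"
  let ?u = "(mul A \<otimes>\<^sub>a\<^bsub>C\<^esub> \<one>\<^bsub>C\<^esub> X) \<cdot>\<^bsub>C\<^esub> (\<one>\<^bsub>C\<^esub> (obj A) \<otimes>\<^sub>a\<^bsub>C\<^esub> \<sigma>)"
  have ring: "wreath_ring C A X \<psi> \<zeta> \<sigma> = \<lparr>obj = (?Y, ?l, ?r),
      mul = (bimod_ten C A (?Y, ?l, ?r) (?Y, ?l, ?r), ?m, (?Y, ?l, ?r)),
      unt = (unit_bimod A, ?u, (?Y, ?l, ?r))\<rparr>"
    by (simp only: wreath_ring_def wreath_bimod_def Let_def wreath_mul_alt left_part.simps
        right_part.simps)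
  interpret ring_over_algebra C D A ?Y ?l ?r ?m ?u
    using assms alg unfolding ring
    by (simp add: ring_over_algebra_def ring_over_algebra_axioms_def
        algebra_in_right_category_def algebra_in_right_category_axioms_def)
  have "is_coequalizer C (?r \<otimes>\<^sub>a\<^bsub>C\<^esub> \<one>\<^bsub>C\<^esub> ?Y) (\<one>\<^bsub>C\<^esub> ?Y \<otimes>\<^sub>a\<^bsub>C\<^esub> ?l) ?q"
    using algebra_in_right_category.qmap_coequalizer[OF regular_algebra right_Y left_Y] by simp
  from coequalizer_factor(4)[OF this _ _ wreath_mul_balanced] have "?m \<cdot>\<^bsub>C\<^esub> ?q = wreath_mul"
    using qY_ar by simp
  then have "wreath_product C A X \<psi> \<zeta> \<sigma> = \<lparr>obj = ?Y, mul = ?m \<cdot>\<^bsub>C\<^esub> ?q, unt = ?u \<cdot>\<^bsub>C\<^esub> unt A\<rparr>"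
    by (simp only: wreath_product_def wreath_mul_def unit_sigma)
  then show ?thesis
    using ring_modules_isomorphic unfolding ring by simp
qed

end
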